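(* Let $(\widetilde{M},\phi,\xi,\eta,\widetilde{g},\varepsilon)$ be an $(n+2)$-dimensional $(\varepsilon)$-para Sasakian manifold and let $M$ be a screen semi-invariant lightlike hypersurface of $\widetilde{M}$ (with screen distribution $S(TM)$ containing $\xi$). Then the distribution $D\perp\langle\xi\rangle$ on $M$ is integrable if and only if $$B(X,\varphi Y)=B(\varphi X,Y)\qquad\text{for all } X,Y\in\Gamma(D).$$
   Context: An $(\varepsilon)$-almost paracontact metric manifold $(\widetilde{M},\phi,\xi,\eta,\widetilde{g},\varepsilon)$, $\varepsilon\in\{1,-1\}$, is a smooth manifold $\widetilde{M}$ with a $(1,1)$-tensor field $\phi$, a vector field $\xi$, a 1-form $\eta$ and a semi-Riemannian metric $\widetilde{g}$ such that $\phi^2=I-\eta\otimes\xi$, $\eta(\xi)=1$, $\phi\xi=0$, $\eta\circ\phi=0$, and $\widetilde{g}(\phi X,\phi Y)=\widetilde{g}(X,Y)-\varepsilon\eta(X)\eta(Y)$ for all $X,Y$. It is $(\varepsilon)$-para Sasakian if, with $\widetilde{\nabla}$ the Levi-Civita connection of $\widetilde{g}$, $(\widetilde{\nabla}_X\phi)Y=-\widetilde{g}(\phi X,\phi Y)\xi-\varepsilon\eta(Y)\phi^2X$ for all $X,Y\in\Gamma(T\widetilde{M})$; in such a manifold $\widetilde{\nabla}_X\xi=\varepsilon\phi X$. A lightlike hypersurface $M$ of $\widetilde{M}$ is a hypersurface on which the induced metric $g=\widetilde{g}|_M$ is degenerate at every point; then the radical distribution $Rad\,TM=TM\cap TM^{\perp}=TM^\perp$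 has rank 1. A screen distribution $S(TM)$ is a fixed (automatically non-degenerate) complement of $Rad\,TM$ in $TM$. For a local nowhere-zero section $E$ of $Rad\,TM$ there is a unique local section $N$ of $S(TM)^\perp\subset T\widetilde{M}$ with $\widetilde{g}(N,N)=0$, $\widetilde{g}(E,N)=1$; the line bundle $ltr\,TM$ spanned locally by $N$ is the lightlike transversal bundle, and $T\widetilde{M}|_M=TM\oplus ltr\,TM$. Standing assumption: $\xi$ is tangent to $M$ and belongs to $\Gamma(S(TM))$. For $X,Y\in\Gamma(TM)$ write $\widetilde{\nabla}_XY=\nabla_XY+B(X,Y)N$ with $\nabla_XY\in\Gamma(TM)$ (so $B$ is the symmetric second fundamental form), and $\phi X=\varphi X+u(X)N$ with $\varphi X\in\Gamma(TM)$ and $u(X)=\widetilde{g}(\phi X,E)=\widetilde{g}(X,\phi E)$. $M$ is screen semi-invariant if $\phi(Rad\,TM)\subset S(TM)$ and $\phi(ltr\,TM)\subset S(TM)$. In that case put $V=\phi E$, $U=\phi N$; then $g(V,U)=1$ and $S(TM)=D_0\perp\{\langle V\rangle\oplus\langle U\rangle\}\perp\langle\xi\rangle$ for a non-degenerate $\phi$-invariant distribution $D_0$ of rank $n-3$ (the orthogonal complement of $V,U,\xi$ in $S(TM)$). Set $D=D_0\perp Rad\,TM\perp\langle V\rangle$ and $D'=\langle U\rangle$, so $TM=D\oplus D'\perp\langle\xi\rangle$. Here $\langle\cdot\rangle$ denotes the distribution spanned and $\perp$ an orthogonal direct sum. *)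

theory Defs
  imports "HOL-Analysis.Analysis"
begin

section \<open>Smooth maps between Euclidean spaces\<close>

text \<open>Meant for open sets. In finite dimension, a map is of class $C^{k+1}$ iff it is differentiable
  and all its directional derivatives are of class $C^k$.\<close>

fun Ck_on :: "nat \<Rightarrow> 'a::euclidean_space set \<Rightarrow> ('a \<Rightarrow> 'b::real_normed_vector) \<Rightarrow> bool" where
  "Ck_on 0 S f \<longleftrightarrow> continuous_on S f"
| "Ck_on (Suc k) S f \<longleftrightarrow>
     (\<forall>x\<in>S. f differentiable (at x)) \<and> (\<forall>v. Ck_on k S (\<lambda>x. frechet_derivative f (at x) v))"

definition smooth_on :: "'a::euclidean_space set \<Rightarrow> ('a \<Rightarrow> 'b::real_normed_vector) \<Rightarrow> bool" where
  "smooth_on S f \<longleftrightarrow> (\<forall>k. Ck_on k S f)"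

section \<open>Smooth manifolds\<close>

text \<open>A smooth manifold is a Hausdorff, second countable space (the sort of the type \<open>'m\<close>) with
  an atlas of charts into \<open>'e\<close>, which need not be maximal. A chart is a pair of its domain and its
  coordinate map.\<close>

type_synonym ('m, 'e) chart = "'m set \<times> ('m \<Rightarrow> 'e)"

abbreviation chart_inv :: "('m, 'e) chart \<Rightarrow> 'e \<Rightarrow> 'm" where
  "chart_inv c \<equiv> inv_into (fst c) (snd c)"

definition transition :: "('m, 'e) chart \<Rightarrow> ('m, 'e) chart \<Rightarrow> 'e \<Rightarrow> 'e" where
  "transition c d = snd d \<circ> chart_inv c"

definition topological_chart :: "('m::topological_space, 'e::euclidean_space) chart \<Rightarrow> bool" where
  "topological_chart c \<longleftrightarrow> open (fst c) \<and> open (snd c ` fst c) \<and>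
     homeomorphism (fst c) (snd c ` fst c) (snd c) (chart_inv c)"

definition smooth_atlas ::
  "('m::{t2_space,second_countable_topology}, 'e::euclidean_space) chart set \<Rightarrow> bool" where
  "smooth_atlas A \<longleftrightarrow>
     (\<forall>c\<in>A. topological_chart c) \<and> (\<Union>c\<in>A. fst c) = UNIV \<and>
     (\<forall>c\<in>A. \<forall>d\<in>A. smooth_on (snd c ` (fst c \<inter> fst d)) (transition c d))"

text \<open>The tangent space at \<open>p\<close> is represented by the model space \<open>'e\<close>: a tangent vector at \<open>p\<close> is
  given by its coordinates in the chart \<open>chart_at A p\<close>, selected once and for all. Its coordinates
  in another chart \<open>c\<close> around \<open>p\<close> are \<open>coords A c p v\<close>; conversely \<open>coord_field A c x\<close> is the vector
  field on the domain of \<open>c\<close> with constant coordinates \<open>x\<close> in \<open>c\<close> (a constant combination of the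
  coordinate vector fields). A vector field is thus a function \<open>'m \<Rightarrow> 'e\<close>, a distribution a function
  \<open>'m \<Rightarrow> 'e set\<close>, and so on; smoothness is always tested in the charts of the atlas.\<close>

definition chart_at :: "('m, 'e) chart set \<Rightarrow> 'm \<Rightarrow> ('m, 'e) chart" where
  "chart_at A p = (SOME c. c \<in> A \<and> p \<in> fst c)"

definition coords ::
  "('m, 'e::euclidean_space) chart set \<Rightarrow> ('m, 'e) chart \<Rightarrow> 'm \<Rightarrow> 'e \<Rightarrow> 'e" where
  "coords A c p v =
     frechet_derivative (transition (chart_at A p) c) (at (snd (chart_at A p) p)) v"

definition coord_field ::
  "('m, 'e::euclidean_space) chart set \<Rightarrow> ('m, 'e) chart \<Rightarrow> 'e \<Rightarrow> 'm \<Rightarrow> 'e" where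
  "coord_field A c x p = frechet_derivative (transition c (chart_at A p)) (at (snd c p)) x"

definition smooth_fun ::
  "('m, 'e::euclidean_space) chart set \<Rightarrow> 'm set \<Rightarrow> ('m \<Rightarrow> real) \<Rightarrow> bool" where
  "smooth_fun A W f \<longleftrightarrow> (\<forall>c\<in>A. smooth_on (snd c ` (fst c \<inter> W)) (f \<circ> chart_inv c))"

definition smooth_field ::
  "('m, 'e::euclidean_space) chart set \<Rightarrow> 'm set \<Rightarrow> ('m \<Rightarrow> 'e) \<Rightarrow> bool" where
  "smooth_field A W X \<longleftrightarrow>
     (\<forall>c\<in>A. smooth_on (snd c ` (fst c \<inter> W)) ((\<lambda>q. coords A c q (X q)) \<circ> chart_inv c))"

definition smooth_fun_near ::
  "('m::topological_space, 'e::euclidean_space) chart set \<Rightarrow> 'm \<Rightarrow> ('m \<Rightarrow> real) \<Rightarrow> bool" where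
  "smooth_fun_near A p f \<longleftrightarrow> (\<exists>W. open W \<and> p \<in> W \<and> smooth_fun A W f)"

definition smooth_field_near ::
  "('m::topological_space, 'e::euclidean_space) chart set \<Rightarrow> 'm \<Rightarrow> ('m \<Rightarrow> 'e) \<Rightarrow> bool" where
  "smooth_field_near A p X \<longleftrightarrow> (\<exists>W. open W \<and> p \<in> W \<and> smooth_field A W X)"

text \<open>The derivative of the function \<open>f\<close> in the direction of \<open>v\<close>, a tangent vector at \<open>p\<close>.\<close>

definition dir_deriv ::
  "('m, 'e::euclidean_space) chart set \<Rightarrow> ('m \<Rightarrow> real) \<Rightarrow> 'm \<Rightarrow> 'e \<Rightarrow> real" where
  "dir_deriv A f p v =
     frechet_derivative (f \<circ> chart_inv (chart_at A p)) (at (snd (chart_at A p) p)) v"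

definition lie_bracket ::
  "('m, 'e::euclidean_space) chart set \<Rightarrow> ('m \<Rightarrow> 'e) \<Rightarrow> ('m \<Rightarrow> 'e) \<Rightarrow> 'm \<Rightarrow> 'e" where
  "lie_bracket A X Y p = (let c = chart_at A p in
     frechet_derivative ((\<lambda>q. coords A c q (Y q)) \<circ> chart_inv c) (at (snd c p)) (X p) -
     frechet_derivative ((\<lambda>q. coords A c q (X q)) \<circ> chart_inv c) (at (snd c p)) (Y p))"

section \<open>Distributions\<close>

definition smooth_distribution ::
  "('m::topological_space, 'e::euclidean_space) chart set \<Rightarrow> ('m \<Rightarrow> 'e set) \<Rightarrow> bool" where
  "smooth_distribution A D \<longleftrightarrow>
     (\<forall>p. \<exists>W k F. open W \<and> p \<in> W \<and> (\<forall>j<k::nat. smooth_field A W (F j)) \<and>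
        (\<forall>q\<in>W. D q = span ((\<lambda>j. F j q) ` {..<k}) \<and> dim (D q) = k))"

definition section_on ::
  "('m, 'e::euclidean_space) chart set \<Rightarrow> ('m \<Rightarrow> 'e set) \<Rightarrow> 'm set \<Rightarrow> ('m \<Rightarrow> 'e) \<Rightarrow> bool" where
  "section_on A D W X \<longleftrightarrow> smooth_field A W X \<and> (\<forall>p\<in>W. X p \<in> D p)"

text \<open>An integral manifold of \<open>D\<close> is a submanifold \<open>S\<close> whose tangent space at each of its points
  is the value of \<open>D\<close>: each point of \<open>S\<close> has a chart \<open>c\<close> (compatible with the atlas) in which \<open>S\<close> is
  a slice parallel to a linear subspace \<open>L\<close>, so that the tangent space to \<open>S\<close> at a point of the
  domain of \<open>c\<close> consists of the vectors whose coordinates in \<open>c\<close> lie in \<open>L\<close>.\<close>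

definition integral_manifold ::
  "('m::{t2_space,second_countable_topology}, 'e::euclidean_space) chart set \<Rightarrow>
   ('m \<Rightarrow> 'e set) \<Rightarrow> 'm set \<Rightarrow> bool" where
  "integral_manifold A D S \<longleftrightarrow>
     (\<forall>p\<in>S. \<exists>c L. smooth_atlas (insert c A) \<and> p \<in> fst c \<and> subspace L \<and>
        S \<inter> fst c = {q \<in> fst c. snd c q - snd c p \<in> L} \<and>
        (\<forall>q \<in> S \<inter> fst c. D q = {v. coords A c q v \<in> L}))"

definition integrable_distribution ::
  "('m::{t2_space,second_countable_topology}, 'e::euclidean_space) chart set \<Rightarrow>
   ('m \<Rightarrow> 'e set) \<Rightarrow> bool" where
  "integrable_distribution A D \<longleftrightarrow> (\<forall>p. \<exists>S. p \<in> S \<and> integral_manifold A D S)"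

section \<open>Semi-Riemannian metrics and the Levi-Civita connection\<close>

definition semi_riemannian_metric ::
  "('m, 'e::euclidean_space) chart set \<Rightarrow> ('m \<Rightarrow> 'e \<Rightarrow> 'e \<Rightarrow> real) \<Rightarrow> bool" where
  "semi_riemannian_metric A g \<longleftrightarrow>
     (\<forall>p. bilinear (g p) \<and> (\<forall>x y. g p x y = g p y x) \<and> (\<forall>x. (\<forall>y. g p x y = 0) \<longrightarrow> x = 0)) \<and>
     (\<forall>c\<in>A. \<forall>x y. smooth_fun A (fst c) (\<lambda>q. g q (coord_field A c x q) (coord_field A c y q)))"

text \<open>\<open>nabla p v Y\<close> is the covariant derivative at \<open>p\<close>, in the direction of the tangent vector \<open>v\<close>
  at \<open>p\<close>, of a vector field \<open>Y\<close> that is smooth near \<open>p\<close>. Locality in \<open>Y\<close> follows from the Leibniz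
  rule.\<close>

definition affine_connection ::
  "('m::topological_space, 'e::euclidean_space) chart set \<Rightarrow>
   ('m \<Rightarrow> 'e \<Rightarrow> ('m \<Rightarrow> 'e) \<Rightarrow> 'e) \<Rightarrow> bool" where
  "affine_connection A nabla \<longleftrightarrow>
     (\<forall>p Y. smooth_field_near A p Y \<longrightarrow> linear (\<lambda>v. nabla p v Y)) \<and>
     (\<forall>p v Y Z. smooth_field_near A p Y \<and> smooth_field_near A p Z \<longrightarrow>
        nabla p v (\<lambda>q. Y q + Z q) = nabla p v Y + nabla p v Z) \<and>
     (\<forall>p v f Y. smooth_fun_near A p f \<and> smooth_field_near A p Y \<longrightarrow>
        nabla p v (\<lambda>q. f q *\<^sub>R Y q) = dir_deriv A f p v *\<^sub>R Y p + f p *\<^sub>R nabla p v Y) \<and>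
     (\<forall>W X Y. open W \<and> smooth_field A W X \<and> smooth_field A W Y \<longrightarrow>
        smooth_field A W (\<lambda>p. nabla p (X p) Y))"

definition levi_civita ::
  "('m::topological_space, 'e::euclidean_space) chart set \<Rightarrow> ('m \<Rightarrow> 'e \<Rightarrow> 'e \<Rightarrow> real) \<Rightarrow>
   ('m \<Rightarrow> 'e \<Rightarrow> ('m \<Rightarrow> 'e) \<Rightarrow> 'e) \<Rightarrow> bool" where
  "levi_civita A g nabla \<longleftrightarrow> affine_connection A nabla \<and>
     (\<forall>p X Y. smooth_field_near A p X \<and> smooth_field_near A p Y \<longrightarrow>
        nabla p (X p) Y - nabla p (Y p) X = lie_bracket A X Y p) \<and>
     (\<forall>p v Y Z. smooth_field_near A p Y \<and> smooth_field_near A p Z \<longrightarrow>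
        dir_deriv A (\<lambda>q. g q (Y q) (Z q)) p v = g p (nabla p v Y) (Z p) + g p (Y p) (nabla p v Z))"

section \<open>Almost paracontact metric and para Sasakian manifolds\<close>

definition eps_almost_paracontact_metric ::
  "('m, 'e::euclidean_space) chart set \<Rightarrow> ('m \<Rightarrow> 'e \<Rightarrow> 'e) \<Rightarrow> ('m \<Rightarrow> 'e) \<Rightarrow> ('m \<Rightarrow> 'e \<Rightarrow> real) \<Rightarrow>
   ('m \<Rightarrow> 'e \<Rightarrow> 'e \<Rightarrow> real) \<Rightarrow> real \<Rightarrow> bool" where
  "eps_almost_paracontact_metric A \<phi> \<xi> \<eta> g \<epsilon> \<longleftrightarrow>
     \<epsilon> \<in> {1, -1} \<and>
     (\<forall>p. linear (\<phi> p)) \<and> (\<forall>c\<in>A. \<forall>x. smooth_field A (fst c) (\<lambda>q. \<phi> q (coord_field A c x q))) \<and>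
     smooth_field A UNIV \<xi> \<and>
     (\<forall>p. linear (\<eta> p)) \<and> (\<forall>c\<in>A. \<forall>x. smooth_fun A (fst c) (\<lambda>q. \<eta> q (coord_field A c x q))) \<and>
     semi_riemannian_metric A g \<and>
     (\<forall>p x. \<phi> p (\<phi> p x) = x - \<eta> p x *\<^sub>R \<xi> p) \<and>
     (\<forall>p. \<eta> p (\<xi> p) = 1) \<and> (\<forall>p. \<phi> p (\<xi> p) = 0) \<and> (\<forall>p x. \<eta> p (\<phi> p x) = 0) \<and>
     (\<forall>p x y. g p (\<phi> p x) (\<phi> p y) = g p x y - \<epsilon> * \<eta> p x * \<eta> p y)"

definition eps_para_sasakian ::
  "('m::topological_space, 'e::euclidean_space) chart set \<Rightarrow> ('m \<Rightarrow> 'e \<Rightarrow> 'e) \<Rightarrow> ('m \<Rightarrow> 'e) \<Rightarrow>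
   ('m \<Rightarrow> 'e \<Rightarrow> real) \<Rightarrow> ('m \<Rightarrow> 'e \<Rightarrow> 'e \<Rightarrow> real) \<Rightarrow> real \<Rightarrow>
   ('m \<Rightarrow> 'e \<Rightarrow> ('m \<Rightarrow> 'e) \<Rightarrow> 'e) \<Rightarrow> bool" where
  "eps_para_sasakian A \<phi> \<xi> \<eta> g \<epsilon> nabla \<longleftrightarrow>
     eps_almost_paracontact_metric A \<phi> \<xi> \<eta> g \<epsilon> \<and> levi_civita A g nabla \<and>
     (\<forall>p v Y. smooth_field_near A p Y \<longrightarrow>
        nabla p v (\<lambda>q. \<phi> q (Y q)) - \<phi> p (nabla p v Y) =
        - g p (\<phi> p v) (\<phi> p (Y p)) *\<^sub>R \<xi> p - (\<epsilon> * \<eta> p (Y p)) *\<^sub>R \<phi> p (\<phi> p v))"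

section \<open>Immersed hypersurfaces\<close>

text \<open>From here on, \<open>A'\<close> is the atlas of the hypersurface, \<open>A\<close> that of the ambient manifold, and
  \<open>\<iota>\<close> the immersion of the former into the latter (the inclusion, in the embedded case).\<close>

definition smooth_map ::
  "('n::topological_space, 'h::euclidean_space) chart set \<Rightarrow>
   ('m::topological_space, 'e::euclidean_space) chart set \<Rightarrow> ('n \<Rightarrow> 'm) \<Rightarrow> bool" where
  "smooth_map A' A f \<longleftrightarrow> continuous_on UNIV f \<and>
     (\<forall>c\<in>A'. \<forall>d\<in>A. smooth_on (snd c ` (fst c \<inter> f -` fst d)) (snd d \<circ> f \<circ> chart_inv c))"

definition differential ::
  "('n, 'h::euclidean_space) chart set \<Rightarrow> ('m, 'e::euclidean_space) chart set \<Rightarrow> ('n \<Rightarrow> 'm) \<Rightarrow>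
   'n \<Rightarrow> 'h \<Rightarrow> 'e" where
  "differential A' A f p x =
     frechet_derivative (snd (chart_at A (f p)) \<circ> f \<circ> chart_inv (chart_at A' p))
       (at (snd (chart_at A' p) p)) x"

definition immersed_hypersurface ::
  "('n::topological_space, 'h::euclidean_space) chart set \<Rightarrow>
   ('m::topological_space, 'e::euclidean_space) chart set \<Rightarrow> ('n \<Rightarrow> 'm) \<Rightarrow> bool" where
  "immersed_hypersurface A' A \<iota> \<longleftrightarrow>
     DIM('e) = DIM('h) + 1 \<and> smooth_map A' A \<iota> \<and> (\<forall>p. inj (differential A' A \<iota> p))"

text \<open>The connection induced on ambient vector fields along the immersion: \<open>Z q\<close> is an ambient
  tangent vector at \<open>\<iota> q\<close>, and \<open>w\<close> is tangent to the hypersurface at \<open>p\<close>. Writing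
  $Z = \sum_a Z^a\,(\partial_a \circ \iota)$ in the coordinate frame of the chart at \<open>\<iota> p\<close>, this is the usual
  $\sum_a (w Z^a)\,\partial_a + Z^a\,\widetilde\nabla_{d\iota(w)} \partial_a$.\<close>

definition cov_along ::
  "('n, 'h::euclidean_space) chart set \<Rightarrow> ('m, 'e::euclidean_space) chart set \<Rightarrow> ('n \<Rightarrow> 'm) \<Rightarrow>
   ('m \<Rightarrow> 'e \<Rightarrow> ('m \<Rightarrow> 'e) \<Rightarrow> 'e) \<Rightarrow> 'n \<Rightarrow> 'h \<Rightarrow> ('n \<Rightarrow> 'e) \<Rightarrow> 'e" where
  "cov_along A' A \<iota> nabla p w Z = (let c = chart_at A' p; d = chart_at A (\<iota> p) in
     frechet_derivative ((\<lambda>q. coords A d (\<iota> q) (Z q)) \<circ> chart_inv c) (at (snd c p)) w +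
     nabla (\<iota> p) (differential A' A \<iota> p w) (coord_field A d (Z p)))"

definition induced_metric ::
  "('n, 'h::euclidean_space) chart set \<Rightarrow> ('m, 'e::euclidean_space) chart set \<Rightarrow> ('n \<Rightarrow> 'm) \<Rightarrow>
   ('m \<Rightarrow> 'e \<Rightarrow> 'e \<Rightarrow> real) \<Rightarrow> 'n \<Rightarrow> 'h \<Rightarrow> 'h \<Rightarrow> real" where
  "induced_metric A' A \<iota> g p x y =
     g (\<iota> p) (differential A' A \<iota> p x) (differential A' A \<iota> p y)"

section \<open>Lightlike hypersurfaces\<close>

definition Rad ::
  "('n, 'h::euclidean_space) chart set \<Rightarrow> ('m, 'e::euclidean_space) chart set \<Rightarrow> ('n \<Rightarrow> 'm) \<Rightarrow>
   ('m \<Rightarrow> 'e \<Rightarrow> 'e \<Rightarrow> real) \<Rightarrow> 'n \<Rightarrow> 'h set" where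
  "Rad A' A \<iota> g p = {x. \<forall>y. induced_metric A' A \<iota> g p x y = 0}"

definition lightlike_hypersurface ::
  "('n::topological_space, 'h::euclidean_space) chart set \<Rightarrow>
   ('m::topological_space, 'e::euclidean_space) chart set \<Rightarrow> ('n \<Rightarrow> 'm) \<Rightarrow>
   ('m \<Rightarrow> 'e \<Rightarrow> 'e \<Rightarrow> real) \<Rightarrow> bool" where
  "lightlike_hypersurface A' A \<iota> g \<longleftrightarrow>
     immersed_hypersurface A' A \<iota> \<and> (\<forall>p. \<exists>x. x \<noteq> 0 \<and> x \<in> Rad A' A \<iota> g p)"

definition screen_distribution ::
  "('n::topological_space, 'h::euclidean_space) chart set \<Rightarrow>
   ('m, 'e::euclidean_space) chart set \<Rightarrow> ('n \<Rightarrow> 'm) \<Rightarrow>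
   ('m \<Rightarrow> 'e \<Rightarrow> 'e \<Rightarrow> real) \<Rightarrow> ('n \<Rightarrow> 'h set) \<Rightarrow> bool" where
  "screen_distribution A' A \<iota> g S \<longleftrightarrow> smooth_distribution A' S \<and>
     (\<forall>p. S p \<inter> Rad A' A \<iota> g p = {0} \<and> {s + r | s r. s \<in> S p \<and> r \<in> Rad A' A \<iota> g p} = UNIV)"

text \<open>\<open>is_transversal A' A \<iota> g S p e N\<close>: \<open>N\<close> is the lightlike transversal vector at \<open>p\<close> that is
  associated with \<open>S\<close> and normalised by the nonzero vector \<open>e\<close> of the radical.\<close>

definition is_transversal ::
  "('n, 'h::euclidean_space) chart set \<Rightarrow> ('m, 'e::euclidean_space) chart set \<Rightarrow> ('n \<Rightarrow> 'm) \<Rightarrow>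
   ('m \<Rightarrow> 'e \<Rightarrow> 'e \<Rightarrow> real) \<Rightarrow> ('n \<Rightarrow> 'h set) \<Rightarrow> 'n \<Rightarrow> 'h \<Rightarrow> 'e \<Rightarrow> bool" where
  "is_transversal A' A \<iota> g S p e N \<longleftrightarrow>
     (\<forall>s\<in>S p. g (\<iota> p) N (differential A' A \<iota> p s) = 0) \<and>
     g (\<iota> p) N N = 0 \<and> g (\<iota> p) (differential A' A \<iota> p e) N = 1"

definition transversal ::
  "('n, 'h::euclidean_space) chart set \<Rightarrow> ('m, 'e::euclidean_space) chart set \<Rightarrow> ('n \<Rightarrow> 'm) \<Rightarrow>
   ('m \<Rightarrow> 'e \<Rightarrow> 'e \<Rightarrow> real) \<Rightarrow> ('n \<Rightarrow> 'h set) \<Rightarrow> 'n \<Rightarrow> 'h \<Rightarrow> 'e" where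
  "transversal A' A \<iota> g S p e = (THE N. is_transversal A' A \<iota> g S p e N)"

definition ltr ::
  "('n, 'h::euclidean_space) chart set \<Rightarrow> ('m, 'e::euclidean_space) chart set \<Rightarrow> ('n \<Rightarrow> 'm) \<Rightarrow>
   ('m \<Rightarrow> 'e \<Rightarrow> 'e \<Rightarrow> real) \<Rightarrow> ('n \<Rightarrow> 'h set) \<Rightarrow> 'n \<Rightarrow> 'e set" where
  "ltr A' A \<iota> g S p = span {N. \<exists>e \<in> Rad A' A \<iota> g p. is_transversal A' A \<iota> g S p e N}"

text \<open>The coefficient \<open>b = B(X, Y)\<close> in the Gauss formula
  $\widetilde\nabla_X Y = \nabla_X Y + B(X,Y) N$ at \<open>p\<close>, with \<open>N\<close> normalised by the local section \<open>E\<close> of the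
  radical distribution.\<close>

definition second_fundamental_form ::
  "('n, 'h::euclidean_space) chart set \<Rightarrow> ('m, 'e::euclidean_space) chart set \<Rightarrow> ('n \<Rightarrow> 'm) \<Rightarrow>
   ('m \<Rightarrow> 'e \<Rightarrow> 'e \<Rightarrow> real) \<Rightarrow> ('n \<Rightarrow> 'h set) \<Rightarrow> ('m \<Rightarrow> 'e \<Rightarrow> ('m \<Rightarrow> 'e) \<Rightarrow> 'e) \<Rightarrow>
   ('n \<Rightarrow> 'h) \<Rightarrow> ('n \<Rightarrow> 'h) \<Rightarrow> ('n \<Rightarrow> 'h) \<Rightarrow> 'n \<Rightarrow> real" where
  "second_fundamental_form A' A \<iota> g S nabla E X Y p =
     (THE b. \<exists>z. cov_along A' A \<iota> nabla p (X p) (\<lambda>q. differential A' A \<iota> q (Y q)) =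
        differential A' A \<iota> p z + b *\<^sub>R transversal A' A \<iota> g S p (E p))"

text \<open>The tangential part of \<open>\<phi>\<close>: $\phi X = \varphi X + u(X) N$ with $\varphi X$ tangent to the
  hypersurface.\<close>

definition phi_tan ::
  "('n, 'h::euclidean_space) chart set \<Rightarrow> ('m, 'e::euclidean_space) chart set \<Rightarrow> ('n \<Rightarrow> 'm) \<Rightarrow>
   ('m \<Rightarrow> 'e \<Rightarrow> 'e \<Rightarrow> real) \<Rightarrow> ('n \<Rightarrow> 'h set) \<Rightarrow> ('m \<Rightarrow> 'e \<Rightarrow> 'e) \<Rightarrow> 'n \<Rightarrow> 'h \<Rightarrow> 'h" where
  "phi_tan A' A \<iota> g S \<phi> p x =
     (THE z. \<exists>N \<in> ltr A' A \<iota> g S p.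
        \<phi> (\<iota> p) (differential A' A \<iota> p x) = differential A' A \<iota> p z + N)"

section \<open>Screen semi-invariant lightlike hypersurfaces\<close>

definition screen_semi_invariant ::
  "('n, 'h::euclidean_space) chart set \<Rightarrow> ('m, 'e::euclidean_space) chart set \<Rightarrow> ('n \<Rightarrow> 'm) \<Rightarrow>
   ('m \<Rightarrow> 'e \<Rightarrow> 'e \<Rightarrow> real) \<Rightarrow> ('n \<Rightarrow> 'h set) \<Rightarrow> ('m \<Rightarrow> 'e \<Rightarrow> 'e) \<Rightarrow> bool" where
  "screen_semi_invariant A' A \<iota> g S \<phi> \<longleftrightarrow>
     (\<forall>p. \<phi> (\<iota> p) ` differential A' A \<iota> p ` Rad A' A \<iota> g p \<subseteq> differential A' A \<iota> p ` S p \<and>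
          \<phi> (\<iota> p) ` ltr A' A \<iota> g S p \<subseteq> differential A' A \<iota> p ` S p)"

text \<open>The lines $\langle V\rangle = \phi(Rad\,TM)$ and $\langle U\rangle = \phi(ltr\,TM)$, as subspaces of the tangent
  space of the hypersurface.\<close>

definition V_line ::
  "('n, 'h::euclidean_space) chart set \<Rightarrow> ('m, 'e::euclidean_space) chart set \<Rightarrow> ('n \<Rightarrow> 'm) \<Rightarrow>
   ('m \<Rightarrow> 'e \<Rightarrow> 'e \<Rightarrow> real) \<Rightarrow> ('m \<Rightarrow> 'e \<Rightarrow> 'e) \<Rightarrow> 'n \<Rightarrow> 'h set" where
  "V_line A' A \<iota> g \<phi> p =
     {x. differential A' A \<iota> p x \<in> \<phi> (\<iota> p) ` differential A' A \<iota> p ` Rad A' A \<iota> g p}"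

definition U_line ::
  "('n, 'h::euclidean_space) chart set \<Rightarrow> ('m, 'e::euclidean_space) chart set \<Rightarrow> ('n \<Rightarrow> 'm) \<Rightarrow>
   ('m \<Rightarrow> 'e \<Rightarrow> 'e \<Rightarrow> real) \<Rightarrow> ('n \<Rightarrow> 'h set) \<Rightarrow> ('m \<Rightarrow> 'e \<Rightarrow> 'e) \<Rightarrow> 'n \<Rightarrow> 'h set" where
  "U_line A' A \<iota> g S \<phi> p = {x. differential A' A \<iota> p x \<in> \<phi> (\<iota> p) ` ltr A' A \<iota> g S p}"

definition xi_line ::
  "('n, 'h::euclidean_space) chart set \<Rightarrow> ('m, 'e::euclidean_space) chart set \<Rightarrow> ('n \<Rightarrow> 'm) \<Rightarrow>
   ('m \<Rightarrow> 'e) \<Rightarrow> 'n \<Rightarrow> 'h set" where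
  "xi_line A' A \<iota> \<xi> p = {x. differential A' A \<iota> p x \<in> span {\<xi> (\<iota> p)}}"

definition D0 ::
  "('n, 'h::euclidean_space) chart set \<Rightarrow> ('m, 'e::euclidean_space) chart set \<Rightarrow> ('n \<Rightarrow> 'm) \<Rightarrow>
   ('m \<Rightarrow> 'e \<Rightarrow> 'e \<Rightarrow> real) \<Rightarrow> ('n \<Rightarrow> 'h set) \<Rightarrow> ('m \<Rightarrow> 'e \<Rightarrow> 'e) \<Rightarrow> ('m \<Rightarrow> 'e) \<Rightarrow> 'n \<Rightarrow> 'h set" where
  "D0 A' A \<iota> g S \<phi> \<xi> p =
     {x \<in> S p. \<forall>y \<in> V_line A' A \<iota> g \<phi> p \<union> U_line A' A \<iota> g S \<phi> p \<union> xi_line A' A \<iota> \<xi> p.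
        induced_metric A' A \<iota> g p x y = 0}"

definition D_dist ::
  "('n, 'h::euclidean_space) chart set \<Rightarrow> ('m, 'e::euclidean_space) chart set \<Rightarrow> ('n \<Rightarrow> 'm) \<Rightarrow>
   ('m \<Rightarrow> 'e \<Rightarrow> 'e \<Rightarrow> real) \<Rightarrow> ('n \<Rightarrow> 'h set) \<Rightarrow> ('m \<Rightarrow> 'e \<Rightarrow> 'e) \<Rightarrow> ('m \<Rightarrow> 'e) \<Rightarrow> 'n \<Rightarrow> 'h set" where
  "D_dist A' A \<iota> g S \<phi> \<xi> p =
     {x + r + v | x r v. x \<in> D0 A' A \<iota> g S \<phi> \<xi> p \<and> r \<in> Rad A' A \<iota> g p \<and> v \<in> V_line A' A \<iota> g \<phi> p}"

definition D_xi ::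
  "('n, 'h::euclidean_space) chart set \<Rightarrow> ('m, 'e::euclidean_space) chart set \<Rightarrow> ('n \<Rightarrow> 'm) \<Rightarrow>
   ('m \<Rightarrow> 'e \<Rightarrow> 'e \<Rightarrow> real) \<Rightarrow> ('n \<Rightarrow> 'h set) \<Rightarrow> ('m \<Rightarrow> 'e \<Rightarrow> 'e) \<Rightarrow> ('m \<Rightarrow> 'e) \<Rightarrow> 'n \<Rightarrow> 'h set" where
  "D_xi A' A \<iota> g S \<phi> \<xi> p =
     {x + z | x z. x \<in> D_dist A' A \<iota> g S \<phi> \<xi> p \<and> z \<in> xi_line A' A \<iota> \<xi> p}"

end

theory Submission
  imports Defs
begin

text \<open>
  Let \<open>E\<close> be a local section of the radical and let \<open>u(X) = g(\<phi> X, E)\<close>, the coefficient of \<open>N\<close> in \<open>\<phi> X\<close>. By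
  linear algebra in the tangent spaces, \<open>D\<close> is the common kernel of \<open>u\<close> and \<open>\<eta>\<close> (\<open>D_dist_iff\<close>), and the sum of
  \<open>D\<close> and the line of \<open>\<xi>\<close> is the kernel of \<open>u\<close> (\<open>D_xi_iff\<close>). The theorem is thus about the integrability of
  a nowhere vanishing 1-form.

  For \<open>X\<close> and \<open>Y\<close> in the kernel of \<open>u\<close>, the ambient connection being torsion free, \<open>u([X, Y])\<close> is the product of
  \<open>\<phi> (\<nabla>\<^sub>X Y) - \<phi> (\<nabla>\<^sub>Y X)\<close> with \<open>E\<close>. The para Sasakian identity lets \<open>\<phi>\<close> pass under \<open>\<nabla>\<close> up to multiples of \<open>\<xi>\<close> and
  of \<open>\<phi>\<^sup>2 X\<close>, which are orthogonal to \<open>E\<close>; and \<open>\<phi> X\<close>, \<open>\<phi> Y\<close> are tangent. Hence \<open>u([X, Y])\<close> is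
  \<open>B(X, \<phi> Y) - B(\<phi> X, Y)\<close> (\<open>u_bracket_second_fundamental_form\<close>). The identity also gives
  \<open>\<phi> (\<nabla>\<^sub>Z \<xi>) = \<epsilon> \<phi>\<^sup>2 Z\<close>, whence \<open>u([X, \<xi>]) = 0\<close> for every such \<open>X\<close> (\<open>u_bracket_\<xi>\<close>). So the condition on \<open>B\<close> says
  exactly that the kernel of \<open>u\<close> is involutive.

  It remains to prove the Frobenius theorem in codimension one. Sections of an integrable distribution
  have brackets in it, as is seen in a chart adapted to an integral manifold
  (\<open>integrable_imp_involutive\<close>). Conversely, a leaf of an involutive 1-form is sought as a graph; the
  equation for the function is a total differential equation \<open>df = a(z, f)\<close>, and involutivity is its
  integrability condition (\<open>leaf_as_graph\<close>). It is solved by iterating the homotopy operator of the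
  Poincare lemma: integration along rays from the origin turns \<open>a(z, f)\<close> into a new function, whose
  derivative differs from \<open>a(z, f)\<close> by an integral of the exterior derivative, and the integrability
  condition bounds the latter by the defect \<open>df - a(z, f)\<close> of the previous iterate
  (\<open>total_differential_equation\<close>). Smoothness of the solution is read off from the equation. Integral
  manifolds are constructed one at a time, each with its own chart, by subtracting the function from
  the transversal coordinate (\<open>frobenius_codimension_one\<close>).

  Several smooth objects are given only pointwise, as unique solutions of linear equations: the section
  \<open>E\<close>, the tangential part of \<open>\<phi> X\<close>, and \<open>\<xi>\<close> as a field on the hypersurface. Their smoothness follows
  from that of the coefficients (\<open>smooth_on_linear_solution\<close>).
\<close>

section \<open>Calculus of $C^k$ maps\<close>

abbreviation fderiv :: "('a::real_normed_vector \<Rightarrow> 'b::real_normed_vector) \<Rightarrow> 'a \<Rightarrow> 'a \<Rightarrow> 'b" where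
  "fderiv f x \<equiv> frechet_derivative f (at x)"

lemma fderiv_eqI: "(f has_derivative f') (at x) \<Longrightarrow> fderiv f x = f'"
  using frechet_derivative_at by metis

lemma fderiv_works: "f differentiable (at x) \<Longrightarrow> (f has_derivative fderiv f x) (at x)"
  using frechet_derivative_works by blast

lemma fderiv_cong:
  assumes "open S" "x \<in> S" "\<And>y. y \<in> S \<Longrightarrow> f y = g y"
  shows "fderiv f x = fderiv g x"
proof -
  have "(f has_derivative d) (at x) \<longleftrightarrow> (g has_derivative d) (at x)" for d
    using assms has_derivative_transform_within_open[of f d x UNIV S g]
      has_derivative_transform_within_open[of g d x UNIV S f] by auto
  then show ?thesis unfolding frechet_derivative_def by simp
qed

lemma differentiable_cong:
  assumes "open S" "x \<in> S" "\<And>y. y \<in> S \<Longrightarrow> f y = g y" "f differentiable (at x)"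
  shows "g differentiable (at x)"
  using assms has_derivative_transform_within_open[of f _ x UNIV S g]
  unfolding differentiable_def by blast

lemma Ck_on_cong:
  assumes "open S" "\<And>x. x \<in> S \<Longrightarrow> f x = g x" "Ck_on k S f"
  shows "Ck_on k S g"
  using assms(2,3)
proof (induction k arbitrary: f g)
  case 0
  then show ?case using continuous_on_cong by fastforce
next
  case (Suc k)
  have 1: "g differentiable (at x)" if "x \<in> S" for x
    using differentiable_cong[OF assms(1) that, of f g] Suc.prems that by auto
  have 2: "Ck_on k S (\<lambda>x. fderiv g x v)" for v
  proof (rule Suc.IH)
    show "fderiv f x v = fderiv g x v" if "x \<in> S" for x
      using fderiv_cong[OF assms(1) that, of f g] Suc.prems(1) by simp
    show "Ck_on k S (\<lambda>x. fderiv f x v)" using Suc.prems(2) by simp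
  qed
  show ?case using 1 2 by simp
qed

text \<open>The derivative may be presented by any formula, which is how all closure properties are proved: the
  derivative of a product or composition is again built from maps of class $C^k$, and the induction
  on \<open>k\<close> goes through.\<close>

lemma Ck_on_SucI:
  assumes "open S" "\<And>x. x \<in> S \<Longrightarrow> (f has_derivative f' x) (at x)"
    and "\<And>v. Ck_on k S (\<lambda>x. f' x v)"
  shows "Ck_on (Suc k) S f"
proof -
  have "Ck_on k S (\<lambda>x. fderiv f x v)" for v
    by (rule Ck_on_cong[OF assms(1) _ assms(3)[of v]]) (simp add: fderiv_eqI[OF assms(2)])
  then show ?thesis using assms(2) by (auto simp: differentiable_def)
qed

lemma Ck_on_has_derivative:
  "Ck_on (Suc k) S f \<Longrightarrow> x \<in> S \<Longrightarrow> (f has_derivative fderiv f x) (at x)"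
  using fderiv_works by auto

lemma Ck_on_imp_continuous_on: "Ck_on k S f \<Longrightarrow> continuous_on S f"
  by (cases k) (auto intro!: continuous_at_imp_continuous_on differentiable_imp_continuous_within)

lemma Ck_on_SucD: "Ck_on (Suc k) S f \<Longrightarrow> Ck_on k S f"
proof (induction k arbitrary: f)
  case 0
  then show ?case using Ck_on_imp_continuous_on[of "Suc 0" S f] by simp
next
  case (Suc k)
  then show ?case by (subst Ck_on.simps) (auto simp del: Ck_on.simps simp: Ck_on.simps(2)[of "Suc k"])
qed

lemma Ck_on_subset: "Ck_on k S f \<Longrightarrow> T \<subseteq> S \<Longrightarrow> Ck_on k T f"
  by (induction k arbitrary: f) (auto intro: continuous_on_subset)

lemma Ck_on_local:
  assumes "\<And>x. x \<in> S \<Longrightarrow> \<exists>T. open T \<and> x \<in> T \<and> Ck_on k T f"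
  shows "Ck_on k S f"
  using assms
proof (induction k arbitrary: f)
  case 0
  have "isCont f x" if "x \<in> S" for x
    using 0[OF that] by (auto simp: continuous_on_eq_continuous_at)
  then show ?case by (simp add: continuous_at_imp_continuous_on)
next
  case (Suc k)
  have "f differentiable (at x)" if "x \<in> S" for x using Suc.prems[OF that] by auto
  moreover have "Ck_on k S (\<lambda>x. fderiv f x v)" for v
    by (rule Suc.IH) (use Suc.prems in force)
  ultimately show ?case by simp
qed

lemma Ck_on_const: "Ck_on k S (\<lambda>x. c)"
  by (induction k arbitrary: c) auto

lemma Ck_on_linear_comp:
  assumes "open S" "bounded_linear h" "Ck_on k S f"
  shows "Ck_on k S (\<lambda>x. h (f x))"
  using assms(3)
proof (induction k arbitrary: f)
  case 0
  then show ?case using bounded_linear.continuous_on[OF assms(2)] by auto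
next
  case (Suc k)
  show ?case
  proof (rule Ck_on_SucI[OF assms(1)])
    show "((\<lambda>x. h (f x)) has_derivative (\<lambda>v. h (fderiv f x v))) (at x)" if "x \<in> S" for x
      by (rule bounded_linear.has_derivative[OF assms(2) Ck_on_has_derivative[OF Suc.prems that]])
    show "Ck_on k S (\<lambda>x. h (fderiv f x v))" for v
      by (rule Suc.IH) (use Suc.prems in simp)
  qed
qed

lemma Ck_on_ident: "Ck_on k S (\<lambda>x. x)"
  by (cases k) (auto simp: Ck_on_const)

lemma Ck_on_linear:
  fixes h :: "'a::euclidean_space \<Rightarrow> 'b::real_normed_vector"
  assumes "linear h" shows "Ck_on k S h"
proof -
  have "Ck_on k UNIV (\<lambda>x. h x)"
    by (rule Ck_on_linear_comp[OF open_UNIV _ Ck_on_ident]) (use assms linear_conv_bounded_linear in blast)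
  then show ?thesis using Ck_on_subset by blast
qed

lemma Ck_on_add:
  assumes "open S" "Ck_on k S f" "Ck_on k S g"
  shows "Ck_on k S (\<lambda>x. f x + g x)"
  using assms(2,3)
proof (induction k arbitrary: f g)
  case 0
  then show ?case by (auto intro: continuous_intros)
next
  case (Suc k)
  show ?case
  proof (rule Ck_on_SucI[OF assms(1)])
    show "((\<lambda>x. f x + g x) has_derivative (\<lambda>v. fderiv f x v + fderiv g x v)) (at x)" if "x \<in> S" for x
      by (rule has_derivative_add[OF Ck_on_has_derivative[OF Suc.prems(1) that]
            Ck_on_has_derivative[OF Suc.prems(2) that]])
    show "Ck_on k S (\<lambda>x. fderiv f x v + fderiv g x v)" for v
      by (rule Suc.IH) (use Suc.prems in auto)
  qed
qed

lemma Ck_on_bilinear: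
  assumes "open S" "bounded_bilinear h" "Ck_on k S f" "Ck_on k S g"
  shows "Ck_on k S (\<lambda>x. h (f x) (g x))"
  using assms(3,4)
proof (induction k arbitrary: f g)
  case 0
  then show ?case using bounded_bilinear.continuous_on[OF assms(2)] by auto
next
  case (Suc k)
  note c = Ck_on_SucD[OF Suc.prems(1)] Ck_on_SucD[OF Suc.prems(2)]
  show ?case
  proof (rule Ck_on_SucI[OF assms(1)])
    show "((\<lambda>x. h (f x) (g x)) has_derivative (\<lambda>v. h (f x) (fderiv g x v) + h (fderiv f x v) (g x))) (at x)"
      if "x \<in> S" for x
      by (rule bounded_bilinear.FDERIV[OF assms(2) Ck_on_has_derivative[OF Suc.prems(1) that]
            Ck_on_has_derivative[OF Suc.prems(2) that]])
    show "Ck_on k S (\<lambda>x. h (f x) (fderiv g x v) + h (fderiv f x v) (g x))" for v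
      by (intro Ck_on_add assms(1) Suc.IH) (use Suc.prems c in auto)
  qed
qed

lemma Ck_on_sum:
  assumes "open S" "\<And>i. i \<in> I \<Longrightarrow> Ck_on k S (f i)"
  shows "Ck_on k S (\<lambda>x. \<Sum>i\<in>I. f i x)"
  using assms(2) by (induction I rule: infinite_finite_induct) (auto intro!: Ck_on_const Ck_on_add assms(1))

lemma linear_expand_Basis:
  fixes h :: "'a::euclidean_space \<Rightarrow> 'b::real_vector"
  assumes "linear h"
  shows "h v = (\<Sum>b\<in>Basis. (v \<bullet> b) *\<^sub>R h b)"
proof -
  have "h v = h (\<Sum>b\<in>Basis. (v \<bullet> b) *\<^sub>R b)" by (simp add: euclidean_representation)
  also have "\<dots> = (\<Sum>b\<in>Basis. (v \<bullet> b) *\<^sub>R h b)"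
    using assms by (simp add: linear_sum linear_cmul)
  finally show ?thesis .
qed

lemma Ck_on_inner: "open S \<Longrightarrow> Ck_on k S f \<Longrightarrow> Ck_on k S g \<Longrightarrow> Ck_on k S (\<lambda>x. f x \<bullet> g x)"
  by (rule Ck_on_bilinear[OF _ bounded_bilinear_inner])

lemma Ck_on_scaleR: "open S \<Longrightarrow> Ck_on k S f \<Longrightarrow> Ck_on k S g \<Longrightarrow> Ck_on k S (\<lambda>x. f x *\<^sub>R g x)"
  by (rule Ck_on_bilinear[OF _ bounded_bilinear_scaleR])

text \<open>A family of linear maps is of class $C^k$ as soon as its values on constant vectors are.\<close>

lemma Ck_on_linear_apply:
  fixes M :: "'a::euclidean_space \<Rightarrow> 'b::euclidean_space \<Rightarrow> 'c::real_normed_vector"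
  assumes "open S" "\<And>x. x \<in> S \<Longrightarrow> linear (M x)" "\<And>v. Ck_on k S (\<lambda>x. M x v)" "Ck_on k S r"
  shows "Ck_on k S (\<lambda>x. M x (r x))"
proof (rule Ck_on_cong[OF assms(1)])
  show "(\<Sum>b\<in>Basis. (r x \<bullet> b) *\<^sub>R M x b) = M x (r x)" if "x \<in> S" for x
    using linear_expand_Basis[OF assms(2)[OF that]] by metis
  show "Ck_on k S (\<lambda>x. \<Sum>b\<in>Basis. (r x \<bullet> b) *\<^sub>R M x b)"
    by (intro Ck_on_sum Ck_on_scaleR Ck_on_inner assms Ck_on_const)
qed

lemma Ck_on_compose:
  fixes f :: "'b::euclidean_space \<Rightarrow> 'c::real_normed_vector" and g :: "'a::euclidean_space \<Rightarrow> 'b"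
  assumes "open S" "g ` S \<subseteq> T" "Ck_on k T f" "Ck_on k S g"
  shows "Ck_on k S (\<lambda>x. f (g x))"
  using assms(3,4)
proof (induction k arbitrary: f)
  case 0
  then show ?case using continuous_on_compose2[of T f S g] assms(2) by auto
next
  case (Suc k)
  have T: "g x \<in> T" if "x \<in> S" for x using that assms(2) by auto
  show ?case
  proof (rule Ck_on_SucI[OF assms(1)])
    show "((\<lambda>x. f (g x)) has_derivative (\<lambda>v. fderiv f (g x) (fderiv g x v))) (at x)" if "x \<in> S" for x
      using diff_chain_at[OF Ck_on_has_derivative[OF Suc.prems(2) that]
        Ck_on_has_derivative[OF Suc.prems(1) T[OF that]]]
      by (simp add: o_def)
    show "Ck_on k S (\<lambda>x. fderiv f (g x) (fderiv g x v))" for v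
    proof (rule Ck_on_linear_apply[OF assms(1), where M="\<lambda>x. fderiv f (g x)"])
      show "linear (fderiv f (g x))" if "x \<in> S" for x
        using Suc.prems(1) T[OF that] by (intro linear_frechet_derivative) auto
      show "Ck_on k S (\<lambda>x. fderiv f (g x) v)" for v
        by (rule Suc.IH) (use Suc.prems Ck_on_SucD[OF Suc.prems(2)] in auto)
      show "Ck_on k S (\<lambda>x. fderiv g x v)" using Suc.prems(2) by simp
    qed
  qed
qed

lemma Ck_on_fderiv_apply:
  fixes f :: "'b::euclidean_space \<Rightarrow> 'c::real_normed_vector"
  assumes "open S" "Ck_on (Suc k) S f" "Ck_on k S r"
  shows "Ck_on k S (\<lambda>x. fderiv f x (r x))"
  by (rule Ck_on_linear_apply[OF assms(1)]) (use assms in \<open>auto intro: linear_frechet_derivative\<close>)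

section \<open>Smooth maps\<close>

lemma smooth_onI: "(\<And>k. Ck_on k S f) \<Longrightarrow> smooth_on S f"
  and smooth_onD: "smooth_on S f \<Longrightarrow> Ck_on k S f"
  by (auto simp: smooth_on_def)

lemma smooth_on_cong: "smooth_on S f \<Longrightarrow> open S \<Longrightarrow> (\<And>x. x \<in> S \<Longrightarrow> f x = g x) \<Longrightarrow> smooth_on S g"
  using Ck_on_cong unfolding smooth_on_def by metis

lemma smooth_on_subset: "smooth_on S f \<Longrightarrow> T \<subseteq> S \<Longrightarrow> smooth_on T f"
  using Ck_on_subset unfolding smooth_on_def by metis

lemma smooth_on_local:
  assumes "\<And>x. x \<in> S \<Longrightarrow> \<exists>T. open T \<and> x \<in> T \<and> smooth_on T f"
  shows "smooth_on S f"
  unfolding smooth_on_def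
proof
  show "Ck_on k S f" for k
    by (rule Ck_on_local) (use assms smooth_onD in blast)
qed

lemma smooth_on_has_derivative: "smooth_on S f \<Longrightarrow> x \<in> S \<Longrightarrow> (f has_derivative fderiv f x) (at x)"
  using Ck_on_has_derivative[of 0 S f x] unfolding smooth_on_def by blast

lemma smooth_on_linear_fderiv: "smooth_on S f \<Longrightarrow> x \<in> S \<Longrightarrow> linear (fderiv f x)"
  using smooth_on_has_derivative has_derivative_linear by blast

lemma smooth_on_imp_continuous_on: "smooth_on S f \<Longrightarrow> continuous_on S f"
  using Ck_on_imp_continuous_on unfolding smooth_on_def by blast

lemma smooth_on_const: "smooth_on S (\<lambda>x. c)"
  and smooth_on_ident: "smooth_on S (\<lambda>x. x)"
  by (simp_all add: smooth_on_def Ck_on_const Ck_on_ident)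

lemma smooth_on_linear: "linear h \<Longrightarrow> smooth_on S h"
  by (simp add: smooth_on_def Ck_on_linear)

lemma smooth_on_add: "open S \<Longrightarrow> smooth_on S f \<Longrightarrow> smooth_on S g \<Longrightarrow> smooth_on S (\<lambda>x. f x + g x)"
  by (simp add: smooth_on_def Ck_on_add)

lemma smooth_on_scaleR:
  "open S \<Longrightarrow> smooth_on S f \<Longrightarrow> smooth_on S g \<Longrightarrow> smooth_on S (\<lambda>x. f x *\<^sub>R g x)"
  by (simp add: smooth_on_def Ck_on_scaleR)

lemma smooth_on_inner:
  "open S \<Longrightarrow> smooth_on S f \<Longrightarrow> smooth_on S g \<Longrightarrow> smooth_on S (\<lambda>x. f x \<bullet> g x)"
  by (simp add: smooth_on_def Ck_on_inner)

lemma smooth_on_mult: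
  fixes f g :: "'a::euclidean_space \<Rightarrow> real"
  shows "open S \<Longrightarrow> smooth_on S f \<Longrightarrow> smooth_on S g \<Longrightarrow> smooth_on S (\<lambda>x. f x * g x)"
  using smooth_on_scaleR[of S f g] by simp

lemma smooth_on_minus: "open S \<Longrightarrow> smooth_on S f \<Longrightarrow> smooth_on S (\<lambda>x. - f x)"
  using smooth_on_scaleR[of S "\<lambda>x. -1" f] smooth_on_const by auto

lemma smooth_on_diff: "open S \<Longrightarrow> smooth_on S f \<Longrightarrow> smooth_on S g \<Longrightarrow> smooth_on S (\<lambda>x. f x - g x)"
  using smooth_on_add[of S f "\<lambda>x. - g x"] smooth_on_minus by auto

lemma smooth_on_sum:
  "open S \<Longrightarrow> (\<And>i. i \<in> I \<Longrightarrow> smooth_on S (f i)) \<Longrightarrow> smooth_on S (\<lambda>x. \<Sum>i\<in>I. f i x)"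
  by (simp add: smooth_on_def Ck_on_sum)

lemma smooth_on_linear_apply:
  fixes M :: "'a::euclidean_space \<Rightarrow> 'b::euclidean_space \<Rightarrow> 'c::real_normed_vector"
  assumes "open S" "\<And>x. x \<in> S \<Longrightarrow> linear (M x)" "\<And>v. smooth_on S (\<lambda>x. M x v)" "smooth_on S r"
  shows "smooth_on S (\<lambda>x. M x (r x))"
  using assms Ck_on_linear_apply[of S M _ r] unfolding smooth_on_def by blast

lemma smooth_on_compose:
  fixes f :: "'b::euclidean_space \<Rightarrow> 'c::real_normed_vector" and g :: "'a::euclidean_space \<Rightarrow> 'b"
  assumes "smooth_on T f" "smooth_on S g" "open S" "g ` S \<subseteq> T"
  shows "smooth_on S (\<lambda>x. f (g x))"
  using assms Ck_on_compose[of S g T _ f] unfolding smooth_on_def by blast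

lemma smooth_on_fderiv_apply:
  fixes f :: "'b::euclidean_space \<Rightarrow> 'c::real_normed_vector"
  assumes "open S" "smooth_on S f" "smooth_on S r"
  shows "smooth_on S (\<lambda>x. fderiv f x (r x))"
  using assms Ck_on_fderiv_apply[of S _ f r] unfolding smooth_on_def by blast

lemmas smooth_on_intros = smooth_on_const smooth_on_ident smooth_on_add smooth_on_diff
  smooth_on_minus smooth_on_scaleR smooth_on_mult smooth_on_inner smooth_on_sum

subsection \<open>Symmetry of second derivatives\<close>

lemma has_real_derivative_along_line:
  assumes "(f has_derivative f') (at (x + s *\<^sub>R w))"
  shows "((\<lambda>s. f (x + s *\<^sub>R w)) has_real_derivative f' w) (at s)"
proof -
  have "((\<lambda>s. x + s *\<^sub>R w) has_derivative (\<lambda>u. u *\<^sub>R w)) (at s)"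
    by (auto intro!: derivative_eq_intros)
  from diff_chain_at[OF this assms] show ?thesis
    unfolding has_field_derivative_def
    using linear_cmul[OF has_derivative_linear[OF assms]] by (simp add: o_def mult_commute_abs)
qed

lemma symmetric_second_derivative_real:
  fixes f :: "'a::euclidean_space \<Rightarrow> real"
  assumes "open S" "x \<in> S" "Ck_on (Suc (Suc 0)) S f"
  shows "fderiv (\<lambda>y. fderiv f y v) x w = fderiv (\<lambda>y. fderiv f y w) x v"
proof -
  define D2 where "D2 v w = (\<lambda>y. fderiv (\<lambda>z. fderiv f z v) y w)" for v w
  have cont: "continuous_on S (D2 v w)" for v w using assms(3) by (simp add: D2_def)
  have d1: "(f has_derivative fderiv f y) (at y)" if "y \<in> S" for y
    using Ck_on_has_derivative[OF assms(3) that] .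
  have d2: "((\<lambda>z. fderiv f z v) has_derivative fderiv (\<lambda>z. fderiv f z v) y) (at y)" if "y \<in> S" for y v
    using assms(3) that by (intro fderiv_works) simp
  obtain r where r: "r > 0" "ball x r \<subseteq> S" using assms(1,2) openE by blast
  \<comment> \<open>The second difference of \<open>f\<close> over a small parallelogram is a value of the mixed derivative, by
    applying the mean value theorem in one direction and then in the other.\<close>
  have key: "\<exists>y. norm (y - x) \<le> t * (norm v + norm w) \<and>
      f (x + t *\<^sub>R v + t *\<^sub>R w) - f (x + t *\<^sub>R v) - f (x + t *\<^sub>R w) + f x = t * t * D2 v w y"
    if t: "t > 0" "t * (norm v + norm w) < r" for t v w
  proof -
    have inS: "x + a *\<^sub>R v + b *\<^sub>R w \<in> S" and bd: "norm (a *\<^sub>R v + b *\<^sub>R w) \<le> t * (norm v + norm w)"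
      if "0 \<le> a" "a \<le> t" "0 \<le> b" "b \<le> t" for a b
    proof -
      have "norm (a *\<^sub>R v + b *\<^sub>R w) \<le> a * norm v + b * norm w"
        using that norm_triangle_ineq[of "a *\<^sub>R v" "b *\<^sub>R w"] by simp
      also have "\<dots> \<le> t * norm v + t * norm w" using that by (intro add_mono mult_right_mono) auto
      finally show *: "norm (a *\<^sub>R v + b *\<^sub>R w) \<le> t * (norm v + norm w)" by (simp add: distrib_left)
      have "dist x (x + u) = norm u" for u by (simp add: dist_norm)
      then have "dist x (x + a *\<^sub>R v + b *\<^sub>R w) < r"
        using * t(2) by (metis add.assoc order_le_less_trans)
      then show "x + a *\<^sub>R v + b *\<^sub>R w \<in> S" using r(2) by (meson mem_ball subsetD)
    qed
    have sw: "x + t *\<^sub>R w + u *\<^sub>R v = x + u *\<^sub>R v + t *\<^sub>R w" for u by simp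
    define h where "h s = f (x + t *\<^sub>R w + s *\<^sub>R v) - f (x + s *\<^sub>R v)" for s
    have dh: "(h has_real_derivative (fderiv f (x + t *\<^sub>R w + s *\<^sub>R v) v - fderiv f (x + s *\<^sub>R v) v)) (at s)"
      if s: "0 \<le> s" "s \<le> t" for s
    proof -
      have "x + t *\<^sub>R w + s *\<^sub>R v \<in> S" "x + s *\<^sub>R v \<in> S"
        using inS[of s t] inS[of s 0] s t by (auto simp: sw)
      then show ?thesis
        unfolding h_def by (intro DERIV_diff has_real_derivative_along_line d1)
    qed
    obtain a where a: "0 < a" "a < t"
      "h t - h 0 = (t - 0) * (fderiv f (x + t *\<^sub>R w + a *\<^sub>R v) v - fderiv f (x + a *\<^sub>R v) v)"
      using MVT2[OF t(1) dh] by blast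
    have dk: "((\<lambda>s. fderiv f (x + a *\<^sub>R v + s *\<^sub>R w) v) has_real_derivative D2 v w (x + a *\<^sub>R v + s *\<^sub>R w)) (at s)"
      if s: "0 \<le> s" "s \<le> t" for s
      unfolding D2_def using inS[of a s] s a by (intro has_real_derivative_along_line d2) auto
    obtain b where b: "0 < b" "b < t"
      "fderiv f (x + a *\<^sub>R v + t *\<^sub>R w) v - fderiv f (x + a *\<^sub>R v + 0 *\<^sub>R w) v = (t - 0) * D2 v w (x + a *\<^sub>R v + b *\<^sub>R w)"
      using MVT2[OF t(1) dk] by blast
    have "h t - h 0 = t * t * D2 v w (x + a *\<^sub>R v + b *\<^sub>R w)"
      using a(3) b(3) by (simp only: sw diff_zero scaleR_zero_left add_0_right mult.assoc)
    moreover have "norm (x + a *\<^sub>R v + b *\<^sub>R w - x) \<le> t * (norm v + norm w)"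
      using bd[of a b] a b by (simp add: add.assoc)
    ultimately show ?thesis unfolding h_def by (intro exI[of _ "x + a *\<^sub>R v + b *\<^sub>R w"]) (simp only: sw, simp)
  qed
  have "\<bar>D2 v w x - D2 w v x\<bar> \<le> e" if "e > 0" for e
  proof -
    obtain d1 where d1: "d1 > 0" "\<And>y. y \<in> S \<Longrightarrow> dist y x < d1 \<Longrightarrow> dist (D2 v w y) (D2 v w x) < e/2"
      using cont[of v w] assms(2) \<open>e > 0\<close> unfolding continuous_on_iff by (metis half_gt_zero)
    obtain d2 where d2: "d2 > 0" "\<And>y. y \<in> S \<Longrightarrow> dist y x < d2 \<Longrightarrow> dist (D2 w v y) (D2 w v x) < e/2"
      using cont[of w v] assms(2) \<open>e > 0\<close> unfolding continuous_on_iff by (metis half_gt_zero)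
    define m where "m = min r (min d1 d2)"
    define t where "t = m / (2 * (norm v + norm w + 1))"
    have m: "m > 0" using r d1 d2 by (simp add: m_def)
    have n0: "norm v + norm w + 1 > 0" by (smt (verit) norm_ge_zero)
    have t: "t > 0" unfolding t_def using m n0 by auto
    have "t * (norm v + norm w) \<le> t * (norm v + norm w + 1)" using t by simp
    also have "\<dots> = m / 2" unfolding t_def using n0 by (simp add: field_simps)
    finally have tm: "t * (norm v + norm w) < m" using m by simp
    then have tr: "t * (norm v + norm w) < r" "t * (norm w + norm v) < r" by (auto simp: m_def add.commute)
    obtain y where y: "norm (y - x) \<le> t * (norm v + norm w)"
      "f (x + t *\<^sub>R v + t *\<^sub>R w) - f (x + t *\<^sub>R v) - f (x + t *\<^sub>R w) + f x = t * t * D2 v w y"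
      using key[OF t tr(1)] by blast
    obtain z where z: "norm (z - x) \<le> t * (norm w + norm v)"
      "f (x + t *\<^sub>R w + t *\<^sub>R v) - f (x + t *\<^sub>R w) - f (x + t *\<^sub>R v) + f x = t * t * D2 w v z"
      using key[OF t tr(2)] by blast
    have sw: "x + t *\<^sub>R w + t *\<^sub>R v = x + t *\<^sub>R v + t *\<^sub>R w" by simp
    have "t * t * D2 v w y = t * t * D2 w v z" using y(2) z(2)[unfolded sw] by linarith
    then have eq: "D2 v w y = D2 w v z" using t by simp
    have yz: "dist y x < m" "dist z x < m" using y(1) z(1) tm by (auto simp: dist_norm add.commute)
    have "y \<in> S" "z \<in> S" using yz r(2) by (auto simp: m_def dist_commute subset_iff)
    then have "dist (D2 v w y) (D2 v w x) < e/2" "dist (D2 w v z) (D2 w v x) < e/2"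
      using d1(2) d2(2) yz by (auto simp: m_def)
    then show ?thesis using eq unfolding dist_real_def by linarith
  qed
  then have "\<bar>D2 v w x - D2 w v x\<bar> \<le> 0" by (rule field_le_epsilon) auto
  then show ?thesis by (simp add: D2_def)
qed

text \<open>In charts, this is what makes the Lie bracket independent of the chart and what cancels the second
  derivatives of the immersion in the torsion of the induced connection.\<close>

lemma symmetric_second_derivative:
  fixes f :: "'a::euclidean_space \<Rightarrow> 'b::euclidean_space"
  assumes "open S" "x \<in> S" "smooth_on S f"
  shows "fderiv (\<lambda>y. fderiv f y v) x w = fderiv (\<lambda>y. fderiv f y w) x v"
proof (rule euclidean_eqI)
  fix b :: 'b assume "b \<in> Basis"
  have fb: "smooth_on S (\<lambda>y. f y \<bullet> b)"
    by (intro smooth_on_inner assms smooth_on_const)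
  have 1: "fderiv (\<lambda>y. f y \<bullet> b) y v = fderiv f y v \<bullet> b" if "y \<in> S" for y v
    using fderiv_eqI[OF has_derivative_inner_left[OF smooth_on_has_derivative[OF assms(3) that], of b]] by simp
  have 2: "fderiv (\<lambda>y. fderiv f y v) x w \<bullet> b = fderiv (\<lambda>y. fderiv (\<lambda>y. f y \<bullet> b) y v) x w" for v w
  proof -
    have "smooth_on S (\<lambda>y. fderiv f y v)" by (intro smooth_on_fderiv_apply assms smooth_on_const)
    then have "fderiv (\<lambda>y. fderiv f y v \<bullet> b) x w = fderiv (\<lambda>y. fderiv f y v) x w \<bullet> b"
      using fderiv_eqI[OF has_derivative_inner_left[OF smooth_on_has_derivative[OF _ assms(2)], of _ b]] by simp
    moreover have "fderiv (\<lambda>y. fderiv f y v \<bullet> b) x w = fderiv (\<lambda>y. fderiv (\<lambda>y. f y \<bullet> b) y v) x w"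
      by (subst fderiv_cong[OF assms(1,2)]) (auto simp: 1)
    ultimately show ?thesis by simp
  qed
  show "fderiv (\<lambda>y. fderiv f y v) x w \<bullet> b = fderiv (\<lambda>y. fderiv f y w) x v \<bullet> b"
    unfolding 2 by (rule symmetric_second_derivative_real[OF assms(1,2) smooth_onD[OF fb]])
qed

section \<open>Smooth dependence of solutions of linear equations\<close>

text \<open>A product of two factors that vanish at \<open>x\<close> is of second order there even if one of them is merely
  continuous.\<close>

lemma has_derivative_scaleR_null:
  fixes w :: "'a::real_normed_vector \<Rightarrow> 'b::real_normed_vector"
  assumes u: "(u \<longlongrightarrow> 0) (at x)" "u x = (0::real)" and w: "(w has_derivative w') (at x)" "w x = 0"
  shows "((\<lambda>y. u y *\<^sub>R w y) has_derivative (\<lambda>_. 0)) (at x)"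
  unfolding has_derivative_at_alt
proof (intro conjI allI impI)
  fix e :: real assume e: "e > 0"
  have bl: "bounded_linear w'" using w has_derivative_bounded_linear by blast
  obtain K where K: "K > 0" "\<And>v. norm (w' v) \<le> norm v * K" using bounded_linear.pos_bounded[OF bl] by blast
  obtain d1 where d1: "d1 > 0" "\<And>y. norm (y - x) < d1 \<Longrightarrow> norm (w y - w x - w' (y - x)) \<le> 1 * norm (y - x)"
    using w(1) unfolding has_derivative_at_alt by (meson zero_less_one)
  obtain d2 where d2: "d2 > 0" "\<And>y. y \<noteq> x \<Longrightarrow> dist y x < d2 \<Longrightarrow> dist (u y) 0 < e / (K + 1)"
    using u(1) e K(1) unfolding LIM_def by (metis add_pos_pos divide_pos_pos zero_less_one)
  show "\<exists>d>0. \<forall>y. norm (y - x) < d \<longrightarrow>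
      norm (u y *\<^sub>R w y - u x *\<^sub>R w x - 0) \<le> e * norm (y - x)"
  proof (intro exI conjI allI impI)
    show "min d1 d2 > 0" using d1 d2 by simp
    fix y assume y: "norm (y - x) < min d1 d2"
    have "norm (w y) \<le> norm (w y - w x - w' (y - x)) + norm (w' (y - x))"
      using norm_triangle_ineq[of "w y - w x - w' (y - x)" "w' (y - x)"] w(2) by simp
    also have "\<dots> \<le> (K + 1) * norm (y - x)"
      using d1(2)[of y] y K(2)[of "y - x"] by (simp add: algebra_simps)
    finally have wy: "norm (w y) \<le> (K + 1) * norm (y - x)" .
    have uy: "\<bar>u y\<bar> \<le> e / (K + 1)"
      using d2(2)[of y] y u(2) e K(1) by (cases "y = x") (auto simp: dist_norm)
    have "\<bar>u y\<bar> * norm (w y) \<le> (e / (K + 1)) * ((K + 1) * norm (y - x))"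
      using wy uy e K(1) by (intro mult_mono) auto
    then show "norm (u y *\<^sub>R w y - u x *\<^sub>R w x - 0) \<le> e * norm (y - x)"
      using K(1) w(2) by simp
  qed
qed simp

text \<open>If \<open>G\<close> is a left inverse of \<open>M x\<^sub>0\<close>, then the equation reads
  \<open>y = y\<^sub>0 + G (b - M y\<^sub>0) - G ((M - M x\<^sub>0) (y - y\<^sub>0))\<close>, where \<open>y\<^sub>0\<close> is the value of \<open>y\<close> at \<open>x\<^sub>0\<close> and the last
  term is a product of two factors that vanish at \<open>x\<^sub>0\<close>. This gives continuity, and then
  differentiability of \<open>y\<close>; higher regularity follows, since the derivatives of \<open>y\<close> solve equations
  with the same \<open>M\<close>.\<close>

lemma linear_solution_differentiable:
  fixes M :: "'a::euclidean_space \<Rightarrow> 'b::euclidean_space \<Rightarrow> 'c::euclidean_space"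
  assumes S: "open S" "x0 \<in> S" and lin: "\<And>x. x \<in> S \<Longrightarrow> linear (M x)" and inj: "inj (M x0)"
    and sol: "\<And>x. x \<in> S \<Longrightarrow> M x (y x) = b x"
  shows "(\<And>v. isCont (\<lambda>x. M x v) x0) \<Longrightarrow> isCont b x0 \<Longrightarrow> isCont y x0"
    and "(\<And>v. (\<lambda>x. M x v) differentiable (at x0)) \<Longrightarrow> b differentiable (at x0) \<Longrightarrow> y differentiable (at x0)"
proof -
  obtain G where G: "linear G" "G \<circ> M x0 = id"
    using linear_injective_left_inverse[OF lin[OF S(2)] inj] by blast
  have bG: "bounded_linear G" using G(1) linear_conv_bounded_linear by blast
  define m where "m x c = G (M x c - M x0 c)" for x c
  define d where "d x = y x - y x0" for x
  define s where "s x = G (b x - M x (y x0))" for x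
  have s0: "s x0 = 0" using sol[OF S(2)] G(1) by (simp add: s_def linear_0)
  have m0: "m x0 c = 0" for c using G(1) by (simp add: m_def linear_0)
  have d0: "d x0 = 0" by (simp add: d_def)
  have eq: "d x = s x - (\<Sum>c\<in>Basis. (d x \<bullet> c) *\<^sub>R m x c)" if x: "x \<in> S" for x
  proof -
    have "linear (\<lambda>v. m x v)" unfolding m_def
      using G(1) lin[OF x] lin[OF S(2)]
      by (auto intro!: linearI simp: linear_add linear_diff linear_cmul algebra_simps)
    then have "(\<Sum>c\<in>Basis. (d x \<bullet> c) *\<^sub>R m x c) = m x (d x)" using linear_expand_Basis by metis
    also have "\<dots> = G (M x (d x)) - G (M x0 (d x))" using G(1) by (simp add: m_def linear_diff)
    also have "G (M x0 (d x)) = d x" using G(2) by (metis comp_apply id_apply)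
    also have "M x (d x) = b x - M x (y x0)" using lin[OF x] sol[OF x] by (simp add: d_def linear_diff)
    finally show ?thesis by (simp add: s_def)
  qed
  show cont: "isCont y x0" if cM: "\<And>v. isCont (\<lambda>x. M x v) x0" and cb: "isCont b x0"
  proof -
    have "isCont s x0" unfolding s_def
      by (intro continuous_intros bounded_linear.isCont[OF bG] cM cb)
    then have s': "((\<lambda>x. 2 * norm (s x)) \<longlongrightarrow> 0) (at x0)"
      unfolding isCont_def s0 by (auto intro!: tendsto_eq_intros)
    have "isCont (\<lambda>x. \<Sum>c\<in>Basis. norm (m x c)) x0" unfolding m_def
      by (intro continuous_intros bounded_linear.isCont[OF bG] cM)
    then have "((\<lambda>x. \<Sum>c\<in>Basis. norm (m x c)) \<longlongrightarrow> 0) (at x0)" unfolding isCont_def m0 by simp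
    then have e1: "\<forall>\<^sub>F x in at x0. (\<Sum>c\<in>Basis. norm (m x c)) < 1/2"
      by (rule order_tendstoD(2)) simp
    have e2: "\<forall>\<^sub>F x in at x0. x \<in> S" using S by (rule eventually_at_in_open')
    have "\<forall>\<^sub>F x in at x0. norm (d x) \<le> 2 * norm (s x)"
      using e1 e2
    proof eventually_elim
      fix x assume x: "(\<Sum>c\<in>Basis. norm (m x c)) < 1/2" "x \<in> S"
      have "norm (\<Sum>c\<in>Basis. (d x \<bullet> c) *\<^sub>R m x c) \<le> (\<Sum>c\<in>Basis. norm (d x) * norm (m x c))"
        by (rule sum_norm_le) (simp add: mult_right_mono Basis_le_norm)
      also have "\<dots> = norm (d x) * (\<Sum>c\<in>Basis. norm (m x c))" by (simp add: sum_distrib_left)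
      also have "\<dots> \<le> norm (d x) * (1/2)" using x by (intro mult_left_mono) auto
      finally have "norm (\<Sum>c\<in>Basis. (d x \<bullet> c) *\<^sub>R m x c) \<le> norm (d x) / 2" by simp
      moreover have "norm (d x) \<le> norm (s x) + norm (\<Sum>c\<in>Basis. (d x \<bullet> c) *\<^sub>R m x c)"
        using norm_triangle_ineq4 eq[OF x(2)] by metis
      ultimately show "norm (d x) \<le> 2 * norm (s x)" by linarith
    qed
    then have "(d \<longlongrightarrow> 0) (at x0)" by (rule Lim_null_comparison) (rule s')
    then show "isCont y x0" unfolding isCont_def d_def[abs_def] by (rule LIM_zero_cancel)
  qed
  show "y differentiable (at x0)"
    if dM: "\<And>v. (\<lambda>x. M x v) differentiable (at x0)" and db: "b differentiable (at x0)"
  proof -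
    have "isCont y x0"
      by (rule cont) (use dM db differentiable_imp_continuous_within in auto)
    then have dl: "((\<lambda>x. d x \<bullet> c) \<longlongrightarrow> 0) (at x0)" for c
      unfolding isCont_def d_def by (auto intro!: tendsto_eq_intros)
    have Gd: "(\<lambda>x. G (h x)) differentiable (at x0)" if "h differentiable (at x0)" for h
      using that bounded_linear.has_derivative[OF bG] unfolding differentiable_def by blast
    have sd: "s differentiable (at x0)" unfolding s_def by (intro Gd differentiable_diff db dM)
    have md: "(\<lambda>x. m x c) differentiable (at x0)" for c
      unfolding m_def by (intro Gd differentiable_diff dM differentiable_const)
    have "((\<lambda>x. (d x \<bullet> c) *\<^sub>R m x c) has_derivative (\<lambda>_. 0)) (at x0)" for c
      by (rule has_derivative_scaleR_null[OF dl _ fderiv_works[OF md] m0]) (simp add: d0)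
    then have "((\<lambda>x. y x0 + s x - (\<Sum>c\<in>Basis. (d x \<bullet> c) *\<^sub>R m x c)) has_derivative
        (\<lambda>v. 0 + fderiv s x0 v - (\<Sum>c\<in>(Basis::'b set). 0))) (at x0)"
      by (intro has_derivative_diff has_derivative_add has_derivative_sum has_derivative_const
          fderiv_works sd)
    then have "(\<lambda>x. y x0 + s x - (\<Sum>c\<in>Basis. (d x \<bullet> c) *\<^sub>R m x c)) differentiable (at x0)"
      unfolding differentiable_def by blast
    then show ?thesis
    proof (rule differentiable_cong[OF S, rotated])
      show "y x0 + s x - (\<Sum>c\<in>Basis. (d x \<bullet> c) *\<^sub>R m x c) = y x" if "x \<in> S" for x
        using eq[OF that] unfolding d_def by (metis add_diff_eq diff_add_cancel add.commute)
    qed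
  qed
qed

lemma Ck_on_linear_solution:
  fixes M :: "'a::euclidean_space \<Rightarrow> 'b::euclidean_space \<Rightarrow> 'c::euclidean_space"
  assumes S: "open S" and lin: "\<And>x. x \<in> S \<Longrightarrow> linear (M x)" and inj: "\<And>x. x \<in> S \<Longrightarrow> inj (M x)"
    and "\<And>v. Ck_on k S (\<lambda>x. M x v)" "Ck_on k S b" "\<And>x. x \<in> S \<Longrightarrow> M x (y x) = b x"
  shows "Ck_on k S y"
  using assms(4-6)
proof (induction k arbitrary: y b)
  case 0
  have "isCont y x" if "x \<in> S" for x
  proof (rule linear_solution_differentiable(1)[where M=M and y=y and b=b, OF S that lin inj[OF that] "0.prems"(3)])
    show "isCont (\<lambda>x. M x v) x" for v using "0.prems"(1)[of v] S that continuous_on_eq_continuous_at by auto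
    show "isCont b x" using "0.prems"(2) S that continuous_on_eq_continuous_at by auto
  qed
  then show ?case by (simp add: continuous_at_imp_continuous_on)
next
  case (Suc k)
  have yd: "(y has_derivative fderiv y x) (at x)" if "x \<in> S" for x
    by (rule fderiv_works, rule linear_solution_differentiable(2)[where M=M and y=y and b=b, OF S that lin inj[OF that] Suc.prems(3)])
      (use Suc.prems(1,2) that in auto)
  have yk: "Ck_on k S y"
    by (rule Suc.IH[OF Ck_on_SucD[OF Suc.prems(1)] Ck_on_SucD[OF Suc.prems(2)] Suc.prems(3)])
  define M' where "M' v x c = fderiv (\<lambda>x. M x c) x v" for v x c
  have dM: "((\<lambda>x. M x c) has_derivative (\<lambda>v. M' v x c)) (at x)" if "x \<in> S" for x c
    unfolding M'_def using Ck_on_has_derivative[OF Suc.prems(1) that] .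
  have "Ck_on k S (\<lambda>x. fderiv y x v)" for v
  proof (rule Suc.IH[of "\<lambda>x. fderiv b x v - (\<Sum>c\<in>Basis. (y x \<bullet> c) *\<^sub>R M' v x c)"])
    show "Ck_on k S (\<lambda>x. M x v)" for v using Ck_on_SucD[OF Suc.prems(1)] .
    have "Ck_on k S (\<lambda>x. fderiv b x v + (- 1) *\<^sub>R (\<Sum>c\<in>Basis. (y x \<bullet> c) *\<^sub>R M' v x c))"
      unfolding M'_def using Suc.prems(1,2)
      by (intro Ck_on_add Ck_on_sum Ck_on_scaleR Ck_on_inner S yk Ck_on_const) auto
    then show "Ck_on k S (\<lambda>x. fderiv b x v - (\<Sum>c\<in>Basis. (y x \<bullet> c) *\<^sub>R M' v x c))" by simp
    show "M x (fderiv y x v) = fderiv b x v - (\<Sum>c\<in>Basis. (y x \<bullet> c) *\<^sub>R M' v x c)" if x: "x \<in> S" for x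
    proof -
      have "((\<lambda>x. \<Sum>c\<in>Basis. (y x \<bullet> c) *\<^sub>R M x c) has_derivative
          (\<lambda>v. \<Sum>c\<in>Basis. (y x \<bullet> c) *\<^sub>R M' v x c + (fderiv y x v \<bullet> c) *\<^sub>R M x c)) (at x)"
        by (intro has_derivative_sum has_derivative_scaleR has_derivative_inner_left yd dM x)
      moreover have "(\<Sum>c\<in>Basis. (y x \<bullet> c) *\<^sub>R M x c) = b x" if "x \<in> S" for x
        using linear_expand_Basis[OF lin[OF that]] Suc.prems(3)[OF that] by metis
      ultimately have "(b has_derivative
          (\<lambda>v. \<Sum>c\<in>Basis. (y x \<bullet> c) *\<^sub>R M' v x c + (fderiv y x v \<bullet> c) *\<^sub>R M x c)) (at x)"
        using has_derivative_transform_within_open[OF _ S x] by blast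
      then have "fderiv b x v = (\<Sum>c\<in>Basis. (y x \<bullet> c) *\<^sub>R M' v x c) + (\<Sum>c\<in>Basis. (fderiv y x v \<bullet> c) *\<^sub>R M x c)"
        using fderiv_eqI by (metis (no_types, lifting) sum.cong sum.distrib)
      also have "(\<Sum>c\<in>Basis. (fderiv y x v \<bullet> c) *\<^sub>R M x c) = M x (fderiv y x v)"
        using linear_expand_Basis[OF lin[OF x]] by metis
      finally show ?thesis by simp
    qed
  qed
  then show ?case using yd by (auto simp: differentiable_def)
qed

lemma smooth_on_linear_solution:
  fixes M :: "'a::euclidean_space \<Rightarrow> 'b::euclidean_space \<Rightarrow> 'c::euclidean_space"
  assumes "open S" "\<And>x. x \<in> S \<Longrightarrow> linear (M x)" "\<And>x. x \<in> S \<Longrightarrow> inj (M x)"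
    "\<And>v. smooth_on S (\<lambda>x. M x v)" "smooth_on S b" "\<And>x. x \<in> S \<Longrightarrow> M x (y x) = b x"
  shows "smooth_on S y"
  by (rule smooth_onI, rule Ck_on_linear_solution[where M=M and b=b])
    (use assms in \<open>auto intro: smooth_onD\<close>)

text \<open>An injective linear map is bounded below, and small perturbations keep it so.\<close>

lemma eventually_inj_linear:
  fixes M :: "'a::euclidean_space \<Rightarrow> 'b::euclidean_space \<Rightarrow> 'c::euclidean_space"
  assumes S: "open S" "x0 \<in> S" and lin: "\<And>x. x \<in> S \<Longrightarrow> linear (M x)" and inj: "inj (M x0)"
    and cont: "\<And>v. continuous_on S (\<lambda>x. M x v)"
  obtains T where "open T" "x0 \<in> T" "T \<subseteq> S" "\<And>x. x \<in> T \<Longrightarrow> inj (M x)"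
proof -
  obtain B where B: "B > 0" "\<And>v. B * norm v \<le> norm (M x0 v)"
    using linear_inj_bounded_below_pos[OF lin[OF S(2)] inj] by blast
  define h where "h x = (\<Sum>c\<in>Basis. norm (M x c - M x0 c))" for x
  have hc: "continuous_on S h" unfolding h_def by (intro continuous_intros cont)
  define T where "T = S \<inter> h -` {..<B}"
  show thesis
  proof
    show "open T" unfolding T_def by (rule continuous_open_preimage[OF hc S(1)]) simp
    show "x0 \<in> T" using S B by (simp add: T_def h_def)
    show "T \<subseteq> S" by (auto simp: T_def)
    fix x assume "x \<in> T"
    then have x: "x \<in> S" "h x < B" by (auto simp: T_def)
    have "v = 0" if "M x v = 0" for v
    proof (rule ccontr)
      assume v: "v \<noteq> 0"
      have lm: "linear (\<lambda>v. M x v - M x0 v)" by (intro linear_compose_sub lin x S)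
      have "norm (M x0 v) = norm (M x v - M x0 v)" using that by simp
      also have "\<dots> = norm (\<Sum>c\<in>Basis. (v \<bullet> c) *\<^sub>R (M x c - M x0 c))"
        using linear_expand_Basis[OF lm, of v] by metis
      also have "\<dots> \<le> (\<Sum>c\<in>Basis. norm v * norm (M x c - M x0 c))"
        by (rule sum_norm_le) (simp add: mult_right_mono Basis_le_norm)
      also have "\<dots> = norm v * h x" by (simp add: h_def sum_distrib_left)
      also have "\<dots> < norm v * B" using v x by simp
      finally show False using B(2)[of v] by (simp add: mult.commute)
    qed
    then show "inj (M x)" using linear_injective_0 lin x by blast
  qed
qed


section \<open>A primitive of a 1-form along rays\<close>

text \<open>The homotopy operator of the Poincare lemma. A 1-form is represented by its coefficient vector,
  so that \<open>\<alpha> x \<bullet> v\<close> is its value on \<open>v\<close>. The primitive fails to have derivative \<open>\<alpha>\<close> by the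
  integral of the exterior derivative of \<open>\<alpha>\<close>.\<close>

definition ray_primitive :: "('a::euclidean_space \<Rightarrow> 'a) \<Rightarrow> 'a \<Rightarrow> real" where
  "ray_primitive \<alpha> z = integral {0..1} (\<lambda>t. \<alpha> (t *\<^sub>R z) \<bullet> z)"

lemma scaleR_in_ball0: "0 \<le> t \<Longrightarrow> t \<le> 1 \<Longrightarrow> z \<in> ball 0 r \<Longrightarrow> t *\<^sub>R z \<in> ball (0::'a::real_normed_vector) r"
  by (simp add: dist_norm) (smt (verit) mult_left_le_one_le norm_ge_zero)

lemma ray_primitive:
  fixes \<alpha> :: "'a::euclidean_space \<Rightarrow> 'a"
  assumes \<alpha>: "Ck_on (Suc 0) (ball 0 r) \<alpha>"
  shows "Ck_on (Suc 0) (ball 0 r) (ray_primitive \<alpha>)"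
    and "\<And>z v \<kappa>. z \<in> ball 0 r \<Longrightarrow>
        (\<And>x v w. x \<in> ball 0 r \<Longrightarrow> \<bar>fderiv \<alpha> x v \<bullet> w - fderiv \<alpha> x w \<bullet> v\<bar> \<le> \<kappa> * norm v * norm w) \<Longrightarrow>
        \<bar>fderiv (ray_primitive \<alpha>) z v - \<alpha> z \<bullet> v\<bar> \<le> \<kappa> * norm z * norm v"
proof -
  let ?B = "ball (0::'a) r"
  have d\<alpha>: "(\<alpha> has_derivative fderiv \<alpha> x) (at x)" if "x \<in> ?B" for x
    using Ck_on_has_derivative[OF \<alpha> that] .
  have c\<alpha>: "continuous_on ?B \<alpha>" using Ck_on_imp_continuous_on[OF \<alpha>] .
  have cd: "continuous_on ?B (\<lambda>x. fderiv \<alpha> x v)" for v using \<alpha> by simp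
  have lin: "linear (fderiv \<alpha> x)" if "x \<in> ?B" for x using d\<alpha>[OF that] has_derivative_linear by blast
  have cdr: "continuous_on T (\<lambda>p. fderiv \<alpha> (h p) (k p))"
    if "continuous_on T h" "continuous_on T k" "h ` T \<subseteq> ?B"
    for T :: "'c::topological_space set" and h k
  proof -
    have "continuous_on T (\<lambda>p. \<Sum>b\<in>Basis. (k p \<bullet> b) *\<^sub>R fderiv \<alpha> (h p) b)"
      by (intro continuous_intros that continuous_on_compose2[OF cd])
    moreover have "(\<Sum>b\<in>Basis. (k p \<bullet> b) *\<^sub>R fderiv \<alpha> (h p) b) = fderiv \<alpha> (h p) (k p)" if "p \<in> T" for p
      using linear_expand_Basis[OF lin[of "h p"], of "k p"] that \<open>h ` T \<subseteq> ?B\<close> by auto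
    ultimately show ?thesis by (rule continuous_on_eq)
  qed
  define F where "F z t v = \<alpha> (t *\<^sub>R z) \<bullet> v + t * (fderiv \<alpha> (t *\<^sub>R z) v \<bullet> z)" for z t v
  have Fbl: "bounded_linear (F z t)" if "z \<in> ?B" "t \<in> cbox 0 1" for z t
    unfolding linear_conv_bounded_linear[symmetric] F_def
    using lin[OF scaleR_in_ball0[of t z r]] that
    by (intro linearI) (auto simp: linear_add linear_cmul inner_add_right inner_add_left algebra_simps)
  have im: "(\<lambda>p. snd p *\<^sub>R fst p) ` (?B \<times> cbox 0 (1::real)) \<subseteq> ?B"
    using scaleR_in_ball0 by fastforce
  have Fc: "continuous_on (?B \<times> cbox 0 1) (\<lambda>p. F (fst p) (snd p) v)" for v
    unfolding F_def
    by (intro continuous_intros cdr im continuous_on_compose2[OF c\<alpha>])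
  have Fc': "continuous_on {0..1} (\<lambda>t. F z t v)" if "z \<in> ?B" for z v
  proof -
    have "Pair z ` {0..1} \<subseteq> ?B \<times> cbox 0 (1::real)" using that by auto
    then have "continuous_on {0..1} (\<lambda>t. F (fst (z, t)) (snd (z, t)) v)"
      by (intro continuous_on_compose2[OF Fc[of v]] continuous_intros)
    then show ?thesis by simp
  qed
  have cs: "continuous_on {0..1} (\<lambda>t. \<alpha> (t *\<^sub>R z) \<bullet> z)" if "z \<in> ?B" for z
    by (intro continuous_intros continuous_on_compose2[OF c\<alpha>]) (use scaleR_in_ball0 that in auto)
  have leib: "(ray_primitive \<alpha> has_derivative (\<lambda>v. integral {0..1} (\<lambda>t. F z t v))) (at z)"
    if z: "z \<in> ?B" for z
  proof -
    have Fcb: "continuous_on (?B \<times> cbox 0 1) (\<lambda>(z, t). Blinfun (F z t))"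
    proof (rule continuous_on_blinfun_componentwise)
      fix i :: 'a
      show "continuous_on (?B \<times> cbox 0 1) (\<lambda>x. blinfun_apply (case x of (z, t) \<Rightarrow> Blinfun (F z t)) i)"
        by (rule continuous_on_eq[OF Fc[of i]]) (auto simp: bounded_linear_Blinfun_apply[OF Fbl] split_beta)
    qed
    have "((\<lambda>z. integral (cbox 0 1) (\<lambda>t. \<alpha> (t *\<^sub>R z) \<bullet> z)) has_derivative
        blinfun_apply (integral (cbox 0 1) (\<lambda>t. Blinfun (F z t)))) (at z within ?B)"
    proof (rule leibniz_rule[OF _ _ Fcb z convex_ball])
      fix z and t :: real assume z: "z \<in> ?B" and t: "t \<in> cbox 0 1"
      have tz: "t *\<^sub>R z \<in> ?B" using scaleR_in_ball0 z t by auto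
      have "((\<lambda>z. \<alpha> (t *\<^sub>R z)) has_derivative (\<lambda>v. fderiv \<alpha> (t *\<^sub>R z) (t *\<^sub>R v))) (at z)"
        using diff_chain_at[OF has_derivative_scaleR_right[OF has_derivative_ident] d\<alpha>[OF tz]]
        by (simp add: o_def)
      then have "((\<lambda>z. \<alpha> (t *\<^sub>R z) \<bullet> z) has_derivative
          (\<lambda>v. \<alpha> (t *\<^sub>R z) \<bullet> v + fderiv \<alpha> (t *\<^sub>R z) (t *\<^sub>R v) \<bullet> z)) (at z)"
        by (rule has_derivative_inner) (rule has_derivative_ident)
      moreover have "(\<lambda>v. \<alpha> (t *\<^sub>R z) \<bullet> v + fderiv \<alpha> (t *\<^sub>R z) (t *\<^sub>R v) \<bullet> z) = Blinfun (F z t)"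
        unfolding bounded_linear_Blinfun_apply[OF Fbl[OF z t]] F_def
        using lin[OF tz] by (simp add: linear_cmul)
      ultimately show "((\<lambda>z. \<alpha> (t *\<^sub>R z) \<bullet> z) has_derivative Blinfun (F z t)) (at z within ?B)"
        using has_derivative_at_withinI by metis
    next
      show "(\<lambda>t. \<alpha> (t *\<^sub>R z) \<bullet> z) integrable_on cbox 0 1" if "z \<in> ?B" for z
        using integrable_continuous_real[OF cs[OF that]] by simp
    qed
    moreover have "blinfun_apply (integral (cbox 0 1) (\<lambda>t. Blinfun (F z t))) = (\<lambda>v. integral {0..1} (\<lambda>t. F z t v))"
    proof
      fix v
      have "(\<lambda>t. Blinfun (F z t)) integrable_on cbox 0 1"
      proof (rule integrable_continuous)
        have "Pair z ` cbox 0 1 \<subseteq> ?B \<times> cbox 0 (1::real)" using z by auto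
        then have "continuous_on (cbox 0 1) (\<lambda>t. case (z, t) of (z, t) \<Rightarrow> Blinfun (F z t))"
          by (intro continuous_on_compose2[OF Fcb] continuous_intros)
        then show "continuous_on (cbox 0 1) (\<lambda>t. Blinfun (F z t))" by simp
      qed
      then have "blinfun_apply (integral (cbox 0 1) (\<lambda>t. Blinfun (F z t))) v
          = integral (cbox 0 1) (\<lambda>t. blinfun_apply (Blinfun (F z t)) v)"
        by (rule blinfun_apply_integral)
      also have "\<dots> = integral (cbox 0 1) (\<lambda>t. F z t v)"
        by (rule integral_cong) (simp add: bounded_linear_Blinfun_apply[OF Fbl[OF z]])
      finally show "blinfun_apply (integral (cbox 0 1) (\<lambda>t. Blinfun (F z t))) v = integral {0..1} (\<lambda>t. F z t v)"
        by simp
    qed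
    ultimately show ?thesis
      using z at_within_open[OF z open_ball] by (simp add: ray_primitive_def[abs_def])
  qed
  show "Ck_on (Suc 0) ?B (ray_primitive \<alpha>)"
  proof (rule Ck_on_SucI[OF open_ball leib])
    show "Ck_on 0 ?B (\<lambda>z. integral {0..1} (\<lambda>t. F z t v))" for v
      using integral_continuous_on_param[of ?B 0 1 "\<lambda>z t. F z t v"] Fc[of v] by (simp add: split_beta')
  qed
  fix z v :: 'a and \<kappa>
  assume z: "z \<in> ?B"
    and \<kappa>: "\<And>x v w. x \<in> ?B \<Longrightarrow> \<bar>fderiv \<alpha> x v \<bullet> w - fderiv \<alpha> x w \<bullet> v\<bar> \<le> \<kappa> * norm v * norm w"
  \<comment> \<open>\<open>H\<close> is the derivative of \<open>t (\<alpha> (t z) \<bullet> v)\<close>; its integral is \<open>\<alpha> z \<bullet> v\<close>, and it differs from the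
    integrand of the derivative of the primitive by a value of the exterior derivative.\<close>
  define H where "H t = \<alpha> (t *\<^sub>R z) \<bullet> v + t * (fderiv \<alpha> (t *\<^sub>R z) z \<bullet> v)" for t
  have Hc: "continuous_on {0..1} H" unfolding H_def
    by (intro continuous_intros cdr continuous_on_compose2[OF c\<alpha>]) (use scaleR_in_ball0 z in auto)
  have "(H has_integral (1 * (\<alpha> (1 *\<^sub>R z) \<bullet> v) - 0 * (\<alpha> (0 *\<^sub>R z) \<bullet> v))) {0..1}"
  proof (rule fundamental_theorem_of_calculus)
    fix t :: real assume t: "t \<in> {0..1}"
    have tz: "t *\<^sub>R z \<in> ?B" using scaleR_in_ball0 z t by auto
    have "((\<lambda>t. \<alpha> (t *\<^sub>R z)) has_derivative (\<lambda>u. fderiv \<alpha> (t *\<^sub>R z) (u *\<^sub>R z))) (at t)"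
      using diff_chain_at[OF has_derivative_scaleR_left[OF has_derivative_ident] d\<alpha>[OF tz]]
      by (simp add: o_def)
    then have "((\<lambda>t. t * (\<alpha> (t *\<^sub>R z) \<bullet> v)) has_derivative
        (\<lambda>u. t * (fderiv \<alpha> (t *\<^sub>R z) (u *\<^sub>R z) \<bullet> v) + u * (\<alpha> (t *\<^sub>R z) \<bullet> v))) (at t)"
      by (intro has_derivative_mult has_derivative_ident has_derivative_inner_left)
    moreover have "(\<lambda>u. t * (fderiv \<alpha> (t *\<^sub>R z) (u *\<^sub>R z) \<bullet> v) + u * (\<alpha> (t *\<^sub>R z) \<bullet> v)) = (\<lambda>u. u *\<^sub>R H t)"
      using lin[OF tz] by (simp add: H_def linear_cmul algebra_simps)
    ultimately show "((\<lambda>t. t * (\<alpha> (t *\<^sub>R z) \<bullet> v)) has_vector_derivative H t) (at t within {0..1})"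
      unfolding has_vector_derivative_def using has_derivative_at_withinI by metis
  qed simp
  then have Hi: "integral {0..1} H = \<alpha> z \<bullet> v" by (simp add: integral_unique)
  have "fderiv (ray_primitive \<alpha>) z v - \<alpha> z \<bullet> v = integral {0..1} (\<lambda>t. F z t v) - integral {0..1} H"
    using fderiv_eqI[OF leib[OF z]] Hi by simp
  also have "\<dots> = integral {0..1} (\<lambda>t. F z t v - H t)"
    by (rule integral_diff[symmetric]) (intro integrable_continuous_real Fc' z Hc)+
  also have "norm \<dots> \<le> (\<kappa> * norm z * norm v) * (1 - 0)"
  proof (rule integral_bound)
    show "continuous_on {0..1} (\<lambda>t. F z t v - H t)" by (intro continuous_intros Fc' z Hc)
    fix t :: real assume t: "t \<in> {0..1}"
    have tz: "t *\<^sub>R z \<in> ?B" using scaleR_in_ball0 z t by auto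
    have "F z t v - H t = t * (fderiv \<alpha> (t *\<^sub>R z) v \<bullet> z - fderiv \<alpha> (t *\<^sub>R z) z \<bullet> v)"
      by (simp add: F_def H_def algebra_simps)
    then have "norm (F z t v - H t) = t * \<bar>fderiv \<alpha> (t *\<^sub>R z) v \<bullet> z - fderiv \<alpha> (t *\<^sub>R z) z \<bullet> v\<bar>"
      using t by (simp add: abs_mult)
    also have "\<dots> \<le> 1 * (\<kappa> * norm v * norm z)"
      using t \<kappa>[OF tz, of v z] by (intro mult_mono) auto
    finally show "norm (F z t v - H t) \<le> \<kappa> * norm z * norm v" by (simp add: mult_ac)
  qed simp
  finally show "\<bar>fderiv (ray_primitive \<alpha>) z v - \<alpha> z \<bullet> v\<bar> \<le> \<kappa> * norm z * norm v" by simp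
qed

lemma ray_primitive_bound:
  assumes "continuous_on (ball 0 r) \<alpha>" "z \<in> ball 0 r" "\<And>x. x \<in> ball 0 r \<Longrightarrow> norm (\<alpha> x) \<le> C"
  shows "\<bar>ray_primitive \<alpha> z\<bar> \<le> C * norm z"
proof -
  have "norm (integral {0..1} (\<lambda>t. \<alpha> (t *\<^sub>R z) \<bullet> z)) \<le> (C * norm z) * (1 - 0)"
  proof (rule integral_bound)
    show "continuous_on {0..1} (\<lambda>t. \<alpha> (t *\<^sub>R z) \<bullet> z)"
      by (intro continuous_intros continuous_on_compose2[OF assms(1)]) (use scaleR_in_ball0 assms(2) in auto)
    fix t :: real assume t: "t \<in> {0..1}"
    then have "t *\<^sub>R z \<in> ball 0 r" using scaleR_in_ball0 assms(2) by auto
    then show "norm (\<alpha> (t *\<^sub>R z) \<bullet> z) \<le> C * norm z"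
      using Cauchy_Schwarz_ineq2[of "\<alpha> (t *\<^sub>R z)" z] assms(3)[of "t *\<^sub>R z"]
      by (smt (verit) mult_right_mono norm_ge_zero real_norm_def)
  qed simp
  then show ?thesis by (simp add: ray_primitive_def)
qed

lemma ray_primitive_diff:
  assumes "continuous_on (ball 0 r) \<alpha>" "continuous_on (ball 0 r) \<beta>" "z \<in> ball 0 r"
  shows "ray_primitive \<alpha> z - ray_primitive \<beta> z = ray_primitive (\<lambda>x. \<alpha> x - \<beta> x) z"
proof -
  have "(\<lambda>t. h (t *\<^sub>R z) \<bullet> z) integrable_on {0..1}" if "continuous_on (ball 0 r) h" for h
    by (intro integrable_continuous_real continuous_intros continuous_on_compose2[OF that])
      (use scaleR_in_ball0 assms(3) in auto)
  from this[OF assms(1)] this[OF assms(2)] show ?thesis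
    by (simp add: ray_primitive_def integral_diff inner_diff_left)
qed

section \<open>Completely integrable total differential equations\<close>

text \<open>The equation \<open>df = a(z, f)\<close> is solved by iterating the ray primitive of \<open>z \<mapsto> a(z, f z)\<close>. The
  iterates contract, as in the Picard-Lindelof theorem. The symmetry hypothesis says that the exterior
  derivative of \<open>z \<mapsto> a(z, f z)\<close> is controlled by the defect \<open>df - a(z, f)\<close>; hence the defects of the
  iterates tend to 0 as well, and the derivatives of the iterates converge uniformly to \<open>a(z, f)\<close>.\<close>

lemma total_differential_equation:
  fixes a :: "'a::euclidean_space \<times> real \<Rightarrow> 'a"
  assumes Om: "open \<Omega>" "(0, 0) \<in> \<Omega>" and a: "Ck_on (Suc 0) \<Omega> a"
    and sym: "\<And>p v w. p \<in> \<Omega> \<Longrightarrow> fderiv a p (v, a p \<bullet> v) \<bullet> w = fderiv a p (w, a p \<bullet> w) \<bullet> v"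
  obtains r f where "r > 0" "f 0 = 0" "\<And>z. z \<in> ball 0 r \<Longrightarrow> (z, f z) \<in> \<Omega>"
    "\<And>z. z \<in> ball 0 r \<Longrightarrow> (f has_derivative (\<lambda>v. a (z, f z) \<bullet> v)) (at z)"
proof -
  obtain R where R: "R > 0" "cball (0, 0) R \<subseteq> \<Omega>" using Om open_contains_cball by blast
  define K where "K = cball (0::'a, 0::real) R"
  have K: "compact K" "convex K" "K \<subseteq> \<Omega>" using R by (auto simp: K_def)
  have da: "(a has_derivative fderiv a p) (at p)" if "p \<in> \<Omega>" for p
    using Ck_on_has_derivative[OF a that] .
  have la: "linear (fderiv a p)" if "p \<in> \<Omega>" for p using da[OF that] has_derivative_linear by blast
  have ca: "continuous_on \<Omega> a" using Ck_on_imp_continuous_on[OF a] .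
  have cda: "continuous_on \<Omega> (\<lambda>p. fderiv a p u)" for u
    using a unfolding Ck_on.simps by blast
  define h where "h p = (\<Sum>b\<in>Basis. norm (fderiv a p b))" for p
  have hb: "norm (fderiv a p u) \<le> h p * norm u" if "p \<in> \<Omega>" for p u
  proof -
    have "norm (fderiv a p u) = norm (\<Sum>b\<in>Basis. (u \<bullet> b) *\<^sub>R fderiv a p b)"
      using linear_expand_Basis[OF la[OF that], of u] by simp
    also have "\<dots> \<le> (\<Sum>b\<in>Basis. norm u * norm (fderiv a p b))"
      by (rule sum_norm_le) (simp add: mult_right_mono Basis_le_norm)
    finally show ?thesis by (simp add: h_def sum_distrib_left mult.commute)
  qed
  have "continuous_on K h" unfolding h_def
    by (intro continuous_intros continuous_on_subset[OF cda K(3)])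
  then have "bounded (h ` K)" using K(1) compact_continuous_image compact_imp_bounded by blast
  then obtain C1 where C1: "\<And>p. p \<in> K \<Longrightarrow> norm (h p) \<le> C1" unfolding bounded_iff by blast
  have "bounded (a ` K)"
    using K(1) compact_continuous_image[OF continuous_on_subset[OF ca K(3)]] compact_imp_bounded by blast
  then obtain C2 where C2: "\<And>p. p \<in> K \<Longrightarrow> norm (a p) \<le> C2" unfolding bounded_iff by blast
  define C where "C = \<bar>C1\<bar> + \<bar>C2\<bar> + 1"
  have C: "C \<ge> 1" by (simp add: C_def)
  have Ca: "norm (a p) \<le> C" if "p \<in> K" for p using C2[OF that] by (simp add: C_def)
  have Cd: "norm (fderiv a p u) \<le> C * norm u" if "p \<in> K" for p u
  proof -
    have "h p \<le> C" using C1[OF that] by (simp add: C_def)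
    then have "h p * norm u \<le> C * norm u" by (intro mult_right_mono) auto
    then show ?thesis using hb[of p u] that K(3) by (meson order_trans subsetD)
  qed
  have Lip: "norm (a p - a q) \<le> C * norm (p - q)" if "p \<in> K" "q \<in> K" for p q
  proof (rule differentiable_bound[OF K(2) _ _ that(1) that(2)])
    show "(a has_derivative fderiv a p) (at p within K)" if "p \<in> K" for p
      using da K(3) that has_derivative_at_withinI by blast
    show "onorm (fderiv a p) \<le> C" if "p \<in> K" for p
      by (rule onorm_le) (use Cd[OF that] in auto)
  qed
  \<comment> \<open>The radius makes \<open>C r \<le> 1/8\<close>, so that consecutive iterates approach at the rate \<open>4\<^sup>-\<^sup>k\<close> and the defects
    decay at the slower rate \<open>2\<^sup>-\<^sup>k\<close>, and keeps the graphs of the iterates inside \<open>K\<close>.\<close>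
  define r where "r = min R 1 / 8 / (C + 1)"
  have r: "r > 0" unfolding r_def using R(1) C by simp
  have "r * (C + 1) = min R 1 / 8"
    using C nonzero_divide_eq_eq[of "C + 1" "min R 1 / 8" r] unfolding r_def by auto
  then have rC: "r * (C + 1) \<le> R" "r * (C + 1) \<le> 1/8" using R(1) by auto
  have Cr: "C * r \<le> 1/8" using rC(2) r by (simp add: algebra_simps)
  let ?B = "ball (0::'a) r"
  have inK: "(z, y) \<in> K" if "z \<in> ?B" "\<bar>y\<bar> \<le> C * r" for z y
  proof -
    have "norm (z, y) \<le> norm z + norm y" by (rule norm_Pair_le)
    also have "\<dots> \<le> r + C * r" using that by simp
    also have "\<dots> \<le> R" using rC(1) by (simp add: algebra_simps)
    finally show ?thesis unfolding K_def zero_prod_def[symmetric] by simp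
  qed
  define f where "f = rec_nat (\<lambda>_. 0) (\<lambda>k h. ray_primitive (\<lambda>z. a (z, h z)))"
  have f0: "f 0 z = 0" and fS: "f (Suc k) = ray_primitive (\<lambda>z. a (z, f k z))" for k z
    by (simp_all add: f_def)
  have \<alpha>1: "Ck_on (Suc 0) ?B (\<lambda>z. a (z, f k z))"
    if "Ck_on (Suc 0) ?B (f k)" "\<And>z. z \<in> ?B \<Longrightarrow> \<bar>f k z\<bar> \<le> C * r" for k
  proof (rule Ck_on_compose[OF open_ball _ a])
    show "(\<lambda>z. (z, f k z)) ` ?B \<subseteq> \<Omega>" using inK that(2) K(3) by blast
    have "Ck_on (Suc 0) ?B (\<lambda>z. (z, 0) + (0, f k z))"
    proof (rule Ck_on_add[OF open_ball])
      show "Ck_on (Suc 0) ?B (\<lambda>z. (z, 0::real))"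
        by (rule Ck_on_linear) (auto intro!: linearI)
      show "Ck_on (Suc 0) ?B (\<lambda>z. (0::'a, f k z))"
        by (rule Ck_on_linear_comp[OF open_ball _ that(1)]) (intro bounded_linear_intros)
    qed
    then show "Ck_on (Suc 0) ?B (\<lambda>z. (z, f k z))" by simp
  qed
  have *: "Ck_on (Suc 0) ?B (f k) \<and> (\<forall>z\<in>?B. \<bar>f k z\<bar> \<le> C * r)" for k
  proof (induction k)
    case 0
    then show ?case using f0 C r Ck_on_const[of "Suc 0" ?B 0] by (auto simp: f_def)
  next
    case (Suc k)
    then have \<alpha>: "Ck_on (Suc 0) ?B (\<lambda>z. a (z, f k z))" using \<alpha>1 by blast
    have "\<bar>f (Suc k) z\<bar> \<le> C * r" if z: "z \<in> ?B" for z
    proof -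
      have "\<bar>f (Suc k) z\<bar> \<le> C * norm z" unfolding fS
        by (rule ray_primitive_bound[OF Ck_on_imp_continuous_on[OF \<alpha>] z]) (use Suc Ca inK in blast)
      also have "\<dots> \<le> C * r" using z C by (intro mult_left_mono) auto
      finally show ?thesis .
    qed
    then show ?case using ray_primitive(1)[OF \<alpha>] by (simp add: fS)
  qed
  have fC: "Ck_on (Suc 0) ?B (f k)" and fb: "z \<in> ?B \<Longrightarrow> \<bar>f k z\<bar> \<le> C * r" for k z
    using * by blast+
  note \<alpha> = \<alpha>1[OF fC fb]
  have fK: "(z, f k z) \<in> K" if "z \<in> ?B" for z k using inK fb that by blast
  have fL: "norm (a (z, x) - a (z, y)) \<le> C * \<bar>x - y\<bar>"
    if "z \<in> ?B" "\<bar>x\<bar> \<le> C * r" "\<bar>y\<bar> \<le> C * r" for x y z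
    using Lip[OF inK[OF that(1,2)] inK[OF that(1,3)]] by (simp add: norm_Pair)
  have step: "\<bar>f (Suc k) z - f k z\<bar> \<le> (1/4) ^ k" if "z \<in> ?B" for k z
    using that
  proof (induction k arbitrary: z)
    case 0
    then show ?case using fb[of z "Suc 0"] Cr by (simp add: f0)
  next
    case (Suc k)
    have c: "continuous_on ?B (\<lambda>z. a (z, f k z))" for k using Ck_on_imp_continuous_on[OF \<alpha>] .
    have "\<bar>f (Suc (Suc k)) z - f (Suc k) z\<bar> = \<bar>ray_primitive (\<lambda>z. a (z, f (Suc k) z) - a (z, f k z)) z\<bar>"
      using ray_primitive_diff[OF c c Suc.prems, of "Suc k" k] by (simp only: fS)
    also have "\<dots> \<le> (C * (1/4) ^ k) * norm z"
    proof (rule ray_primitive_bound[OF continuous_on_diff[OF c c] Suc.prems])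
      show "norm (a (z, f (Suc k) z) - a (z, f k z)) \<le> C * (1/4) ^ k" if "z \<in> ?B" for z
        by (rule order_trans[OF fL[OF that fb[OF that] fb[OF that]] mult_left_mono[OF Suc.IH[OF that]]]) (use C in simp)
    qed
    also have "\<dots> \<le> (C * (1/4) ^ k) * r" using Suc.prems C by (intro mult_left_mono) auto
    also have "\<dots> = (C * r) * (1/4) ^ k" by simp
    also have "\<dots> \<le> (1/4) * (1/4) ^ k" using Cr by (intro mult_right_mono) auto
    finally show ?case by simp
  qed
  have defect: "\<bar>fderiv (f k) z v - a (z, f k z) \<bullet> v\<bar> \<le> 4 * C / 2 ^ k * norm v" if "z \<in> ?B" for k z v
    using that
  proof (induction k arbitrary: z v)
    case 0
    have "f 0 = (\<lambda>_. 0)" using f0 by auto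
    then have "\<bar>fderiv (f 0) z v - a (z, f 0 z) \<bullet> v\<bar> = \<bar>a (z, f 0 z) \<bullet> v\<bar>" by simp
    also have "\<dots> \<le> norm (a (z, f 0 z)) * norm v" by (rule Cauchy_Schwarz_ineq2)
    also have "\<dots> \<le> (4 * C) * norm v" using Ca[OF fK[OF 0], of 0] C by (intro mult_right_mono) auto
    finally show ?case by simp
  next
    case (Suc k)
    define \<alpha>k where "\<alpha>k z = a (z, f k z)" for z
    have \<alpha>k: "Ck_on (Suc 0) ?B \<alpha>k" unfolding \<alpha>k_def[abs_def] by (rule \<alpha>)
    have "\<bar>fderiv (ray_primitive \<alpha>k) z v - \<alpha>k z \<bullet> v\<bar> \<le> (2 * C * (4 * C / 2 ^ k)) * norm z * norm v"
    proof (rule ray_primitive(2)[OF \<alpha>k Suc.prems])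
      fix x v w :: 'a assume x: "x \<in> ?B"
      define p where "p = (x, f k x)"
      have p: "p \<in> K" "p \<in> \<Omega>" using fK[OF x] K(3) by (auto simp: p_def)
      have d: "fderiv \<alpha>k x v = fderiv a p (v, fderiv (f k) x v)" for v
      proof -
        have "((\<lambda>z. (z, f k z)) has_derivative (\<lambda>v. (v, fderiv (f k) x v))) (at x)"
          by (intro has_derivative_Pair has_derivative_ident Ck_on_has_derivative[OF fC x])
        from diff_chain_at[OF this da[OF p(2)[unfolded p_def]]]
        show ?thesis unfolding \<alpha>k_def[abs_def] p_def using fderiv_eqI by (fastforce simp: o_def)
      qed
      \<comment> \<open>The part \<open>a\<close> of \<open>df\<close> contributes nothing to the exterior derivative, by the symmetry hypothesis.\<close>
      define E where "E v = fderiv (f k) x v - a p \<bullet> v" for v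
      have E: "\<bar>E v\<bar> \<le> 4 * C / 2 ^ k * norm v" for v using Suc.IH[OF x, of v] by (simp add: E_def p_def)
      have split: "fderiv \<alpha>k x v = fderiv a p (v, a p \<bullet> v) + fderiv a p (0, E v)" for v
      proof -
        have "(v, fderiv (f k) x v) = (v, a p \<bullet> v) + (0, E v)" by (simp add: E_def)
        then show ?thesis unfolding d by (metis la[OF p(2)] linear_add)
      qed
      have bd: "\<bar>fderiv a p (0, E v) \<bullet> w\<bar> \<le> C * (4 * C / 2 ^ k * norm v) * norm w" for v w
      proof -
        have "\<bar>fderiv a p (0, E v) \<bullet> w\<bar> \<le> norm (fderiv a p (0, E v)) * norm w" by (rule Cauchy_Schwarz_ineq2)
        also have "norm (fderiv a p (0, E v)) \<le> C * \<bar>E v\<bar>" using Cd[OF p(1), of "(0, E v)"] by (simp add: norm_Pair)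
        also have "\<dots> \<le> C * (4 * C / 2 ^ k * norm v)" using E C by (intro mult_left_mono) auto
        finally show ?thesis by (simp add: mult_right_mono)
      qed
      have "fderiv \<alpha>k x v \<bullet> w - fderiv \<alpha>k x w \<bullet> v = fderiv a p (0, E v) \<bullet> w - fderiv a p (0, E w) \<bullet> v"
        unfolding split inner_add_left using sym[OF p(2), of v w] by simp
      also have "\<bar>\<dots>\<bar> \<le> C * (4 * C / 2 ^ k * norm v) * norm w + C * (4 * C / 2 ^ k * norm w) * norm v"
        using bd[of v w] bd[of w v] by linarith
      also have "\<dots> = 2 * C * (4 * C / 2 ^ k) * norm v * norm w" by (simp add: algebra_simps)
      finally show "\<bar>fderiv \<alpha>k x v \<bullet> w - fderiv \<alpha>k x w \<bullet> v\<bar> \<le> 2 * C * (4 * C / 2 ^ k) * norm v * norm w" .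
    qed
    also have "\<dots> \<le> (2 * C * (4 * C / 2 ^ k)) * r * norm v"
      using Suc.prems C by (intro mult_left_mono mult_right_mono) auto
    also have "\<dots> = (C * r) * (8 * C / 2 ^ k * norm v)" by simp
    also have "\<dots> \<le> 1/8 * (8 * C / 2 ^ k * norm v)" using Cr C by (intro mult_right_mono) auto
    finally have 1: "\<bar>fderiv (f (Suc k)) z v - a (z, f k z) \<bullet> v\<bar> \<le> C / 2 ^ k * norm v"
      by (simp add: fS \<alpha>k_def[abs_def])
    have "\<bar>a (z, f k z) \<bullet> v - a (z, f (Suc k) z) \<bullet> v\<bar> \<le> norm (a (z, f k z) - a (z, f (Suc k) z)) * norm v"
      unfolding inner_diff_left[symmetric] by (rule Cauchy_Schwarz_ineq2)
    also have "\<dots> \<le> (C * \<bar>f k z - f (Suc k) z\<bar>) * norm v"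
      by (intro mult_right_mono fL fb Suc.prems) simp
    also have "\<dots> \<le> (C * (1/2) ^ k) * norm v"
    proof (intro mult_right_mono mult_left_mono)
      have "\<bar>f k z - f (Suc k) z\<bar> \<le> (1/4) ^ k" using step[OF Suc.prems, of k] by (simp add: abs_minus_commute)
      also have "\<dots> \<le> (1/2) ^ k" by (intro power_mono) auto
      finally show "\<bar>f k z - f (Suc k) z\<bar> \<le> (1/2) ^ k" .
    qed (use C in auto)
    finally have 2: "\<bar>a (z, f k z) \<bullet> v - a (z, f (Suc k) z) \<bullet> v\<bar> \<le> C / 2 ^ k * norm v"
      by (simp add: power_one_over field_simps)
    have "4 * C / 2 ^ Suc k * norm v = C / 2 ^ k * norm v + C / 2 ^ k * norm v" by (simp add: field_simps)
    then show ?case using 1 2 by linarith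
  qed
  define F where "F z = (\<Sum>k. f (Suc k) z - f k z)" for z
  have "uniform_limit ?B (\<lambda>n z. \<Sum>k<n. f (Suc k) z - f k z) F sequentially"
    unfolding F_def
    by (rule Weierstrass_m_test[where M="\<lambda>k. (1/4) ^ k"]) (use step in \<open>auto intro: summable_geometric\<close>)
  moreover have "(\<lambda>n z. \<Sum>k<n. f (Suc k) z - f k z) = f"
    using sum_lessThan_telescope[of "\<lambda>k. f k _"] by (simp add: f0 fun_eq_iff)
  ultimately have ul: "uniform_limit ?B f F sequentially" by simp
  have lim: "(\<lambda>n. f n z) \<longlonglongrightarrow> F z" if "z \<in> ?B" for z using tendsto_uniform_limitI[OF ul that] .
  have Fb: "\<bar>F z\<bar> \<le> C * r" if "z \<in> ?B" for z
    by (rule LIMSEQ_le_const2[OF tendsto_rabs[OF lim[OF that]]]) (use fb[OF that] in auto)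
  have "\<exists>g. \<forall>z\<in>?B. (\<lambda>n. f n z) \<longlonglongrightarrow> g z \<and> (g has_derivative (\<lambda>v. a (z, F z) \<bullet> v)) (at z within ?B)"
  proof (rule has_derivative_sequence)
    show "(f n has_derivative fderiv (f n) z) (at z within ?B)" if "z \<in> ?B" for n z
      using Ck_on_has_derivative[OF fC that] has_derivative_at_withinI by blast
    show "0 \<in> ?B" using r by simp
    show "(\<lambda>n. f n 0) \<longlonglongrightarrow> F 0" using lim r by simp
    fix e :: real assume e: "e > 0"
    have "(\<lambda>n. 4 * C * (1/2) ^ n) \<longlonglongrightarrow> 4 * C * 0"
      by (intro tendsto_mult tendsto_const LIMSEQ_power_zero) auto
    then have "\<forall>\<^sub>F n in sequentially. 4 * C * (1/2) ^ n < e/2" using e by (intro order_tendstoD(2)) auto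
    moreover have "\<forall>\<^sub>F n in sequentially. \<forall>z\<in>?B. dist (f n z) (F z) < e / (2 * C)"
      using ul e C unfolding uniform_limit_iff by simp
    ultimately show "\<forall>\<^sub>F n in sequentially. \<forall>z\<in>?B. \<forall>v. norm (fderiv (f n) z v - a (z, F z) \<bullet> v) \<le> e * norm v"
    proof eventually_elim
      fix n assume n: "4 * C * (1/2) ^ n < e/2" "\<forall>z\<in>?B. dist (f n z) (F z) < e / (2 * C)"
      show "\<forall>z\<in>?B. \<forall>v. norm (fderiv (f n) z v - a (z, F z) \<bullet> v) \<le> e * norm v"
      proof (intro ballI allI)
        fix z v :: 'a assume z: "z \<in> ?B"
        have "4 * C / 2 ^ n * norm v \<le> e/2 * norm v"
          using n(1) by (intro mult_right_mono) (auto simp: power_one_over field_simps)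
        with defect[OF z, of n v] have 1: "\<bar>fderiv (f n) z v - a (z, f n z) \<bullet> v\<bar> \<le> e/2 * norm v" by linarith
        have "\<bar>a (z, f n z) \<bullet> v - a (z, F z) \<bullet> v\<bar> \<le> norm (a (z, f n z) - a (z, F z)) * norm v"
          unfolding inner_diff_left[symmetric] by (rule Cauchy_Schwarz_ineq2)
        also have "\<dots> \<le> (C * \<bar>f n z - F z\<bar>) * norm v"
          by (intro mult_right_mono fL fb Fb z) simp
        also have "\<dots> \<le> e/2 * norm v"
        proof (intro mult_right_mono)
          have "\<bar>f n z - F z\<bar> < e / (2 * C)" using n(2) z by (simp add: dist_real_def)
          then show "C * \<bar>f n z - F z\<bar> \<le> e/2" using C by (simp add: field_simps)
        qed simp
        finally show "norm (fderiv (f n) z v - a (z, F z) \<bullet> v) \<le> e * norm v"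
          using 1 unfolding real_norm_def by linarith
      qed
    qed
  qed simp
  then obtain g where g: "\<And>z. z \<in> ?B \<Longrightarrow> (\<lambda>n. f n z) \<longlonglongrightarrow> g z"
    "\<And>z. z \<in> ?B \<Longrightarrow> (g has_derivative (\<lambda>v. a (z, F z) \<bullet> v)) (at z within ?B)" by blast
  have gF: "g z = F z" if "z \<in> ?B" for z using LIMSEQ_unique[OF g(1)[OF that] lim[OF that]] .
  have fz: "f n 0 = 0" for n by (cases n) (simp_all add: f0 fS ray_primitive_def)
  show thesis
  proof (rule that[OF r])
    show "g 0 = 0" using LIMSEQ_unique[OF g(1)[of 0]] r by (simp add: fz)
    fix z assume z: "z \<in> ?B"
    show "(z, g z) \<in> \<Omega>" using inK[OF z Fb[OF z]] K(3) gF[OF z] by auto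
    show "(g has_derivative (\<lambda>v. a (z, g z) \<bullet> v)) (at z)"
      using g(2)[OF z] gF[OF z] at_within_open[OF z open_ball] by simp
  qed
qed

text \<open>If \<open>f\<close> is of class $C^k$, then so is its derivative \<open>a(z, f)\<close>.\<close>

lemma total_differential_equation_smooth:
  fixes a :: "'a::euclidean_space \<times> real \<Rightarrow> 'a"
  assumes B: "open B" and a: "smooth_on \<Omega> a" and f: "\<And>z. z \<in> B \<Longrightarrow> (z, f z) \<in> \<Omega>"
    "\<And>z. z \<in> B \<Longrightarrow> (f has_derivative (\<lambda>v. a (z, f z) \<bullet> v)) (at z)"
  shows "smooth_on B f"
proof (rule smooth_onI)
  fix k show "Ck_on k B f"
  proof (induction k)
    case 0
    then show ?case using f(2)
      by (auto intro!: continuous_at_imp_continuous_on has_derivative_continuous)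
  next
    case (Suc k)
    have "Ck_on k B (\<lambda>z. (z, 0) + (0, f z))"
    proof (rule Ck_on_add[OF B])
      show "Ck_on k B (\<lambda>z. (z, 0::real))" by (rule Ck_on_linear) (auto intro!: linearI)
      show "Ck_on k B (\<lambda>z. (0::'a, f z))"
        by (rule Ck_on_linear_comp[OF B _ Suc]) (intro bounded_linear_intros)
    qed
    then have "Ck_on k B (\<lambda>z. (z, f z))" by simp
    then have "Ck_on k B (\<lambda>z. a (z, f z))"
      using f(1) by (intro Ck_on_compose[OF B _ smooth_onD[OF a]]) auto
    then show ?case
      by (intro Ck_on_SucI[OF B f(2)] Ck_on_inner B Ck_on_const) auto
  qed
qed

section \<open>Tangent vectors and vector fields in charts\<close>

lemma fderiv_applyI: "(f has_derivative f') (at x) \<Longrightarrow> fderiv f x v = f' v"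
  using fderiv_eqI by metis

text \<open>The product rule for the value of a family of linear maps on a variable vector. Expanding in a
  basis keeps the family a plain function, with derivatives taken only on constant vectors.\<close>

lemma has_derivative_linear_apply:
  fixes M :: "'a::euclidean_space \<Rightarrow> 'b::euclidean_space \<Rightarrow> 'c::real_normed_vector"
  assumes S: "open S" "x \<in> S" and lin: "\<And>y. y \<in> S \<Longrightarrow> linear (M y)"
    and M: "\<And>u. (\<lambda>y. M y u) differentiable (at x)" and r: "(r has_derivative r') (at x)"
  shows "((\<lambda>y. M y (r y)) has_derivative (\<lambda>v. fderiv (\<lambda>y. M y (r x)) x v + M x (r' v))) (at x)"
proof -
  have 1: "((\<lambda>y. \<Sum>b\<in>Basis. (r y \<bullet> b) *\<^sub>R M y b) has_derivative
      (\<lambda>v. \<Sum>b\<in>Basis. (r x \<bullet> b) *\<^sub>R fderiv (\<lambda>y. M y b) x v + (r' v \<bullet> b) *\<^sub>R M x b)) (at x)"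
    by (intro has_derivative_sum has_derivative_scaleR has_derivative_inner_left r fderiv_works M)
  have 2: "((\<lambda>y. \<Sum>b\<in>Basis. (r x \<bullet> b) *\<^sub>R M y b) has_derivative
      (\<lambda>v. \<Sum>b\<in>Basis. (r x \<bullet> b) *\<^sub>R fderiv (\<lambda>y. M y b) x v)) (at x)"
    by (intro has_derivative_sum has_derivative_scaleR_right fderiv_works M)
  have "((\<lambda>y. M y (r x)) has_derivative (\<lambda>v. \<Sum>b\<in>Basis. (r x \<bullet> b) *\<^sub>R fderiv (\<lambda>y. M y b) x v)) (at x)"
    by (rule has_derivative_transform_within_open[OF 2 S]) (metis lin linear_expand_Basis)
  then have 3: "fderiv (\<lambda>y. M y (r x)) x v = (\<Sum>b\<in>Basis. (r x \<bullet> b) *\<^sub>R fderiv (\<lambda>y. M y b) x v)" for v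
    by (rule fderiv_applyI)
  have 4: "M x (r' v) = (\<Sum>b\<in>Basis. (r' v \<bullet> b) *\<^sub>R M x b)" for v
    by (rule linear_expand_Basis[OF lin[OF S(2)]])
  have "((\<lambda>y. M y (r y)) has_derivative
      (\<lambda>v. \<Sum>b\<in>Basis. (r x \<bullet> b) *\<^sub>R fderiv (\<lambda>y. M y b) x v + (r' v \<bullet> b) *\<^sub>R M x b)) (at x)"
    by (rule has_derivative_transform_within_open[OF 1 S]) (metis lin linear_expand_Basis)
  then show ?thesis unfolding 3 4 sum.distrib .
qed

subsection \<open>Charts and transition maps\<close>

lemma chart_facts:
  assumes "smooth_atlas B" "c \<in> B"
  shows "topological_chart c" "open (fst c)" "open (snd c ` fst c)"
    "q \<in> fst c \<Longrightarrow> chart_inv c (snd c q) = q"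
    "continuous_on (fst c) (snd c)" "continuous_on (snd c ` fst c) (chart_inv c)"
  using assms unfolding smooth_atlas_def topological_chart_def homeomorphism_def by auto

lemma chart_image_open:
  assumes "smooth_atlas B" "c \<in> B" "open W"
  shows "open (snd c ` (fst c \<inter> W))"
proof -
  have "snd c ` (fst c \<inter> W) = snd c ` fst c \<inter> chart_inv c -` W"
    using chart_facts(4)[OF assms(1,2)] by auto
  then show ?thesis
    using continuous_open_preimage[OF chart_facts(6)[OF assms(1,2)] chart_facts(3)[OF assms(1,2)] assms(3)] by simp
qed

lemma chart_image_open_subset:
  assumes "smooth_atlas B" "c \<in> B" "open W" "W \<subseteq> fst c"
  shows "open (snd c ` W)"
  using chart_image_open[OF assms(1-3)] assms(4) by (simp add: Int_absorb1)

lemma chart_vimage_open: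
  assumes "smooth_atlas B" "c \<in> B" "open T"
  shows "open {q \<in> fst c. snd c q \<in> T}"
proof -
  have "{q \<in> fst c. snd c q \<in> T} = fst c \<inter> snd c -` T" by auto
  then show ?thesis
    using continuous_open_preimage[OF chart_facts(5)[OF assms(1,2)] chart_facts(2)[OF assms(1,2)] assms(3)] by simp
qed

lemma transition_apply:
  assumes "smooth_atlas B" "c \<in> B" "q \<in> fst c"
  shows "transition c d (snd c q) = snd d q"
  using chart_facts(4)[OF assms] by (simp add: transition_def)

lemma transition_smooth:
  assumes "smooth_atlas B" "c \<in> B" "d \<in> B"
  shows "smooth_on (snd c ` (fst c \<inter> fst d)) (transition c d)"
  using assms unfolding smooth_atlas_def by blast

abbreviation chart_deriv :: "('m, 'e::euclidean_space) chart \<Rightarrow> ('m, 'e) chart \<Rightarrow> 'm \<Rightarrow> 'e \<Rightarrow> 'e" where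
  "chart_deriv c d q \<equiv> fderiv (transition c d) (snd c q)"

lemma chart_deriv_has_derivative:
  assumes "smooth_atlas B" "c \<in> B" "d \<in> B" "q \<in> fst c" "q \<in> fst d"
  shows "(transition c d has_derivative chart_deriv c d q) (at (snd c q))"
  using smooth_on_has_derivative[OF transition_smooth[OF assms(1-3)]] assms(4,5) by blast

lemma chart_deriv_linear:
  assumes "smooth_atlas B" "c \<in> B" "d \<in> B" "q \<in> fst c" "q \<in> fst d"
  shows "linear (chart_deriv c d q)"
  using chart_deriv_has_derivative[OF assms] has_derivative_linear by blast

lemma chart_deriv_comp:
  assumes B: "smooth_atlas B" and c: "c \<in> B" "d \<in> B" "e \<in> B" and q: "q \<in> fst c" "q \<in> fst d" "q \<in> fst e"
  shows "chart_deriv d e q (chart_deriv c d q v) = chart_deriv c e q v"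
proof -
  let ?S = "snd c ` (fst c \<inter> (fst d \<inter> fst e))"
  have S: "open ?S" by (rule chart_image_open[OF B c(1)]) (intro open_Int chart_facts(2)[OF B] c)
  have "((\<lambda>x. transition d e (transition c d x)) has_derivative
      (\<lambda>v. chart_deriv d e q (chart_deriv c d q v))) (at (snd c q))"
    by (rule has_derivative_compose[OF chart_deriv_has_derivative[OF B c(1,2) q(1,2)]])
      (simp add: transition_apply[OF B c(1) q(1)] chart_deriv_has_derivative[OF B c(2,3) q(2,3)])
  then have "(transition c e has_derivative (\<lambda>v. chart_deriv d e q (chart_deriv c d q v))) (at (snd c q))"
    by (rule has_derivative_transform_within_open[OF _ S])
      (use q in \<open>auto simp: transition_apply[OF B c(1)] transition_apply[OF B c(2)]\<close>)
  then show ?thesis by (rule fderiv_applyI[symmetric])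
qed

lemma chart_deriv_refl:
  assumes B: "smooth_atlas B" and c: "c \<in> B" and q: "q \<in> fst c"
  shows "chart_deriv c c q v = v"
proof -
  have "(transition c c has_derivative (\<lambda>v. v)) (at (snd c q))"
    by (rule has_derivative_transform_within_open[OF has_derivative_ident chart_facts(3)[OF B c]])
      (use q in \<open>auto simp: transition_apply[OF B c]\<close>)
  then show ?thesis by (rule fderiv_applyI)
qed

abbreviation local_rep :: "('m, 'e::euclidean_space) chart set \<Rightarrow> ('m, 'e) chart \<Rightarrow> ('m \<Rightarrow> 'e) \<Rightarrow> 'e \<Rightarrow> 'e" where
  "local_rep A c X \<equiv> (\<lambda>q. coords A c q (X q)) \<circ> chart_inv c"

locale smooth_manifold =
  fixes A :: "('m::{t2_space,second_countable_topology}, 'e::euclidean_space) chart set"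
  assumes atlas: "smooth_atlas A"
begin

lemma chart_at: "chart_at A p \<in> A" "p \<in> fst (chart_at A p)"
proof -
  have "\<exists>c. c \<in> A \<and> p \<in> fst c" using atlas unfolding smooth_atlas_def by blast
  from someI_ex[OF this] show "chart_at A p \<in> A" "p \<in> fst (chart_at A p)"
    by (auto simp: chart_at_def)
qed

text \<open>The tangent vectors refer to the atlas \<open>A\<close>; the charts of a larger atlas \<open>B\<close> are the charts that
  are compatible with \<open>A\<close>, such as those that exhibit an integral manifold.\<close>

context
  fixes B :: "('m, 'e) chart set"
  assumes B: "smooth_atlas B" "A \<subseteq> B"
begin

lemma chart_at_B: "chart_at A p \<in> B"
  using chart_at B by blast

lemma coords_linear: "c \<in> B \<Longrightarrow> q \<in> fst c \<Longrightarrow> linear (coords A c q)"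
  using chart_deriv_linear[OF B(1) chart_at_B _ chart_at(2)] by (simp add: coords_def[abs_def])

lemma coord_field_linear: "c \<in> B \<Longrightarrow> q \<in> fst c \<Longrightarrow> linear (\<lambda>x. coord_field A c x q)"
  using chart_deriv_linear[OF B(1) _ chart_at_B _ chart_at(2)] by (simp add: coord_field_def[abs_def])

lemma coords_coord_field: "c \<in> B \<Longrightarrow> q \<in> fst c \<Longrightarrow> coords A c q (coord_field A c x q) = x"
  unfolding coords_def coord_field_def
  by (subst chart_deriv_comp[OF B(1) _ chart_at_B]) (auto simp: chart_at chart_deriv_refl[OF B(1)])

lemma coord_field_coords: "c \<in> B \<Longrightarrow> q \<in> fst c \<Longrightarrow> coord_field A c (coords A c q v) q = v"
  unfolding coords_def coord_field_def
  by (subst chart_deriv_comp[OF B(1) chart_at_B _ chart_at_B])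
    (auto simp: chart_at chart_deriv_refl[OF B(1) chart_at_B])

lemma coords_change:
  assumes "c \<in> B" "d \<in> B" "q \<in> fst c" "q \<in> fst d"
  shows "coords A d q v = chart_deriv c d q (coords A c q v)"
  unfolding coords_def by (rule chart_deriv_comp[OF B(1) chart_at_B assms(1,2) chart_at(2) assms(3,4), symmetric])

lemma local_rep_apply: "c \<in> B \<Longrightarrow> q \<in> fst c \<Longrightarrow> local_rep A c X (snd c q) = coords A c q (X q)"
  using chart_facts(4)[OF B(1)] by simp

lemma local_rep_change:
  assumes "c \<in> B" "d \<in> B" "q \<in> fst c" "q \<in> fst d"
  shows "local_rep A d X (snd d q) = chart_deriv c d q (local_rep A c X (snd c q))"
  unfolding local_rep_apply[OF assms(1,3)] local_rep_apply[OF assms(2,4)] by (rule coords_change[OF assms])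

lemma smooth_local_rep_change:
  assumes cd: "c \<in> B" "d \<in> B" and W: "open W" "W \<subseteq> fst c" "W \<subseteq> fst d"
    and X: "smooth_on (snd c ` W) (local_rep A c X)"
  shows "smooth_on (snd d ` W) (local_rep A d X)"
proof -
  have oc: "open (snd c ` W)" and od: "open (snd d ` W)"
    using chart_image_open_subset[OF B(1)] cd W by blast+
  have "snd c ` W \<subseteq> snd c ` (fst c \<inter> fst d)" "snd d ` W \<subseteq> snd d ` (fst d \<inter> fst c)" using W by auto
  then have s: "smooth_on (snd c ` W) (transition c d)" "smooth_on (snd d ` W) (transition d c)"
    using transition_smooth[OF B(1)] cd smooth_on_subset by blast+
  have im: "transition d c ` snd d ` W \<subseteq> snd c ` W"
  proof clarify
    fix q assume "q \<in> W"
    then show "transition d c (snd d q) \<in> snd c ` W"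
      using W transition_apply[OF B(1) cd(2), of q c] by auto
  qed
  have 1: "smooth_on (snd d ` W) (\<lambda>y. fderiv (transition c d) (transition d c y) (local_rep A c X (transition d c y)))"
    by (rule smooth_on_compose[OF smooth_on_fderiv_apply[OF oc s(1) X] s(2) od im])
  show ?thesis
  proof (rule smooth_on_cong[OF 1 od])
    fix y assume "y \<in> snd d ` W"
    then obtain q where q: "q \<in> W" "y = snd d q" by blast
    then have q': "q \<in> fst c" "q \<in> fst d" using W by auto
    show "fderiv (transition c d) (transition d c y) (local_rep A c X (transition d c y)) = local_rep A d X y"
      unfolding q(2) transition_apply[OF B(1) cd(2) q'(2)] local_rep_change[OF cd q'] ..
  qed
qed

lemma smooth_field_local_rep:
  assumes "smooth_field A W X" "open W" "d \<in> B"
  shows "smooth_on (snd d ` (fst d \<inter> W)) (local_rep A d X)"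
proof (rule smooth_on_local)
  fix x assume "x \<in> snd d ` (fst d \<inter> W)"
  then obtain q where q: "q \<in> fst d" "q \<in> W" "x = snd d q" by blast
  let ?c = "chart_at A q" and ?V = "fst d \<inter> W \<inter> fst (chart_at A q)"
  have V: "open ?V" using assms chart_facts(2)[OF B(1)] chart_at_B by blast
  have "smooth_on (snd ?c ` (fst ?c \<inter> W)) (local_rep A ?c X)"
    using assms(1) chart_at(1) unfolding smooth_field_def by blast
  then have "smooth_on (snd ?c ` ?V) (local_rep A ?c X)" by (rule smooth_on_subset) auto
  then have "smooth_on (snd d ` ?V) (local_rep A d X)"
    by (rule smooth_local_rep_change[OF chart_at_B assms(3) V, rotated -1]) auto
  moreover have "open (snd d ` ?V)" by (rule chart_image_open_subset[OF B(1) assms(3) V]) auto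
  moreover have "x \<in> snd d ` ?V" using q chart_at by blast
  ultimately show "\<exists>T. open T \<and> x \<in> T \<and> smooth_on T (local_rep A d X)" by blast
qed

lemma smooth_fieldI:
  assumes "\<And>p. p \<in> W \<Longrightarrow> \<exists>c V. c \<in> B \<and> open V \<and> p \<in> V \<and> V \<subseteq> fst c \<and> smooth_on (snd c ` V) (local_rep A c X)"
  shows "smooth_field A W X"
  unfolding smooth_field_def
proof
  fix d assume d: "d \<in> A"
  then have dB: "d \<in> B" using B by blast
  show "smooth_on (snd d ` (fst d \<inter> W)) (local_rep A d X)"
  proof (rule smooth_on_local)
    fix x assume "x \<in> snd d ` (fst d \<inter> W)"
    then obtain q where q: "q \<in> fst d" "q \<in> W" "x = snd d q" by blast
    obtain c V where c: "c \<in> B" "open V" "q \<in> V" "V \<subseteq> fst c" "smooth_on (snd c ` V) (local_rep A c X)"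
      using assms[OF q(2)] by blast
    let ?V = "fst d \<inter> V"
    have V: "open ?V" using c chart_facts(2)[OF B(1) dB] by blast
    have "smooth_on (snd c ` ?V) (local_rep A c X)" by (rule smooth_on_subset[OF c(5)]) auto
    then have "smooth_on (snd d ` ?V) (local_rep A d X)"
      by (rule smooth_local_rep_change[OF c(1) dB V, rotated -1]) (use c in auto)
    moreover have "open (snd d ` ?V)" by (rule chart_image_open_subset[OF B(1) dB V]) auto
    moreover have "x \<in> snd d ` ?V" using q c by blast
    ultimately show "\<exists>T. open T \<and> x \<in> T \<and> smooth_on T (local_rep A d X)" by blast
  qed
qed

text \<open>Differentiating the transformation law of the components produces second derivatives of the
  transition map, which are symmetric and cancel in the bracket.\<close>

lemma lie_bracket_chart:
  assumes c: "c \<in> B" and p: "p \<in> fst c" and W: "open W" "p \<in> W"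
    and X: "smooth_field A W X" and Y: "smooth_field A W Y"
  shows "coords A c p (lie_bracket A X Y p) =
    fderiv (local_rep A c Y) (snd c p) (local_rep A c X (snd c p)) -
    fderiv (local_rep A c X) (snd c p) (local_rep A c Y (snd c p))"
proof -
  define d where "d = chart_at A p"
  have d: "d \<in> B" "p \<in> fst d" using chart_at_B chart_at by (auto simp: d_def)
  let ?V = "fst c \<inter> fst d \<inter> W" and ?T = "transition d c" and ?x = "snd d p"
  let ?S = "snd d ` ?V"
  have V: "open ?V" "p \<in> ?V"
    using W c d p chart_facts(2)[OF B(1) c] chart_facts(2)[OF B(1) d(1)] by auto
  have S: "open ?S" "?x \<in> ?S" using chart_image_open_subset[OF B(1) d(1) V(1)] V(2) by auto
  have Ts: "smooth_on ?S ?T" by (rule smooth_on_subset[OF transition_smooth[OF B(1) d(1) c]]) auto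
  have Tx: "?T ?x = snd c p" using transition_apply[OF B(1) d] .
  have self: "coords A d p v = v" for v
    unfolding coords_def d_def using chart_deriv_refl[OF B(1) chart_at_B chart_at(2)] .
  have key: "fderiv (local_rep A c X) (snd c p) (fderiv ?T ?x v) =
      fderiv (\<lambda>y. fderiv ?T y (local_rep A d X ?x)) ?x v + fderiv ?T ?x (fderiv (local_rep A d X) ?x v)"
    if X: "smooth_field A W X" for X v
  proof -
    have Xc: "smooth_on (snd c ` (fst c \<inter> W)) (local_rep A c X)"
      and Xd: "smooth_on (snd d ` (fst d \<inter> W)) (local_rep A d X)"
      using smooth_field_local_rep[OF X W(1)] c d by auto
    have rd: "(local_rep A d X has_derivative fderiv (local_rep A d X) ?x) (at ?x)"
      by (rule smooth_on_has_derivative[OF Xd]) (use d W in blast)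
    have rc: "(local_rep A c X has_derivative fderiv (local_rep A c X) (snd c p)) (at (?T ?x))"
      unfolding Tx by (rule smooth_on_has_derivative[OF Xc]) (use p W in blast)
    have 1: "((\<lambda>y. local_rep A c X (?T y)) has_derivative (\<lambda>v. fderiv (local_rep A c X) (snd c p) (fderiv ?T ?x v))) (at ?x)"
      by (rule has_derivative_compose[OF smooth_on_has_derivative[OF Ts S(2)] rc])
    have 2: "((\<lambda>y. fderiv ?T y (local_rep A d X y)) has_derivative
        (\<lambda>v. fderiv (\<lambda>y. fderiv ?T y (local_rep A d X ?x)) ?x v + fderiv ?T ?x (fderiv (local_rep A d X) ?x v))) (at ?x)"
    proof (rule has_derivative_linear_apply[OF S _ _ rd])
      show "linear (fderiv ?T y)" if "y \<in> ?S" for y using smooth_on_linear_fderiv[OF Ts that] .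
      show "(\<lambda>y. fderiv ?T y u) differentiable (at ?x)" for u
        using smooth_on_has_derivative[OF smooth_on_fderiv_apply[OF S(1) Ts smooth_on_const] S(2)]
        unfolding differentiable_def by blast
    qed
    have 3: "fderiv ?T y (local_rep A d X y) = local_rep A c X (?T y)" if y: "y \<in> ?S" for y
    proof -
      obtain q where q: "q \<in> ?V" "y = snd d q" using y by blast
      then have q': "q \<in> fst d" "q \<in> fst c" by auto
      show ?thesis
        unfolding q(2) transition_apply[OF B(1) d(1) q'(1)] local_rep_change[OF d(1) c q'] ..
    qed
    have "((\<lambda>y. local_rep A c X (?T y)) has_derivative
        (\<lambda>v. fderiv (\<lambda>y. fderiv ?T y (local_rep A d X ?x)) ?x v + fderiv ?T ?x (fderiv (local_rep A d X) ?x v))) (at ?x)"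
      by (rule has_derivative_transform_within_open[OF 2 S 3])
    from fun_cong[OF has_derivative_unique[OF 1 this]] show ?thesis .
  qed
  have at_p: "local_rep A d X ?x = X p" for X using local_rep_apply[OF d] self by simp
  have push: "fderiv ?T ?x (X p) = local_rep A c X (snd c p)" for X
    using local_rep_change[OF d(1) c d(2) p, of X] at_p by simp
  have lT: "linear (fderiv ?T ?x)" using smooth_on_linear_fderiv[OF Ts S(2)] .
  have br: "lie_bracket A X Y p = fderiv (local_rep A d Y) ?x (X p) - fderiv (local_rep A d X) ?x (Y p)"
    by (simp add: lie_bracket_def Let_def d_def)
  have "coords A c p (lie_bracket A X Y p) = fderiv ?T ?x (lie_bracket A X Y p)"
    unfolding coords_def d_def ..
  also have "\<dots> = fderiv ?T ?x (fderiv (local_rep A d Y) ?x (X p)) - fderiv ?T ?x (fderiv (local_rep A d X) ?x (Y p))"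
    unfolding br using lT by (simp add: linear_diff)
  also have "\<dots> = fderiv (local_rep A c Y) (snd c p) (fderiv ?T ?x (X p)) - fderiv (local_rep A c X) (snd c p) (fderiv ?T ?x (Y p))"
    unfolding key[OF X] key[OF Y] at_p
    using symmetric_second_derivative[OF S Ts, of "X p" "Y p"] by simp
  finally show ?thesis unfolding push .
qed

end

lemmas coords_linear_A = coords_linear[OF atlas order_refl]
  and coord_field_linear_A = coord_field_linear[OF atlas order_refl]
  and coords_coord_field_A = coords_coord_field[OF atlas order_refl]
  and coord_field_coords_A = coord_field_coords[OF atlas order_refl]
  and local_rep_apply_A = local_rep_apply[OF atlas order_refl]
  and smooth_field_local_rep_A = smooth_field_local_rep[OF atlas order_refl]
  and smooth_fieldI_A = smooth_fieldI[OF atlas order_refl]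
  and lie_bracket_chart_A = lie_bracket_chart[OF atlas order_refl]

lemma coords_chart_at: "coords A (chart_at A p) p v = v"
  unfolding coords_def using chart_deriv_refl[OF atlas chart_at] .

lemma coord_field_chart_at: "coord_field A (chart_at A p) v p = v"
  unfolding coord_field_def using chart_deriv_refl[OF atlas chart_at] .

lemma smooth_field_subset: "smooth_field A W X \<Longrightarrow> V \<subseteq> W \<Longrightarrow> smooth_field A V X"
  unfolding smooth_field_def by (meson Int_mono image_mono order_refl smooth_on_subset)

lemma smooth_field_of_rep:
  assumes c: "c \<in> A" and T: "open T" "T \<subseteq> snd c ` fst c" and r: "smooth_on T r"
  shows "smooth_field A {q \<in> fst c. snd c q \<in> T} (\<lambda>q. coord_field A c (r (snd c q)) q)"
proof (rule smooth_fieldI_A)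
  fix p assume p: "p \<in> {q \<in> fst c. snd c q \<in> T}"
  let ?V = "{q \<in> fst c. snd c q \<in> T}"
  have im: "snd c ` ?V = T" using T by auto
  have "smooth_on T (local_rep A c (\<lambda>q. coord_field A c (r (snd c q)) q))"
  proof (rule smooth_on_cong[OF r T(1)])
    fix x assume "x \<in> T"
    then obtain q where "q \<in> fst c" "x = snd c q" using T by blast
    then show "r x = local_rep A c (\<lambda>q. coord_field A c (r (snd c q)) q) x"
      using coords_coord_field_A[OF c] chart_facts(4)[OF atlas c] by simp
  qed
  then show "\<exists>c' V. c' \<in> A \<and> open V \<and> p \<in> V \<and> V \<subseteq> fst c' \<and>
      smooth_on (snd c' ` V) (local_rep A c' (\<lambda>q. coord_field A c (r (snd c q)) q))"
    using c chart_vimage_open[OF atlas c T(1)] p im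
    by (intro exI[of _ c] exI[of _ ?V]) auto
qed

lemma smooth_coord_field:
  assumes c: "c \<in> A" shows "smooth_field A (fst c) (coord_field A c x)"
  using smooth_field_of_rep[OF c chart_facts(3)[OF atlas c] order_refl smooth_on_const[of _ x]]
  by (rule smooth_field_subset) auto

lemma smooth_field_scaleR:
  assumes "open W" "smooth_fun A W f" "smooth_field A W X"
  shows "smooth_field A W (\<lambda>q. f q *\<^sub>R X q)"
  unfolding smooth_field_def
proof
  fix c assume c: "c \<in> A"
  have o: "open (snd c ` (fst c \<inter> W))" by (rule chart_image_open[OF atlas c assms(1)])
  have 1: "smooth_on (snd c ` (fst c \<inter> W)) (f \<circ> chart_inv c)"
    "smooth_on (snd c ` (fst c \<inter> W)) (local_rep A c X)"
    using assms c unfolding smooth_fun_def smooth_field_def by blast+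
  from smooth_on_scaleR[OF o 1] show "smooth_on (snd c ` (fst c \<inter> W)) (local_rep A c (\<lambda>q. f q *\<^sub>R X q))"
    by (rule smooth_on_cong[OF _ o])
      (auto simp: chart_facts(4)[OF atlas c] linear_cmul[OF coords_linear_A[OF c]])
qed

lemma smooth_field_diff:
  assumes "open W" "smooth_field A W X" "smooth_field A W Y"
  shows "smooth_field A W (\<lambda>q. X q - Y q)"
  unfolding smooth_field_def
proof
  fix c assume c: "c \<in> A"
  have o: "open (snd c ` (fst c \<inter> W))" by (rule chart_image_open[OF atlas c assms(1)])
  have 1: "smooth_on (snd c ` (fst c \<inter> W)) (local_rep A c X)"
    "smooth_on (snd c ` (fst c \<inter> W)) (local_rep A c Y)"
    using assms c unfolding smooth_field_def by blast+
  from smooth_on_diff[OF o 1] show "smooth_on (snd c ` (fst c \<inter> W)) (local_rep A c (\<lambda>q. X q - Y q))"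
    by (rule smooth_on_cong[OF _ o])
      (auto simp: chart_facts(4)[OF atlas c] linear_diff[OF coords_linear_A[OF c]])
qed

end

section \<open>The Frobenius theorem in codimension one\<close>

text \<open>A subspace is the common kernel of the functionals that vanish on it, and each of them is constant
  along the line.\<close>

lemma derivative_in_subspace:
  fixes f :: "'a::euclidean_space \<Rightarrow> 'b::euclidean_space"
  assumes f: "(f has_derivative f') (at x)" and S: "open S" "x \<in> S" and L: "subspace L"
    and mem: "\<And>t. x + t *\<^sub>R l \<in> S \<Longrightarrow> f (x + t *\<^sub>R l) \<in> L"
  shows "f' l \<in> L"
proof -
  have "f' l \<bullet> w = 0" if w: "w \<in> L\<^sup>\<bottom>" for w
  proof -
    define T where "T = (\<lambda>t::real. x + t *\<^sub>R l) -` S"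
    have T: "open T" "0 \<in> T" unfolding T_def using S
      by (auto intro!: open_vimage continuous_intros)
    have "((\<lambda>y. f y \<bullet> w) has_derivative (\<lambda>v. f' v \<bullet> w)) (at (x + 0 *\<^sub>R l))"
      using has_derivative_inner_left[OF f] by simp
    then have "((\<lambda>t. f (x + t *\<^sub>R l) \<bullet> w) has_real_derivative f' l \<bullet> w) (at 0)"
      by (rule has_real_derivative_along_line)
    then have "((\<lambda>t. 0) has_real_derivative f' l \<bullet> w) (at 0)"
      unfolding has_field_derivative_def
      by (rule has_derivative_transform_within_open[OF _ T])
        (use mem w in \<open>auto simp: T_def orthogonal_comp_def orthogonal_def inner_commute\<close>)
    then show ?thesis using DERIV_unique[OF _ DERIV_const] by blast
  qed
  then have "f' l \<in> L\<^sup>\<bottom>\<^sup>\<bottom>" by (auto simp: orthogonal_comp_def orthogonal_def inner_commute)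
  then show ?thesis using orthogonal_comp_self[OF L] by simp
qed

context smooth_manifold
begin

text \<open>In a chart adapted to an integral manifold, sections of the distribution have components in a
  fixed subspace along the integral manifold, and so have their derivatives along it.\<close>

lemma integrable_imp_involutive:
  assumes D: "integrable_distribution A D" and W: "open W" "p \<in> W"
    and X: "section_on A D W X" and Y: "section_on A D W Y"
  shows "lie_bracket A X Y p \<in> D p"
proof -
  obtain S where S: "p \<in> S" "integral_manifold A D S"
    using D unfolding integrable_distribution_def by blast
  obtain c L where c: "smooth_atlas (insert c A)" "p \<in> fst c" "subspace L"
    "S \<inter> fst c = {q \<in> fst c. snd c q - snd c p \<in> L}"
    "\<And>q. q \<in> S \<inter> fst c \<Longrightarrow> D q = {v. coords A c q v \<in> L}"
    using S(2)[unfolded integral_manifold_def, rule_format, OF S(1)] by blast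
  have cB: "c \<in> insert c A" "A \<subseteq> insert c A" by auto
  let ?x = "snd c p" and ?T = "snd c ` (fst c \<inter> W)"
  have T: "open ?T" "?x \<in> ?T" using chart_image_open[OF c(1) cB(1) W(1)] c(2) W(2) by auto
  have along: "local_rep A c X (?x + l) \<in> L" if X: "section_on A D W X" and l: "l \<in> L" "?x + l \<in> ?T" for X l
  proof -
    obtain q where q: "q \<in> fst c" "q \<in> W" "snd c q = ?x + l" using l(2) by force
    then have "q \<in> S \<inter> fst c" unfolding c(4) using l(1) by simp
    from c(5)[OF this] have "coords A c q (X q) \<in> L" using X q(2) unfolding section_on_def by blast
    then show ?thesis using local_rep_apply[OF c(1) cB(2) cB(1) q(1), of X] q(3) by simp
  qed
  have dL: "fderiv (local_rep A c X) ?x l \<in> L" if X: "section_on A D W X" and l: "l \<in> L" for X l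
  proof (rule derivative_in_subspace[where f="local_rep A c X" and f'="fderiv (local_rep A c X) ?x" and l=l,
        OF _ T c(3)])
    have "smooth_on ?T (local_rep A c X)"
      using smooth_field_local_rep[OF c(1) cB(2) _ W(1) cB(1)] X unfolding section_on_def by blast
    then show "(local_rep A c X has_derivative fderiv (local_rep A c X) ?x) (at ?x)"
      using T(2) by (rule smooth_on_has_derivative)
    show "local_rep A c X (?x + t *\<^sub>R l) \<in> L" if "?x + t *\<^sub>R l \<in> ?T" for t
      using along[OF X _ that] subspace_scale[OF c(3) l] by blast
  qed
  have xL: "local_rep A c X ?x \<in> L" if X: "section_on A D W X" for X
    using along[OF X subspace_0[OF c(3)]] T(2) by simp
  have "coords A c p (lie_bracket A X Y p) =
      fderiv (local_rep A c Y) ?x (local_rep A c X ?x) - fderiv (local_rep A c X) ?x (local_rep A c Y ?x)"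
    using lie_bracket_chart[OF c(1) cB(2) cB(1) c(2) W] X Y unfolding section_on_def by blast
  also have "\<dots> \<in> L" by (intro subspace_diff c(3) dL xL X Y)
  finally show ?thesis using c(5)[of p] S(1) c(2) by blast
qed

text \<open>The flattening of a leaf is a diffeomorphism of an open set \<open>Z\<close> in the model space; composed with a
  chart of the atlas it has to give a chart that is compatible with all the others.\<close>

lemma compatible_chart_comp:
  assumes c: "c \<in> A" and Z: "open Z" and sm: "smooth_on Z \<Psi>" "smooth_on Z \<Theta>"
    and im: "\<Psi> ` Z \<subseteq> Z" "\<Theta> ` Z \<subseteq> Z" and inv: "\<And>x. x \<in> Z \<Longrightarrow> \<Theta> (\<Psi> x) = x" "\<And>x. x \<in> Z \<Longrightarrow> \<Psi> (\<Theta> x) = x"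
  defines "c' \<equiv> ({q \<in> fst c. snd c q \<in> Z}, \<Psi> \<circ> snd c)"
  shows "smooth_atlas (insert c' A)"
    and "\<And>q v. q \<in> fst c \<Longrightarrow> snd c q \<in> Z \<Longrightarrow> coords A c' q v = fderiv \<Psi> (snd c q) (coords A c q v)"
proof -
  note cf = chart_facts[OF atlas c]
  have fc': "fst c' = {q \<in> fst c. snd c q \<in> Z}" and sc': "snd c' q = \<Psi> (snd c q)" for q
    by (auto simp: c'_def)
  have of: "open (fst c')" unfolding fc' by (rule chart_vimage_open[OF atlas c Z])
  have c\<Psi>: "continuous_on Z \<Psi>" "continuous_on Z \<Theta>" using sm smooth_on_imp_continuous_on by blast+
  have img: "snd c' ` (fst c' \<inter> W) = Z \<inter> \<Theta> -` (snd c ` (fst c \<inter> W))" for W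
  proof (intro equalityI subsetI)
    fix y assume "y \<in> snd c' ` (fst c' \<inter> W)"
    then obtain q where "q \<in> fst c" "snd c q \<in> Z" "q \<in> W" "y = \<Psi> (snd c q)" by (auto simp: fc' sc')
    then show "y \<in> Z \<inter> \<Theta> -` (snd c ` (fst c \<inter> W))" using im(1) inv(1) by auto
  next
    fix y assume "y \<in> Z \<inter> \<Theta> -` (snd c ` (fst c \<inter> W))"
    then obtain q where q: "q \<in> fst c" "q \<in> W" "\<Theta> y = snd c q" "y \<in> Z" by auto
    then have "snd c q \<in> Z" using im(2) by (metis image_subset_iff)
    moreover have "y = \<Psi> (snd c q)" using inv(2) q by metis
    ultimately show "y \<in> snd c' ` (fst c' \<inter> W)" using q by (auto simp: fc' sc')
  qed
  have oi: "open (snd c' ` (fst c' \<inter> W))" if "open W" for W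
    unfolding img by (rule continuous_open_preimage[OF c\<Psi>(2) Z chart_image_open[OF atlas c that]])
  have c'inv: "chart_inv c' (\<Psi> (snd c q)) = q" if "q \<in> fst c'" for q
  proof -
    have "inj_on (snd c') (fst c')"
    proof (rule inj_on_inverseI)
      show "chart_inv c (\<Theta> (snd c' q)) = q" if "q \<in> fst c'" for q
        using that inv(1) cf(4) by (auto simp: fc' sc')
    qed
    then show ?thesis using that inv_into_f_f[of "snd c'" "fst c'" q] by (simp add: sc')
  qed
  have ci: "chart_inv c' y = chart_inv c (\<Theta> y)" if "y \<in> snd c' ` fst c'" for y
    using that c'inv inv(1) cf(4) by (auto simp: fc' sc')
  have imc: "\<Theta> ` snd c' ` fst c' \<subseteq> snd c ` fst c" using inv(1) by (auto simp: fc' sc')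
  have top: "topological_chart c'"
    unfolding topological_chart_def homeomorphism_def
  proof (intro conjI)
    show "open (fst c')" by (rule of)
    show "open (snd c' ` fst c')" using oi[of UNIV] by simp
    show "\<forall>q\<in>fst c'. chart_inv c' (snd c' q) = q" using c'inv by (simp add: sc')
    show "snd c' ` fst c' = snd c' ` fst c'" ..
    show "continuous_on (fst c') (snd c')"
      unfolding c'_def snd_conv fst_conv
      by (intro continuous_on_compose continuous_on_subset[OF cf(5)] continuous_on_subset[OF c\<Psi>(1)]) auto
    show "\<forall>y\<in>snd c' ` fst c'. snd c' (chart_inv c' y) = y" using c'inv by (auto simp: sc')
    show "chart_inv c' ` snd c' ` fst c' = fst c'" using c'inv by (force simp: sc')
    have "continuous_on (snd c' ` fst c') (\<lambda>y. chart_inv c (\<Theta> y))"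
      by (rule continuous_on_compose2[OF cf(6) continuous_on_subset[OF c\<Psi>(2)] imc])
        (use img[of UNIV] in auto)
    then show "continuous_on (snd c' ` fst c') (chart_inv c')"
      by (rule continuous_on_eq) (simp add: ci)
  qed
  have to: "smooth_on (snd c' ` (fst c' \<inter> fst d)) (transition c' d)" if d: "d \<in> A" for d
  proof -
    have o: "open (snd c' ` (fst c' \<inter> fst d))" by (rule oi[OF chart_facts(2)[OF atlas d]])
    have "smooth_on (snd c' ` (fst c' \<inter> fst d)) (\<lambda>y. transition c d (\<Theta> y))"
    proof (rule smooth_on_compose[OF transition_smooth[OF atlas c d] _ o])
      show "smooth_on (snd c' ` (fst c' \<inter> fst d)) \<Theta>"
        by (rule smooth_on_subset[OF sm(2)]) (auto simp: img)
      show "\<Theta> ` snd c' ` (fst c' \<inter> fst d) \<subseteq> snd c ` (fst c \<inter> fst d)" by (auto simp: img)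
    qed
    then show ?thesis
      by (rule smooth_on_cong[OF _ o]) (use ci in \<open>auto simp: transition_def\<close>)
  qed
  have tr: "smooth_on (snd d ` (fst d \<inter> fst c')) (transition d c')" if d: "d \<in> A" for d
  proof -
    let ?T = "snd d ` (fst d \<inter> fst c')"
    have o: "open ?T" by (rule chart_image_open[OF atlas d of])
    have "smooth_on ?T (\<lambda>y. \<Psi> (transition d c y))"
    proof (rule smooth_on_compose[OF sm(1) _ o])
      show "smooth_on ?T (transition d c)"
        by (rule smooth_on_subset[OF transition_smooth[OF atlas d c]]) (auto simp: fc')
      show "transition d c ` ?T \<subseteq> Z"
      proof clarify
        fix q assume "q \<in> fst d" "q \<in> fst c'"
        then show "transition d c (snd d q) \<in> Z" using transition_apply[OF atlas d, of q c] by (simp add: fc')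
      qed
    qed
    then show ?thesis by (rule smooth_on_cong[OF _ o]) (simp add: transition_def sc')
  qed
  have self: "smooth_on (snd c' ` (fst c' \<inter> fst c')) (transition c' c')"
    by (rule smooth_on_cong[OF smooth_on_ident oi[OF of]]) (auto simp: transition_def sc' c'inv)
  show at': "smooth_atlas (insert c' A)"
    using atlas top to tr self unfolding smooth_atlas_def by auto
  fix q v assume q: "q \<in> fst c" "snd c q \<in> Z"
  have q': "q \<in> fst c'" using q by (simp add: fc')
  have "(transition c c' has_derivative fderiv \<Psi> (snd c q)) (at (snd c q))"
  proof (rule has_derivative_transform_within_open[OF smooth_on_has_derivative[OF sm(1) q(2)]])
    show "open (snd c ` (fst c \<inter> fst c'))" by (rule chart_image_open[OF atlas c of])
    show "snd c q \<in> snd c ` (fst c \<inter> fst c')" using q q' by blast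
    show "\<Psi> x = transition c c' x" if "x \<in> snd c ` (fst c \<inter> fst c')" for x
      by (simp add: transition_def sc' cf(4)) (use that cf(4) in auto)
  qed
  then have "chart_deriv c c' q = fderiv \<Psi> (snd c q)" by (rule fderiv_eqI)
  then show "coords A c' q v = fderiv \<Psi> (snd c q) (coords A c q v)"
    using coords_change[OF at' _ _ _ q(1) q'] c by auto
qed

end

text \<open>An involutive 1-form \<open>\<omega>\<close> has a leaf through every point that is the graph of a function over the
  kernel of \<open>\<omega> x\<^sub>0\<close>: normalising \<open>\<omega>\<close> on a transversal vector \<open>e\<close>, the condition that the graph be
  tangent to the kernel of \<open>\<omega>\<close> is a total differential equation, whose integrability condition is
  involutivity. The function is extended to be constant in the direction of \<open>e\<close>.\<close>

lemma leaf_as_graph: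
  fixes \<omega> :: "'a::euclidean_space \<Rightarrow> 'a"
  assumes Om: "open \<Omega>" "x0 \<in> \<Omega>" and \<omega>: "smooth_on \<Omega> \<omega>" "\<omega> x0 \<noteq> 0"
    and inv: "\<And>x v w. x \<in> \<Omega> \<Longrightarrow> \<omega> x \<bullet> v = 0 \<Longrightarrow> \<omega> x \<bullet> w = 0 \<Longrightarrow> fderiv \<omega> x v \<bullet> w = fderiv \<omega> x w \<bullet> v"
  obtains b e r f where "b \<bullet> e = (1::real)" "r > 0" "f 0 = 0" "smooth_on (ball 0 r) f"
    "\<And>x. norm (x - (b \<bullet> x) *\<^sub>R e) < r \<Longrightarrow> b \<bullet> x = f (x - (b \<bullet> x) *\<^sub>R e) \<Longrightarrow> x0 + x \<in> \<Omega> \<and>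
      (\<exists>k. k \<noteq> 0 \<and> (\<forall>v. b \<bullet> v - fderiv f (x - (b \<bullet> x) *\<^sub>R e) (v - (b \<bullet> v) *\<^sub>R e) = k * (\<omega> (x0 + x) \<bullet> v)))"
proof -
  define b where "b = \<omega> x0"
  define e where "e = (1 / (b \<bullet> b)) *\<^sub>R b"
  have be: "b \<bullet> e = 1" using \<omega>(2) by (simp add: e_def b_def)
  define \<pi> where "\<pi> v = v - (b \<bullet> v) *\<^sub>R e" for v
  have l\<pi>: "linear \<pi>" unfolding \<pi>_def by (intro linearI) (auto simp: inner_add_right algebra_simps)
  have b\<pi>: "b \<bullet> \<pi> v = 0" for v using be by (simp add: \<pi>_def inner_diff_right)
  have ce: "continuous_on \<Omega> (\<lambda>x. \<omega> x \<bullet> e)"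
    by (intro continuous_intros smooth_on_imp_continuous_on \<omega>(1))
  define \<Omega>' where "\<Omega>' = \<Omega> \<inter> (\<lambda>x. \<omega> x \<bullet> e) -` {0<..}"
  have Om': "open \<Omega>'" "\<Omega>' \<subseteq> \<Omega>" "x0 \<in> \<Omega>'"
    unfolding \<Omega>'_def using continuous_open_preimage[OF ce Om(1), of "{0<..}"] Om(2) be
    by (auto simp: b_def)
  define m where "m x = inverse (\<omega> x \<bullet> e)" for x
  have mpos: "\<omega> x \<bullet> e > 0" "m x > 0" "(\<omega> x \<bullet> e) * m x = 1" if "x \<in> \<Omega>'" for x
    using that by (auto simp: \<Omega>'_def m_def)
  have \<omega>': "smooth_on \<Omega>' \<omega>" using smooth_on_subset \<omega>(1) Om'(2) by blast
  have sm: "smooth_on \<Omega>' m"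
  proof (rule smooth_on_linear_solution[where M="\<lambda>x y. (\<omega> x \<bullet> e) * y" and b="\<lambda>_. 1"])
    show "linear (\<lambda>y. (\<omega> x \<bullet> e) * y)" for x by (intro linearI) (auto simp: algebra_simps)
    show "inj (\<lambda>y. (\<omega> x \<bullet> e) * y)" if "x \<in> \<Omega>'" for x using mpos(1)[OF that] by (auto intro!: injI)
  qed (auto intro!: smooth_on_intros \<omega>' Om' simp: mpos)
  \<comment> \<open>The multiple of \<open>\<omega>\<close> that takes the value 1 on \<open>e\<close>; it is again involutive.\<close>
  define \<beta> where "\<beta> x = m x *\<^sub>R \<omega> x" for x
  have s\<beta>: "smooth_on \<Omega>' \<beta>" unfolding \<beta>_def by (intro smooth_on_scaleR Om' sm \<omega>')
  have \<beta>e: "\<beta> x \<bullet> e = 1" if "x \<in> \<Omega>'" for x using mpos(3)[OF that] by (simp add: \<beta>_def mult.commute)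
  have \<beta>0: "\<beta> x \<bullet> v = 0 \<longleftrightarrow> \<omega> x \<bullet> v = 0" if "x \<in> \<Omega>'" for x v using mpos(2)[OF that] by (simp add: \<beta>_def)
  have d\<beta>: "fderiv \<beta> x v = m x *\<^sub>R fderiv \<omega> x v + fderiv m x v *\<^sub>R \<omega> x" if "x \<in> \<Omega>'" for x v
    unfolding \<beta>_def
    by (rule fderiv_applyI[OF has_derivative_scaleR[OF smooth_on_has_derivative[OF sm that]
          smooth_on_has_derivative[OF \<omega>' that]]])
  have \<beta>inv: "fderiv \<beta> x v \<bullet> w = fderiv \<beta> x w \<bullet> v" if "x \<in> \<Omega>'" "\<beta> x \<bullet> v = 0" "\<beta> x \<bullet> w = 0" for x v w
    using that inv[of x v w] Om'(2) \<beta>0[OF that(1)]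
    by (auto simp: d\<beta> inner_add_left)
  have d\<beta>e: "fderiv \<beta> x v \<bullet> e = 0" if x: "x \<in> \<Omega>'" for x v
  proof -
    have "((\<lambda>x. \<beta> x \<bullet> e) has_derivative (\<lambda>v. fderiv \<beta> x v \<bullet> e)) (at x)"
      by (rule has_derivative_inner_left[OF smooth_on_has_derivative[OF s\<beta> x]])
    then have "((\<lambda>x. 1) has_derivative (\<lambda>v. fderiv \<beta> x v \<bullet> e)) (at x)"
      by (rule has_derivative_transform_within_open[OF _ Om'(1) x]) (simp add: \<beta>e)
    from fun_cong[OF has_derivative_unique[OF this has_derivative_const]] show ?thesis .
  qed
  define \<sigma> where "\<sigma> p = x0 + \<pi> (fst p) + snd p *\<^sub>R e" for p
  \<comment> \<open>For the graph of \<open>f\<close> over \<open>ker b\<close>, tangency to \<open>ker \<beta>\<close> reads \<open>df v = - \<beta> (\<pi> v)\<close>, and \<open>- \<beta> \<circ> \<pi> = b - \<beta>\<close>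
    since \<open>\<beta> e = 1\<close>.\<close>
  define a where "a p = b - \<beta> (\<sigma> p)" for p
  define \<Lambda> where "\<Lambda> = \<sigma> -` \<Omega>'"
  have l\<sigma>: "linear (\<lambda>p. \<pi> (fst p) + snd p *\<^sub>R e)"
    by (intro linearI) (auto simp: linear_add[OF l\<pi>] linear_cmul[OF l\<pi>] algebra_simps)
  have \<sigma>eq: "\<sigma> = (\<lambda>p. x0 + (\<pi> (fst p) + snd p *\<^sub>R e))" by (auto simp: \<sigma>_def)
  have s\<sigma>: "smooth_on T \<sigma>" for T
    unfolding \<sigma>eq by (rule smooth_on_subset[OF _ subset_UNIV])
      (intro smooth_on_add smooth_on_const smooth_on_linear l\<sigma> open_UNIV)
  have \<Lambda>: "open \<Lambda>" "(0, 0) \<in> \<Lambda>"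
    unfolding \<Lambda>_def using open_vimage[OF Om'(1) smooth_on_imp_continuous_on[OF s\<sigma>]] Om'(3)
    by (auto simp: \<sigma>_def linear_0[OF l\<pi>])
  have sa: "smooth_on \<Lambda> a" unfolding a_def
    by (intro smooth_on_diff smooth_on_const \<Lambda> smooth_on_compose[OF s\<beta> s\<sigma>]) (auto simp: \<Lambda>_def)
  have d\<sigma>: "(\<sigma> has_derivative (\<lambda>p. \<pi> (fst p) + snd p *\<^sub>R e)) (at p)" for p
    unfolding \<sigma>eq using has_derivative_add[OF has_derivative_const
        bounded_linear_imp_has_derivative[OF l\<sigma>[unfolded linear_conv_bounded_linear]]] by simp
  have da: "fderiv a p (v, s) = - fderiv \<beta> (\<sigma> p) (\<pi> v + s *\<^sub>R e)" if "p \<in> \<Lambda>" for p v s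
  proof -
    have "\<sigma> p \<in> \<Omega>'" using that by (simp add: \<Lambda>_def)
    from has_derivative_diff[OF has_derivative_const has_derivative_compose[OF d\<sigma>
          smooth_on_has_derivative[OF s\<beta> this]], of b]
    have "(a has_derivative (\<lambda>u. 0 - fderiv \<beta> (\<sigma> p) (\<pi> (fst u) + snd u *\<^sub>R e))) (at p)"
      by (simp add: a_def[abs_def])
    from fderiv_applyI[OF this] show ?thesis by simp
  qed
  have a\<pi>: "a p \<bullet> v = - (\<beta> (\<sigma> p) \<bullet> \<pi> v)" if "p \<in> \<Lambda>" for p v
    using \<beta>e[of "\<sigma> p"] that by (simp add: a_def \<pi>_def \<Lambda>_def inner_diff_left inner_diff_right)
  have sym: "fderiv a p (v, a p \<bullet> v) \<bullet> w = fderiv a p (w, a p \<bullet> w) \<bullet> v" if p: "p \<in> \<Lambda>" for p v w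
  proof -
    have x: "\<sigma> p \<in> \<Omega>'" using p by (simp add: \<Lambda>_def)
    \<comment> \<open>The tangent vector of the graph over \<open>v\<close>; it differs from \<open>v\<close> by a multiple of \<open>e\<close>, which the
      derivative of \<open>\<beta>\<close> annihilates.\<close>
    define hat where "hat v = \<pi> v + (a p \<bullet> v) *\<^sub>R e" for v
    have ker: "\<beta> (\<sigma> p) \<bullet> hat v = 0" for v using a\<pi>[OF p] \<beta>e[OF x] by (simp add: hat_def inner_add_right inner_diff_right)
    have drop: "fderiv \<beta> (\<sigma> p) u \<bullet> v = fderiv \<beta> (\<sigma> p) u \<bullet> hat v" for u v
      using d\<beta>e[OF x, of u] by (simp add: hat_def \<pi>_def inner_add_right inner_diff_right)
    show ?thesis unfolding da[OF p] hat_def[symmetric] inner_minus_left drop[of _ w] drop[of _ v]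
      using \<beta>inv[OF x ker ker] by simp
  qed
  obtain r f where f: "r > 0" "f 0 = 0" "\<And>z. z \<in> ball 0 r \<Longrightarrow> (z, f z) \<in> \<Lambda>"
    "\<And>z. z \<in> ball 0 r \<Longrightarrow> (f has_derivative (\<lambda>v. a (z, f z) \<bullet> v)) (at z)"
    using total_differential_equation[OF \<Lambda> smooth_onD[OF sa] sym] by blast
  show thesis
  proof (rule that[OF be f(1,2) total_differential_equation_smooth[OF open_ball sa f(3,4)]])
    fix x assume x: "norm (x - (b \<bullet> x) *\<^sub>R e) < r" "b \<bullet> x = f (x - (b \<bullet> x) *\<^sub>R e)"
    define z where "z = \<pi> x"
    have z: "z \<in> ball 0 r" using x(1) by (simp add: z_def \<pi>_def)
    have "\<pi> z = z" using b\<pi>[of x] by (simp add: z_def \<pi>_def[of "\<pi> x"])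
    then have \<sigma>z: "\<sigma> (z, f z) = x0 + x" using x(2) by (simp add: \<sigma>_def z_def \<pi>_def)
    have xO: "x0 + x \<in> \<Omega>'" using f(3)[OF z] \<sigma>z by (simp add: \<Lambda>_def)
    have "b \<bullet> v - fderiv f z (\<pi> v) = m (x0 + x) * (\<omega> (x0 + x) \<bullet> v)" for v
    proof -
      have "fderiv f z (\<pi> v) = a (z, f z) \<bullet> \<pi> v" by (rule fderiv_applyI[OF f(4)[OF z]])
      also have "\<dots> = - (\<beta> (x0 + x) \<bullet> \<pi> v)" unfolding a_def \<sigma>z inner_diff_left b\<pi> by simp
      also have "\<dots> = (b \<bullet> v) - \<beta> (x0 + x) \<bullet> v" using \<beta>e[OF xO] by (simp add: \<pi>_def inner_diff_right)
      finally show ?thesis by (simp add: \<beta>_def)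
    qed
    then show "x0 + x \<in> \<Omega> \<and> (\<exists>k. k \<noteq> 0 \<and> (\<forall>v. b \<bullet> v - fderiv f (x - (b \<bullet> x) *\<^sub>R e) (v - (b \<bullet> v) *\<^sub>R e) = k * (\<omega> (x0 + x) \<bullet> v)))"
      using xO Om'(2) mpos(2)[OF xO] unfolding z_def \<pi>_def by (metis less_irrefl subsetD)
  qed
qed

text \<open>The leaf through \<open>p\<close> is flattened by the shear \<open>\<Psi>\<close> that subtracts the function of which it is the
  graph. The inverse of \<open>\<Psi>\<close> adds the function back, because the function is constant in the direction
  of the shear.\<close>

lemma (in smooth_manifold) frobenius_codimension_one:
  fixes \<omega> :: "'e \<Rightarrow> 'e"
  assumes c: "c \<in> A" "p \<in> fst c" and Om: "open \<Omega>" "snd c p \<in> \<Omega>"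
    and \<omega>: "smooth_on \<Omega> \<omega>" "\<omega> (snd c p) \<noteq> 0"
    and D: "\<And>q. q \<in> fst c \<Longrightarrow> snd c q \<in> \<Omega> \<Longrightarrow> D q = {v. \<omega> (snd c q) \<bullet> coords A c q v = 0}"
    and inv: "\<And>x v w. x \<in> \<Omega> \<Longrightarrow> \<omega> x \<bullet> v = 0 \<Longrightarrow> \<omega> x \<bullet> w = 0 \<Longrightarrow> fderiv \<omega> x v \<bullet> w = fderiv \<omega> x w \<bullet> v"
  shows "\<exists>S. p \<in> S \<and> integral_manifold A D S"
proof -
  let ?x0 = "snd c p"
  obtain b e r f where bef: "b \<bullet> e = (1::real)" "r > 0" "f 0 = 0" "smooth_on (ball 0 r) f"
    and leaf: "\<And>x. norm (x - (b \<bullet> x) *\<^sub>R e) < r \<Longrightarrow> b \<bullet> x = f (x - (b \<bullet> x) *\<^sub>R e) \<Longrightarrow> ?x0 + x \<in> \<Omega> \<and>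
      (\<exists>k. k \<noteq> 0 \<and> (\<forall>v. b \<bullet> v - fderiv f (x - (b \<bullet> x) *\<^sub>R e) (v - (b \<bullet> v) *\<^sub>R e) = k * (\<omega> (?x0 + x) \<bullet> v)))"
    using leaf_as_graph[OF Om \<omega> inv] by blast
  define \<pi> where "\<pi> v = v - (b \<bullet> v) *\<^sub>R e" for v
  have l\<pi>: "linear \<pi>" unfolding \<pi>_def by (intro linearI) (auto simp: inner_add_right algebra_simps)
  have \<pi>e: "\<pi> (v + s *\<^sub>R e) = \<pi> v" for v s using bef(1) by (simp add: \<pi>_def inner_add_right algebra_simps)
  define F where "F x = f (\<pi> (x - ?x0))" for x
  define Z where "Z = {x. \<pi> (x - ?x0) \<in> ball 0 r}"
  define \<Psi> where "\<Psi> x = x - F x *\<^sub>R e" for x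
  define \<Theta> where "\<Theta> x = x + F x *\<^sub>R e" for x
  have c\<pi>: "continuous_on UNIV (\<lambda>x. \<pi> (x - ?x0))"
    by (rule continuous_on_compose2[OF linear_continuous_on[OF l\<pi>[unfolded linear_conv_bounded_linear]]])
      (auto intro!: continuous_intros)
  have Z: "open Z" unfolding Z_def using open_vimage[OF open_ball c\<pi>, of 0 r] unfolding vimage_def .
  have s\<pi>: "smooth_on Z (\<lambda>x. \<pi> (x - ?x0))"
    by (rule smooth_on_compose[OF smooth_on_linear[OF l\<pi>, of UNIV]]) (auto intro!: smooth_on_intros Z)
  have sF: "smooth_on Z F" unfolding F_def
    by (rule smooth_on_compose[OF bef(4) s\<pi> Z]) (auto simp: Z_def)
  have sm: "smooth_on Z \<Psi>" "smooth_on Z \<Theta>" unfolding \<Psi>_def \<Theta>_def by (intro smooth_on_intros Z sF)+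
  have inv0: "\<pi> (x + s *\<^sub>R e - ?x0) = \<pi> (x - ?x0)" for x s
    using \<pi>e[of "x - ?x0" s] by (simp add: algebra_simps)
  have inv1: "\<pi> (\<Psi> x - ?x0) = \<pi> (x - ?x0)" "\<pi> (\<Theta> x - ?x0) = \<pi> (x - ?x0)" for x
    using inv0[of x "- F x"] inv0[of x "F x"] by (auto simp: \<Psi>_def \<Theta>_def)
  have inv2: "F (\<Psi> x) = F x" "F (\<Theta> x) = F x" for x by (simp_all only: F_def inv1)
  have im: "\<Psi> ` Z \<subseteq> Z" "\<Theta> ` Z \<subseteq> Z" unfolding Z_def using inv1 by auto
  have inv3: "\<Theta> (\<Psi> x) = x" "\<Psi> (\<Theta> x) = x" for x
    using inv2[of x] by (simp_all add: \<Theta>_def[of "\<Psi> x"] \<Psi>_def[of "\<Theta> x"]) (simp_all add: \<Theta>_def \<Psi>_def)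
  define c' where "c' = ({q \<in> fst c. snd c q \<in> Z}, \<Psi> \<circ> snd c)"
  note new = compatible_chart_comp[OF c(1) Z sm im inv3, folded c'_def]
  define L where "L = {v. b \<bullet> v = 0}"
  have L: "subspace L" unfolding L_def by (rule subspace_hyperplane)
  have \<Psi>x0: "\<Psi> ?x0 = ?x0" using bef(3) by (simp add: \<Psi>_def F_def linear_0[OF l\<pi>])
  have pZ: "?x0 \<in> Z" using bef(2) by (simp add: Z_def linear_0[OF l\<pi>])
  define S where "S = {q \<in> fst c'. snd c' q - ?x0 \<in> L}"
  have "integral_manifold A D S"
    unfolding integral_manifold_def
  proof
    fix p' assume p': "p' \<in> S"
    have 1: "S \<inter> fst c' = {q \<in> fst c'. snd c' q - snd c' p' \<in> L}"
      using p' by (auto simp: S_def L_def inner_diff_right)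
    have 2: "D q = {v. coords A c' q v \<in> L}" if q: "q \<in> S \<inter> fst c'" for q
    proof -
      let ?y = "snd c q"
      define x where "x = ?y - ?x0"
      have qc: "q \<in> fst c" "?y \<in> Z" using q by (auto simp: S_def c'_def)
      have "b \<bullet> (\<Psi> ?y - ?x0) = 0" using q by (simp add: S_def c'_def L_def)
      then have bx: "b \<bullet> x = f (\<pi> x)"
        using bef(1) by (simp add: x_def \<Psi>_def F_def inner_diff_right algebra_simps)
      have nx: "norm (\<pi> x) < r" using qc(2) by (simp add: Z_def x_def)
      obtain k where k: "?y \<in> \<Omega>" "k \<noteq> 0"
        "\<And>v. b \<bullet> v - fderiv f (\<pi> x) (\<pi> v) = k * (\<omega> ?y \<bullet> v)"
        using leaf[of x, folded \<pi>_def] nx bx by (auto simp: x_def)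
      have "((\<lambda>y. y - ?x0) has_derivative (\<lambda>v. v)) (at ?y)" by (auto intro!: derivative_eq_intros)
      from has_derivative_compose[OF this bounded_linear_imp_has_derivative[OF l\<pi>[unfolded linear_conv_bounded_linear]]]
      have d1: "((\<lambda>y. \<pi> (y - ?x0)) has_derivative \<pi>) (at ?y)" .
      have d2: "(f has_derivative fderiv f (\<pi> x)) (at (\<pi> (?y - ?x0)))"
        unfolding x_def[symmetric] using smooth_on_has_derivative[OF bef(4)] nx by simp
      have "(F has_derivative (\<lambda>v. fderiv f (\<pi> x) (\<pi> v))) (at ?y)"
        using has_derivative_compose[OF d1 d2] unfolding F_def[abs_def] .
      then have "(\<Psi> has_derivative (\<lambda>v. v - fderiv f (\<pi> x) (\<pi> v) *\<^sub>R e)) (at ?y)"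
        unfolding \<Psi>_def by (intro has_derivative_diff has_derivative_ident has_derivative_scaleR_left)
      then have "b \<bullet> fderiv \<Psi> ?y v = k * (\<omega> ?y \<bullet> v)" for v
        using k(3)[of v] bef(1) by (simp add: fderiv_applyI inner_diff_right)
      then have "coords A c' q v \<in> L \<longleftrightarrow> \<omega> ?y \<bullet> coords A c q v = 0" for v
        using new(2)[OF qc] k(2) by (simp add: L_def)
      then show ?thesis using D[OF qc(1) k(1)] by simp
    qed
    show "\<exists>c L. smooth_atlas (insert c A) \<and> p' \<in> fst c \<and> subspace L \<and>
        S \<inter> fst c = {q \<in> fst c. snd c q - snd c p' \<in> L} \<and> (\<forall>q\<in>S \<inter> fst c. D q = {v. coords A c q v \<in> L})"
      using new(1) p' L 1 2 by (intro exI[of _ c'] exI[of _ L]) (auto simp: S_def)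
  qed
  moreover have "p \<in> S" using c pZ \<Psi>x0 L by (simp add: S_def c'_def subspace_0)
  ultimately show ?thesis by blast
qed

section \<open>Affine connections in coordinates\<close>

context smooth_manifold
begin

lemma smooth_field_add:
  assumes "open W" "smooth_field A W X" "smooth_field A W Y"
  shows "smooth_field A W (\<lambda>q. X q + Y q)"
  unfolding smooth_field_def
proof
  fix c assume c: "c \<in> A"
  have o: "open (snd c ` (fst c \<inter> W))" by (rule chart_image_open[OF atlas c assms(1)])
  have 1: "smooth_on (snd c ` (fst c \<inter> W)) (local_rep A c X)"
    "smooth_on (snd c ` (fst c \<inter> W)) (local_rep A c Y)"
    using assms c unfolding smooth_field_def by blast+
  from smooth_on_add[OF o 1] show "smooth_on (snd c ` (fst c \<inter> W)) (local_rep A c (\<lambda>q. X q + Y q))"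
    by (rule smooth_on_cong[OF _ o])
      (auto simp: chart_facts(4)[OF atlas c] linear_add[OF coords_linear_A[OF c]])
qed

lemma smooth_fun_const: "smooth_fun A W (\<lambda>_. k)"
  unfolding smooth_fun_def o_def by (simp add: smooth_on_const)

lemma smooth_field_zero:
  assumes "open W" shows "smooth_field A W (\<lambda>_. 0)"
  unfolding smooth_field_def
proof
  fix c assume c: "c \<in> A"
  show "smooth_on (snd c ` (fst c \<inter> W)) (local_rep A c (\<lambda>_. 0))"
    by (rule smooth_on_cong[OF smooth_on_const[of _ 0] chart_image_open[OF atlas c assms]])
      (auto simp: chart_facts(4)[OF atlas c] linear_0[OF coords_linear_A[OF c]])
qed

lemma smooth_field_sum:
  assumes "open W" "finite I" "\<And>i. i \<in> I \<Longrightarrow> smooth_field A W (X i)"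
  shows "smooth_field A W (\<lambda>q. \<Sum>i\<in>I. X i q)"
  using assms(2,3)
proof (induction I rule: finite_induct)
  case empty
  then show ?case using smooth_field_zero[OF assms(1)] by simp
next
  case (insert i I)
  then show ?case using smooth_field_add[OF assms(1), of "X i" "\<lambda>q. \<Sum>i\<in>I. X i q"] by simp
qed

lemma smooth_fun_cong:
  assumes "open W" "smooth_fun A W f" "\<And>q. q \<in> W \<Longrightarrow> f q = h q"
  shows "smooth_fun A W h"
  unfolding smooth_fun_def
proof
  fix c assume c: "c \<in> A"
  have "smooth_on (snd c ` (fst c \<inter> W)) (f \<circ> chart_inv c)" using assms(2) c unfolding smooth_fun_def by blast
  then show "smooth_on (snd c ` (fst c \<inter> W)) (h \<circ> chart_inv c)"
    by (rule smooth_on_cong[OF _ chart_image_open[OF atlas c assms(1)]])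
      (auto simp: chart_facts(4)[OF atlas c] assms(3))
qed

lemma smooth_field_near: "open W \<Longrightarrow> p \<in> W \<Longrightarrow> smooth_field A W X \<Longrightarrow> smooth_field_near A p X"
  unfolding smooth_field_near_def by blast

lemma smooth_fun_near: "open W \<Longrightarrow> p \<in> W \<Longrightarrow> smooth_fun A W f \<Longrightarrow> smooth_fun_near A p f"
  unfolding smooth_fun_near_def by blast

lemma dir_deriv_const:
  assumes "open W" "p \<in> W" "\<And>q. q \<in> W \<Longrightarrow> f q = k"
  shows "dir_deriv A f p v = 0"
proof -
  let ?c = "chart_at A p"
  have o: "open (snd ?c ` (fst ?c \<inter> W))" by (rule chart_image_open[OF atlas chart_at(1) assms(1)])
  have "((\<lambda>_. k) has_derivative (\<lambda>_. 0)) (at (snd ?c p))" by simp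
  then have "((f \<circ> chart_inv ?c) has_derivative (\<lambda>_. 0)) (at (snd ?c p))"
    by (rule has_derivative_transform_within_open[OF _ o])
      (use assms chart_at(2) chart_facts(4)[OF atlas chart_at(1)] in auto)
  then show ?thesis unfolding dir_deriv_def by (rule fderiv_applyI)
qed

context
  fixes nabla :: "'m \<Rightarrow> 'e \<Rightarrow> ('m \<Rightarrow> 'e) \<Rightarrow> 'e"
  assumes conn: "affine_connection A nabla"
begin

lemma nabla_add:
  assumes "smooth_field_near A p Y" "smooth_field_near A p Z"
  shows "nabla p v (\<lambda>q. Y q + Z q) = nabla p v Y + nabla p v Z"
  by (rule conn[unfolded affine_connection_def, THEN conjunct2, THEN conjunct1, rule_format])
    (use assms in blast)

lemma nabla_scaleR:
  assumes "smooth_fun_near A p f" "smooth_field_near A p Y"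
  shows "nabla p v (\<lambda>q. f q *\<^sub>R Y q) = dir_deriv A f p v *\<^sub>R Y p + f p *\<^sub>R nabla p v Y"
  by (rule conn[unfolded affine_connection_def, THEN conjunct2, THEN conjunct2, THEN conjunct1, rule_format])
    (use assms in blast)

text \<open>Multiplication by the indicator function of \<open>W\<close>, which is smooth near the points of \<open>W\<close>, makes
  two fields that agree on \<open>W\<close> equal.\<close>

lemma nabla_local:
  assumes W: "open W" "p \<in> W" and eq: "\<And>q. q \<in> W \<Longrightarrow> Y q = Z q"
    and sm: "smooth_field_near A p Y" "smooth_field_near A p Z"
  shows "nabla p v Y = nabla p v Z"
proof -
  define f :: "'m \<Rightarrow> real" where "f q = (if q \<in> W then 1 else 0)" for q
  have "smooth_fun A W f"
    by (rule smooth_fun_cong[OF W(1) smooth_fun_const[of _ 1]]) (simp add: f_def)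
  then have f: "smooth_fun_near A p f" by (rule smooth_fun_near[OF W])
  have df: "dir_deriv A f p v = 0" by (rule dir_deriv_const[OF W]) (simp add: f_def)
  have "(\<lambda>q. f q *\<^sub>R Y q) = (\<lambda>q. f q *\<^sub>R Z q)" using eq by (auto simp: f_def)
  then have "nabla p v (\<lambda>q. f q *\<^sub>R Y q) = nabla p v (\<lambda>q. f q *\<^sub>R Z q)" by simp
  then show ?thesis unfolding nabla_scaleR[OF f sm(1)] nabla_scaleR[OF f sm(2)] df
    using W(2) by (simp add: f_def)
qed

lemma nabla_sum:
  assumes W: "open W" "p \<in> W" and "finite I" "\<And>i. i \<in> I \<Longrightarrow> smooth_field A W (X i)"
  shows "nabla p v (\<lambda>q. \<Sum>i\<in>I. X i q) = (\<Sum>i\<in>I. nabla p v (X i))"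
  using assms(3,4)
proof (induction I rule: finite_induct)
  case empty
  have z: "smooth_field_near A p (\<lambda>_. 0)" by (rule smooth_field_near[OF W smooth_field_zero[OF W(1)]])
  show ?case using nabla_add[OF z z, of v] by simp
next
  case (insert i I)
  have "nabla p v (\<lambda>q. X i q + (\<Sum>i\<in>I. X i q)) = nabla p v (X i) + nabla p v (\<lambda>q. \<Sum>i\<in>I. X i q)"
    by (rule nabla_add) (auto intro!: smooth_field_near[OF W] smooth_field_sum W insert)
  then show ?case using insert by simp
qed

text \<open>By the product rule, the connection is determined by its values on the coordinate fields.\<close>

lemma nabla_in_chart:
  assumes W: "open W" "p \<in> W" and Y: "smooth_field A W Y"
  defines "d \<equiv> chart_at A p"
  shows "nabla p v Y = fderiv (local_rep A d Y) (snd d p) v + nabla p v (coord_field A d (Y p))"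
proof -
  have d: "d \<in> A" "p \<in> fst d" using chart_at by (auto simp: d_def)
  define V where "V = fst d \<inter> W"
  have V: "open V" "p \<in> V" using chart_facts(2)[OF atlas d(1)] W d by (auto simp: V_def)
  have frame: "smooth_field A V (coord_field A d b)" for b
    by (rule smooth_field_subset[OF smooth_coord_field[OF d(1)]]) (simp add: V_def)
  have YV: "smooth_field A V Y" by (rule smooth_field_subset[OF Y]) (simp add: V_def)
  have "smooth_on (snd d ` (fst d \<inter> V)) (local_rep A d Y)"
    using YV d(1) unfolding smooth_field_def by blast
  then have Yd: "smooth_on (snd d ` V) (local_rep A d Y)" by (simp add: V_def Int_absorb1 inf.absorb_iff2)
  have expand: "nabla p v Z = (\<Sum>b\<in>Basis. dir_deriv A (\<lambda>q. coords A d q (Z q) \<bullet> b) p v *\<^sub>R b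
      + (Z p \<bullet> b) *\<^sub>R nabla p v (coord_field A d b))"
    if Z: "smooth_field A V Z" for Z
  proof -
    have comp: "smooth_fun A V (\<lambda>q. coords A d q (Z q) \<bullet> b)" for b
      unfolding smooth_fun_def
    proof
      fix c assume c: "c \<in> A"
      let ?T = "snd c ` (fst c \<inter> V)"
      have o: "open ?T" by (rule chart_image_open[OF atlas c V(1)])
      have "?T \<subseteq> snd c ` (fst c \<inter> fst d)" by (auto simp: V_def)
      then have t: "smooth_on ?T (transition c d)" using smooth_on_subset transition_smooth[OF atlas c d(1)] by blast
      have z: "smooth_on (snd d ` V) (local_rep A d Z)"
        using smooth_field_local_rep_A[OF Z V(1) d(1)] by (simp add: V_def)
      have "smooth_on ?T (\<lambda>x. local_rep A d Z (transition c d x))"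
      proof (rule smooth_on_compose[OF z t o], clarify)
        fix q assume "q \<in> fst c" "q \<in> V"
        then show "transition c d (snd c q) \<in> snd d ` V" using transition_apply[OF atlas c, of q d] by auto
      qed
      then have "smooth_on ?T (\<lambda>x. local_rep A d Z (transition c d x) \<bullet> b)"
        by (intro smooth_on_inner o smooth_on_const)
      then show "smooth_on ?T ((\<lambda>q. coords A d q (Z q) \<bullet> b) \<circ> chart_inv c)"
      proof (rule smooth_on_cong[OF _ o])
        fix x assume "x \<in> ?T"
        then obtain q where q: "q \<in> fst c" "q \<in> fst d" "x = snd c q" by (auto simp: V_def)
        show "local_rep A d Z (transition c d x) \<bullet> b = ((\<lambda>q. coords A d q (Z q) \<bullet> b) \<circ> chart_inv c) x"
          unfolding q(3) transition_apply[OF atlas c q(1)] local_rep_apply_A[OF d(1) q(2)]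
          using chart_facts(4)[OF atlas c q(1)] by simp
      qed
    qed
    have "nabla p v Z = nabla p v (\<lambda>q. \<Sum>b\<in>Basis. (coords A d q (Z q) \<bullet> b) *\<^sub>R coord_field A d b q)"
    proof (rule nabla_local[OF V])
      fix q assume "q \<in> V"
      then have q: "q \<in> fst d" by (simp add: V_def)
      show "Z q = (\<Sum>b\<in>Basis. (coords A d q (Z q) \<bullet> b) *\<^sub>R coord_field A d b q)"
        using linear_expand_Basis[OF coord_field_linear_A[OF d(1) q], of "coords A d q (Z q)"]
          coord_field_coords_A[OF d(1) q] by simp
    qed (intro smooth_field_near[OF V] Z smooth_field_sum smooth_field_scaleR comp frame V finite_Basis)+
    also have "\<dots> = (\<Sum>b\<in>Basis. nabla p v (\<lambda>q. (coords A d q (Z q) \<bullet> b) *\<^sub>R coord_field A d b q))"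
      by (rule nabla_sum[OF V finite_Basis]) (intro smooth_field_scaleR comp frame V)
    also have "\<dots> = (\<Sum>b\<in>Basis. dir_deriv A (\<lambda>q. coords A d q (Z q) \<bullet> b) p v *\<^sub>R b
      + (Z p \<bullet> b) *\<^sub>R nabla p v (coord_field A d b))"
    proof (rule sum.cong[OF refl])
      fix b :: 'e
      show "nabla p v (\<lambda>q. (coords A d q (Z q) \<bullet> b) *\<^sub>R coord_field A d b q) =
          dir_deriv A (\<lambda>q. coords A d q (Z q) \<bullet> b) p v *\<^sub>R b + (Z p \<bullet> b) *\<^sub>R nabla p v (coord_field A d b)"
        using nabla_scaleR[OF smooth_fun_near[OF V comp] smooth_field_near[OF V frame], of v b b]
        unfolding d_def coords_chart_at coord_field_chart_at .
    qed
    finally show ?thesis .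
  qed
  have h1: "dir_deriv A (\<lambda>q. coords A d q (Y q) \<bullet> b) p v = fderiv (local_rep A d Y) (snd d p) v \<bullet> b" for b
  proof -
    have h: "((\<lambda>x. local_rep A d Y x \<bullet> b) has_derivative (\<lambda>v. fderiv (local_rep A d Y) (snd d p) v \<bullet> b)) (at (snd d p))"
      by (intro has_derivative_inner_left smooth_on_has_derivative[OF Yd]) (use V in blast)
    have eq: "(\<lambda>q. coords A d q (Y q) \<bullet> b) \<circ> chart_inv d = (\<lambda>x. local_rep A d Y x \<bullet> b)" by auto
    show ?thesis unfolding dir_deriv_def d_def[symmetric] eq by (rule fderiv_applyI[OF h])
  qed
  have h2: "dir_deriv A (\<lambda>q. coords A d q (coord_field A d (Y p) q) \<bullet> b) p v = 0" for b
    by (rule dir_deriv_const[OF V, of _ "Y p \<bullet> b"]) (simp add: coords_coord_field_A[OF d(1)] V_def)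
  have h3: "coord_field A d (Y p) p = Y p" unfolding d_def by (rule coord_field_chart_at)
  have "nabla p v (coord_field A d (Y p)) = (\<Sum>b\<in>Basis. (Y p \<bullet> b) *\<^sub>R nabla p v (coord_field A d b))"
    using expand[OF frame[of "Y p"]] unfolding h2 h3 by simp
  then show ?thesis
    unfolding expand[OF YV] h1 sum.distrib euclidean_representation by simp
qed

end

end

section \<open>Vector fields along an immersion\<close>

locale smooth_immersion = amb: smooth_manifold A + hyp: smooth_manifold A'
  for A :: "('m::{t2_space,second_countable_topology}, 'e::euclidean_space) chart set"
    and A' :: "('n::{t2_space,second_countable_topology}, 'h::euclidean_space) chart set" +
  fixes \<iota> :: "'n \<Rightarrow> 'm"
  assumes smooth: "smooth_map A' A \<iota>" and inj_differential: "inj (differential A' A \<iota> p)"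
begin

abbreviation d\<iota> :: "'n \<Rightarrow> 'h \<Rightarrow> 'e" where "d\<iota> \<equiv> differential A' A \<iota>"

abbreviation \<iota>_rep :: "('n, 'h) chart \<Rightarrow> ('m, 'e) chart \<Rightarrow> 'h \<Rightarrow> 'e" where
  "\<iota>_rep c d \<equiv> snd d \<circ> \<iota> \<circ> chart_inv c"

abbreviation along_rep :: "('n, 'h) chart \<Rightarrow> ('m, 'e) chart \<Rightarrow> ('n \<Rightarrow> 'e) \<Rightarrow> 'h \<Rightarrow> 'e" where
  "along_rep c d Z \<equiv> (\<lambda>q. coords A d (\<iota> q) (Z q)) \<circ> chart_inv c"

definition smooth_along :: "'n set \<Rightarrow> ('n \<Rightarrow> 'e) \<Rightarrow> bool" where
  "smooth_along W Z \<longleftrightarrow> (\<forall>c\<in>A'. \<forall>d\<in>A. smooth_on (snd c ` (fst c \<inter> (\<iota> -` fst d \<inter> W))) (along_rep c d Z))"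

lemma open_\<iota>_vimage: "d \<in> A \<Longrightarrow> open (\<iota> -` fst d)"
  using smooth chart_facts(2)[OF amb.atlas] unfolding smooth_map_def by (blast intro: open_vimage)

context
  fixes c :: "('n, 'h) chart" and d :: "('m, 'e) chart" and W :: "'n set"
  assumes c: "c \<in> A'" and d: "d \<in> A" and W: "open W"
begin

lemma open_along_dom: "open (snd c ` (fst c \<inter> (\<iota> -` fst d \<inter> W)))"
  by (rule chart_image_open[OF hyp.atlas c open_Int[OF open_\<iota>_vimage[OF d] W]])

lemma \<iota>_rep_apply: "q \<in> fst c \<Longrightarrow> \<iota>_rep c d (snd c q) = snd d (\<iota> q)"
  and along_rep_apply: "q \<in> fst c \<Longrightarrow> along_rep c d Z (snd c q) = coords A d (\<iota> q) (Z q)"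
  using chart_facts(4)[OF hyp.atlas c] by simp_all

lemma \<iota>_rep_smooth: "smooth_on (snd c ` (fst c \<inter> (\<iota> -` fst d \<inter> W))) (\<iota>_rep c d)"
proof -
  have "smooth_on (snd c ` (fst c \<inter> \<iota> -` fst d)) (\<iota>_rep c d)"
    using smooth c d unfolding smooth_map_def by blast
  then show ?thesis by (rule smooth_on_subset) auto
qed

lemma \<iota>_rep_image: "\<iota>_rep c d ` snd c ` (fst c \<inter> (\<iota> -` fst d \<inter> W)) \<subseteq> snd d ` fst d"
  using chart_facts(4)[OF hyp.atlas c] by auto

end

lemma differential_has_derivative:
  "(\<iota>_rep (chart_at A' p) (chart_at A (\<iota> p)) has_derivative d\<iota> p) (at (snd (chart_at A' p) p))"
proof -
  have "snd (chart_at A' p) p \<in> snd (chart_at A' p) ` (fst (chart_at A' p) \<inter> (\<iota> -` fst (chart_at A (\<iota> p)) \<inter> UNIV))"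
    using hyp.chart_at amb.chart_at by auto
  from smooth_on_has_derivative[OF \<iota>_rep_smooth[OF hyp.chart_at(1) amb.chart_at(1) open_UNIV] this]
  show ?thesis by (simp add: differential_def[abs_def])
qed

lemma differential_linear: "linear (d\<iota> p)"
  using differential_has_derivative has_derivative_linear by blast

lemma differential_in_charts:
  assumes c: "c \<in> A'" and d: "d \<in> A" and q: "q \<in> fst c" "\<iota> q \<in> fst d"
  shows "coords A d (\<iota> q) (d\<iota> q v) = fderiv (\<iota>_rep c d) (snd c q) (coords A' c q v)"
proof -
  define c0 where "c0 = chart_at A' q"
  define d0 where "d0 = chart_at A (\<iota> q)"
  have c0: "c0 \<in> A'" "q \<in> fst c0" and d0: "d0 \<in> A" "\<iota> q \<in> fst d0"
    using hyp.chart_at amb.chart_at by (auto simp: c0_def d0_def)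
  let ?x = "snd c0 q" and ?W = "fst c \<inter> \<iota> -` fst d0"
  let ?S = "snd c0 ` (fst c0 \<inter> (\<iota> -` fst d \<inter> ?W))"
  have W: "open ?W" using chart_facts(2)[OF hyp.atlas c] open_\<iota>_vimage[OF d0(1)] by blast
  have S: "open ?S" "?x \<in> ?S" using open_along_dom[OF c0(1) d W] c0 d0 q by auto
  have 1: "(\<iota>_rep c0 d0 has_derivative d\<iota> q) (at ?x)"
    using differential_has_derivative by (simp add: c0_def d0_def)
  have "(transition d0 d has_derivative chart_deriv d0 d (\<iota> q)) (at (\<iota>_rep c0 d0 ?x))"
    unfolding \<iota>_rep_apply[OF c0(1) d0(1) open_UNIV c0(2)]
    by (rule chart_deriv_has_derivative[OF amb.atlas d0(1) d d0(2) q(2)])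
  from has_derivative_compose[OF 1 this]
  have L: "((\<lambda>x. transition d0 d (\<iota>_rep c0 d0 x)) has_derivative (\<lambda>v. chart_deriv d0 d (\<iota> q) (d\<iota> q v))) (at ?x)" .
  have 2: "(transition c0 c has_derivative chart_deriv c0 c q) (at ?x)"
    by (rule chart_deriv_has_derivative[OF hyp.atlas c0(1) c c0(2) q(1)])
  have "snd c q \<in> snd c ` (fst c \<inter> (\<iota> -` fst d \<inter> UNIV))" using q by auto
  then have "(\<iota>_rep c d has_derivative fderiv (\<iota>_rep c d) (snd c q)) (at (transition c0 c ?x))"
    unfolding transition_apply[OF hyp.atlas c0(1,2)]
    by (rule smooth_on_has_derivative[OF \<iota>_rep_smooth[OF c d open_UNIV]])
  from has_derivative_compose[OF 2 this]
  have R: "((\<lambda>x. \<iota>_rep c d (transition c0 c x)) has_derivative (\<lambda>v. fderiv (\<iota>_rep c d) (snd c q) (chart_deriv c0 c q v))) (at ?x)" .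
  have "((\<lambda>x. \<iota>_rep c d (transition c0 c x)) has_derivative (\<lambda>v. chart_deriv d0 d (\<iota> q) (d\<iota> q v))) (at ?x)"
  proof (rule has_derivative_transform_within_open[OF L S])
    fix x assume "x \<in> ?S"
    then obtain q' where q': "q' \<in> fst c0" "q' \<in> fst c" "\<iota> q' \<in> fst d0" "\<iota> q' \<in> fst d" "x = snd c0 q'" by auto
    show "transition d0 d (\<iota>_rep c0 d0 x) = \<iota>_rep c d (transition c0 c x)"
      unfolding q'(5) \<iota>_rep_apply[OF c0(1) d0(1) open_UNIV q'(1)] transition_apply[OF hyp.atlas c0(1) q'(1)]
        transition_apply[OF amb.atlas d0(1) q'(3)] \<iota>_rep_apply[OF c d open_UNIV q'(2)] ..
  qed
  from fun_cong[OF has_derivative_unique[OF this R]] show ?thesis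
    unfolding coords_def c0_def d0_def .
qed

lemma smooth_along_differential:
  assumes W: "open W" and X: "smooth_field A' W X"
  shows "smooth_along W (\<lambda>q. d\<iota> q (X q))"
  unfolding smooth_along_def
proof (intro ballI)
  fix c d assume c: "c \<in> A'" and d: "d \<in> A"
  note o = open_along_dom[OF c d W]
  have "smooth_on (snd c ` (fst c \<inter> W)) (local_rep A' c X)" using X c unfolding smooth_field_def by blast
  then have "smooth_on (snd c ` (fst c \<inter> (\<iota> -` fst d \<inter> W))) (local_rep A' c X)"
    by (rule smooth_on_subset) auto
  from smooth_on_fderiv_apply[OF o \<iota>_rep_smooth[OF c d W] this]
  show "smooth_on (snd c ` (fst c \<inter> (\<iota> -` fst d \<inter> W))) (along_rep c d (\<lambda>q. d\<iota> q (X q)))"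
  proof (rule smooth_on_cong[OF _ o])
    fix x assume "x \<in> snd c ` (fst c \<inter> (\<iota> -` fst d \<inter> W))"
    then obtain q where q: "q \<in> fst c" "\<iota> q \<in> fst d" "x = snd c q" by auto
    show "fderiv (\<iota>_rep c d) x (local_rep A' c X x) = along_rep c d (\<lambda>q. d\<iota> q (X q)) x"
      unfolding q(3) along_rep_apply[OF c d W q(1)] hyp.local_rep_apply_A[OF c q(1)]
        differential_in_charts[OF c d q(1,2)] ..
  qed
qed

lemma smooth_along_restrict:
  assumes W: "open W" and X: "smooth_field A UNIV X"
  shows "smooth_along W (\<lambda>q. X (\<iota> q))"
  unfolding smooth_along_def
proof (intro ballI)
  fix c d assume c: "c \<in> A'" and d: "d \<in> A"
  note o = open_along_dom[OF c d W]
  have "smooth_on (snd d ` fst d) (local_rep A d X)" using X d unfolding smooth_field_def by auto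
  from smooth_on_compose[OF this \<iota>_rep_smooth[OF c d W] o \<iota>_rep_image[OF c d W]]
  show "smooth_on (snd c ` (fst c \<inter> (\<iota> -` fst d \<inter> W))) (along_rep c d (\<lambda>q. X (\<iota> q)))"
  proof (rule smooth_on_cong[OF _ o])
    fix x assume "x \<in> snd c ` (fst c \<inter> (\<iota> -` fst d \<inter> W))"
    then obtain q where q: "q \<in> fst c" "\<iota> q \<in> fst d" "x = snd c q" by auto
    show "local_rep A d X (\<iota>_rep c d x) = along_rep c d (\<lambda>q. X (\<iota> q)) x"
      unfolding q(3) along_rep_apply[OF c d W q(1)] \<iota>_rep_apply[OF c d W q(1)] amb.local_rep_apply_A[OF d q(2)] ..
  qed
qed

abbreviation tensor_rep :: "('m, 'e) chart \<Rightarrow> ('m \<Rightarrow> 'e \<Rightarrow> 'e) \<Rightarrow> 'e \<Rightarrow> 'e \<Rightarrow> 'e" where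
  "tensor_rep d T y u \<equiv> local_rep A d (\<lambda>q. T q (coord_field A d u q)) y"

definition smooth_tensor :: "('m \<Rightarrow> 'e \<Rightarrow> 'e) \<Rightarrow> bool" where
  "smooth_tensor T \<longleftrightarrow> (\<forall>p. linear (T p)) \<and> (\<forall>d\<in>A. \<forall>x. smooth_field A (fst d) (\<lambda>q. T q (coord_field A d x q)))"

context
  fixes T d assumes T: "smooth_tensor T" and d: "d \<in> A"
begin

lemma tensor_rep_apply: "q \<in> fst d \<Longrightarrow> tensor_rep d T (snd d q) u = coords A d q (T q (coord_field A d u q))"
  by (rule amb.local_rep_apply_A[OF d])

lemma tensor_rep_smooth: "smooth_on (snd d ` fst d) (\<lambda>y. tensor_rep d T y u)"
proof -
  have "smooth_on (snd d ` (fst d \<inter> fst d)) (local_rep A d (\<lambda>q. T q (coord_field A d u q)))"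
    using T d unfolding smooth_tensor_def smooth_field_def by blast
  then show ?thesis by (simp only: Int_absorb)
qed

lemma tensor_rep_linear: "y \<in> snd d ` fst d \<Longrightarrow> linear (tensor_rep d T y)"
proof -
  assume "y \<in> snd d ` fst d"
  then obtain q where q: "q \<in> fst d" "y = snd d q" by blast
  have "linear (T q)" using T unfolding smooth_tensor_def by blast
  from linear_compose[OF linear_compose[OF amb.coord_field_linear_A[OF d q(1)] this] amb.coords_linear_A[OF d q(1)]]
  have "linear (\<lambda>u. coords A d q (T q (coord_field A d u q)))" by (simp add: o_def)
  then show "linear (tensor_rep d T y)" unfolding q(2) tensor_rep_apply[OF q(1)] .
qed

lemma along_rep_tensor:
  assumes c: "c \<in> A'" and q: "q \<in> fst c" "\<iota> q \<in> fst d"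
  shows "along_rep c d (\<lambda>q. T (\<iota> q) (Z q)) (snd c q) = tensor_rep d T (\<iota>_rep c d (snd c q)) (along_rep c d Z (snd c q))"
  unfolding along_rep_apply[OF c d open_UNIV q(1)] \<iota>_rep_apply[OF c d open_UNIV q(1)] tensor_rep_apply[OF q(2)]
    amb.coord_field_coords_A[OF d q(2)] ..

end

lemma smooth_along_tensor:
  assumes W: "open W" and T: "smooth_tensor T" and Z: "smooth_along W Z"
  shows "smooth_along W (\<lambda>q. T (\<iota> q) (Z q))"
  unfolding smooth_along_def
proof (intro ballI)
  fix c d assume c: "c \<in> A'" and d: "d \<in> A"
  note o = open_along_dom[OF c d W]
  let ?S = "snd c ` (fst c \<inter> (\<iota> -` fst d \<inter> W))"
  have "smooth_on ?S (\<lambda>x. tensor_rep d T (\<iota>_rep c d x) (along_rep c d Z x))"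
  proof (rule smooth_on_linear_apply[OF o, where M="\<lambda>x. tensor_rep d T (\<iota>_rep c d x)"])
    show "linear (tensor_rep d T (\<iota>_rep c d x))" if "x \<in> ?S" for x
      by (rule tensor_rep_linear[OF T d]) (use that \<iota>_rep_image[OF c d W] in blast)
    show "smooth_on ?S (\<lambda>x. tensor_rep d T (\<iota>_rep c d x) v)" for v
      by (rule smooth_on_compose[OF tensor_rep_smooth[OF T d] \<iota>_rep_smooth[OF c d W] o \<iota>_rep_image[OF c d W]])
    show "smooth_on ?S (along_rep c d Z)" using Z c d unfolding smooth_along_def by blast
  qed
  then show "smooth_on ?S (along_rep c d (\<lambda>q. T (\<iota> q) (Z q)))"
  proof (rule smooth_on_cong[OF _ o])
    fix x assume "x \<in> ?S"
    then obtain q where q: "q \<in> fst c" "\<iota> q \<in> fst d" "x = snd c q" by auto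
    show "tensor_rep d T (\<iota>_rep c d x) (along_rep c d Z x) = along_rep c d (\<lambda>q. T (\<iota> q) (Z q)) x"
      unfolding q(3) by (rule along_rep_tensor[OF T d c q(1,2), symmetric])
  qed
qed

text \<open>Components of the metric are smooth on the ambient chart; the pairing of two fields is a polynomial in
  these and in the components of the fields.\<close>

lemma smooth_fun_along_metric:
  assumes W: "open W" and g: "semi_riemannian_metric A g" and Z: "smooth_along W Z1" "smooth_along W Z2"
  shows "smooth_fun A' W (\<lambda>q. g (\<iota> q) (Z1 q) (Z2 q))"
  unfolding smooth_fun_def
proof
  fix c assume c: "c \<in> A'"
  show "smooth_on (snd c ` (fst c \<inter> W)) ((\<lambda>q. g (\<iota> q) (Z1 q) (Z2 q)) \<circ> chart_inv c)"
  proof (rule smooth_on_local)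
    fix x assume "x \<in> snd c ` (fst c \<inter> W)"
    then obtain q0 where q0: "q0 \<in> fst c" "q0 \<in> W" "x = snd c q0" by auto
    define d where "d = chart_at A (\<iota> q0)"
    have d: "d \<in> A" "\<iota> q0 \<in> fst d" using amb.chart_at by (auto simp: d_def)
    let ?S = "snd c ` (fst c \<inter> (\<iota> -` fst d \<inter> W))"
    note o = open_along_dom[OF c d(1) W]
    have gs: "smooth_on (snd d ` fst d) ((\<lambda>q. g q (coord_field A d a q) (coord_field A d b q)) \<circ> chart_inv d)" for a b
    proof -
      have "smooth_fun A (fst d) (\<lambda>q. g q (coord_field A d a q) (coord_field A d b q))"
        using g d(1) unfolding semi_riemannian_metric_def by blast
      then have "smooth_on (snd d ` (fst d \<inter> fst d)) ((\<lambda>q. g q (coord_field A d a q) (coord_field A d b q)) \<circ> chart_inv d)"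
        using d(1) unfolding smooth_fun_def by blast
      then show ?thesis by simp
    qed
    have zs: "smooth_on ?S (along_rep c d Z1)" "smooth_on ?S (along_rep c d Z2)"
      using Z c d(1) unfolding smooth_along_def by blast+
    have "smooth_on ?S (\<lambda>x. \<Sum>a\<in>Basis. \<Sum>b\<in>Basis. (along_rep c d Z1 x \<bullet> a) * ((along_rep c d Z2 x \<bullet> b) *
        ((\<lambda>q. g q (coord_field A d a q) (coord_field A d b q)) \<circ> chart_inv d) (\<iota>_rep c d x)))"
      by (intro smooth_on_sum smooth_on_mult smooth_on_inner o zs smooth_on_const
          smooth_on_compose[OF gs \<iota>_rep_smooth[OF c d(1) W] o \<iota>_rep_image[OF c d(1) W]])
    then have "smooth_on ?S ((\<lambda>q. g (\<iota> q) (Z1 q) (Z2 q)) \<circ> chart_inv c)"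
    proof (rule smooth_on_cong[OF _ o])
      fix x assume "x \<in> ?S"
      then obtain q where q: "q \<in> fst c" "\<iota> q \<in> fst d" "x = snd c q" by auto
      let ?P = "\<iota> q"
      have bl: "bilinear (g ?P)" using g unfolding semi_riemannian_metric_def by blast
      have ex: "Z = (\<Sum>a\<in>Basis. (coords A d ?P Z \<bullet> a) *\<^sub>R coord_field A d a ?P)" for Z
        using linear_expand_Basis[OF amb.coord_field_linear_A[OF d(1) q(2)], of "coords A d ?P Z"]
          amb.coord_field_coords_A[OF d(1) q(2)] by simp
      have l1: "linear (\<lambda>a. g ?P a b)" and l2: "linear (g ?P a)" for a b
        using bl unfolding bilinear_def by blast+
      have "g ?P (Z1 q) (Z2 q) = g ?P (\<Sum>a\<in>Basis. (coords A d ?P (Z1 q) \<bullet> a) *\<^sub>R coord_field A d a ?P)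
          (\<Sum>b\<in>Basis. (coords A d ?P (Z2 q) \<bullet> b) *\<^sub>R coord_field A d b ?P)"
        using ex by metis
      also have "\<dots> = (\<Sum>a\<in>Basis. (coords A d ?P (Z1 q) \<bullet> a) * (\<Sum>b\<in>Basis. (coords A d ?P (Z2 q) \<bullet> b) *
          g ?P (coord_field A d a ?P) (coord_field A d b ?P)))"
        unfolding linear_sum[OF l1] linear_cmul[OF l1]
        unfolding linear_sum[OF l2] linear_cmul[OF l2] real_scaleR_def ..
      also have "\<dots> = (\<Sum>a\<in>Basis. \<Sum>b\<in>Basis. (along_rep c d Z1 x \<bullet> a) * ((along_rep c d Z2 x \<bullet> b) *
        ((\<lambda>q. g q (coord_field A d a q) (coord_field A d b q)) \<circ> chart_inv d) (\<iota>_rep c d x)))"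
        unfolding q(3) using chart_facts(4)[OF hyp.atlas c q(1)] chart_facts(4)[OF amb.atlas d(1) q(2)]
        by (simp add: sum_distrib_left)
      finally show "(\<Sum>a\<in>Basis. \<Sum>b\<in>Basis. (along_rep c d Z1 x \<bullet> a) * ((along_rep c d Z2 x \<bullet> b) *
        ((\<lambda>q. g q (coord_field A d a q) (coord_field A d b q)) \<circ> chart_inv d) (\<iota>_rep c d x)))
        = ((\<lambda>q. g (\<iota> q) (Z1 q) (Z2 q)) \<circ> chart_inv c) x"
        unfolding q(3) using chart_facts(4)[OF hyp.atlas c q(1)] by simp
    qed
    then show "\<exists>T. open T \<and> x \<in> T \<and> smooth_on T ((\<lambda>q. g (\<iota> q) (Z1 q) (Z2 q)) \<circ> chart_inv c)"
      using o q0 d by blast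
  qed
qed

text \<open>The equation \<open>d\<iota> X = Z\<close> is linear and injective in \<open>X\<close>, so that smoothness passes from \<open>Z\<close> to \<open>X\<close>.\<close>

lemma smooth_field_of_along:
  assumes W: "open W" and Z: "smooth_along W Z" and X: "\<And>q. q \<in> W \<Longrightarrow> d\<iota> q (X q) = Z q"
  shows "smooth_field A' W X"
proof (rule hyp.smooth_fieldI_A)
  fix p assume p: "p \<in> W"
  define c where "c = chart_at A' p"
  define d where "d = chart_at A (\<iota> p)"
  have c: "c \<in> A'" "p \<in> fst c" and d: "d \<in> A" "\<iota> p \<in> fst d"
    using amb.chart_at hyp.chart_at by (auto simp: c_def d_def)
  let ?V = "fst c \<inter> (\<iota> -` fst d \<inter> W)"
  have V: "open ?V" "p \<in> ?V" using chart_facts(2)[OF hyp.atlas c(1)] open_\<iota>_vimage[OF d(1)] W c d p by auto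
  note o = open_along_dom[OF c(1) d(1) W]
  have "smooth_on (snd c ` ?V) (local_rep A' c X)"
  proof (rule smooth_on_linear_solution[OF o, where M="fderiv (\<iota>_rep c d)" and b="along_rep c d Z"])
    fix x assume "x \<in> snd c ` ?V"
    then obtain q where q: "q \<in> fst c" "\<iota> q \<in> fst d" "q \<in> W" "x = snd c q" by auto
    show lin: "linear (fderiv (\<iota>_rep c d) x)"
      by (rule smooth_on_linear_fderiv[OF \<iota>_rep_smooth[OF c(1) d(1) W]]) (use q in blast)
    show "inj (fderiv (\<iota>_rep c d) x)"
      unfolding linear_injective_0[OF lin]
    proof (intro allI impI)
      fix v assume v: "fderiv (\<iota>_rep c d) x v = 0"
      define u where "u = coord_field A' c v q"
      have "coords A' c q u = v" unfolding u_def by (rule hyp.coords_coord_field_A[OF c(1) q(1)])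
      then have "coords A d (\<iota> q) (d\<iota> q u) = 0"
        using differential_in_charts[OF c(1) d(1) q(1,2), of u] v q(4) by simp
      then have "d\<iota> q u = 0"
        using amb.coord_field_coords_A[OF d(1) q(2), of "d\<iota> q u"] linear_0[OF amb.coord_field_linear_A[OF d(1) q(2)]] by simp
      then have "u = 0" using inj_differential differential_linear linear_injective_0 by blast
      then show "v = 0" using \<open>coords A' c q u = v\<close> linear_0[OF hyp.coords_linear_A[OF c(1) q(1)]] by simp
    qed
    show "fderiv (\<iota>_rep c d) x (local_rep A' c X x) = along_rep c d Z x"
      unfolding q(4) hyp.local_rep_apply_A[OF c(1) q(1)] along_rep_apply[OF c(1) d(1) W q(1)]
        differential_in_charts[OF c(1) d(1) q(1,2), symmetric] X[OF q(3)] ..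
  next
    show "smooth_on (snd c ` ?V) (\<lambda>x. fderiv (\<iota>_rep c d) x v)" for v
      by (rule smooth_on_fderiv_apply[OF o \<iota>_rep_smooth[OF c(1) d(1) W] smooth_on_const])
    show "smooth_on (snd c ` ?V) (along_rep c d Z)" using Z c(1) d(1) unfolding smooth_along_def by blast
  qed
  then show "\<exists>c V. c \<in> A' \<and> open V \<and> p \<in> V \<and> V \<subseteq> fst c \<and> smooth_on (snd c ` V) (local_rep A' c X)"
    using c V by blast
qed

section \<open>The induced covariant derivative along the immersion\<close>

lemma cov_along_local:
  assumes W: "open W" "p \<in> W" and eq: "\<And>q. q \<in> W \<Longrightarrow> Y q = Z q"
  shows "cov_along A' A \<iota> nabla p w Y = cov_along A' A \<iota> nabla p w Z"
proof -
  let ?c = "chart_at A' p" and ?d = "chart_at A (\<iota> p)"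
  have "fderiv (along_rep ?c ?d Y) (snd ?c p) = fderiv (along_rep ?c ?d Z) (snd ?c p)"
  proof (rule fderiv_cong)
    show "open (snd ?c ` (fst ?c \<inter> W))" by (rule chart_image_open[OF hyp.atlas hyp.chart_at(1) W(1)])
    show "snd ?c p \<in> snd ?c ` (fst ?c \<inter> W)" using hyp.chart_at(2) W(2) by blast
    show "along_rep ?c ?d Y x = along_rep ?c ?d Z x" if "x \<in> snd ?c ` (fst ?c \<inter> W)" for x
      using that eq chart_facts(4)[OF hyp.atlas hyp.chart_at(1)] by auto
  qed
  then show ?thesis using eq[OF W(2)] by (simp add: cov_along_def Let_def)
qed

text \<open>Covariant differentiation of a tensor obeys the same product rule along the immersion as in the
  ambient manifold, since both sides of the rule are tensorial in the direction and in the field.\<close>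

lemma cov_along_tensor:
  assumes conn: "affine_connection A nabla" and W: "open W" "p \<in> W"
    and T: "smooth_tensor T" and Z: "smooth_along W Z"
  defines "d \<equiv> chart_at A (\<iota> p)"
  shows "cov_along A' A \<iota> nabla p w (\<lambda>q. T (\<iota> q) (Z q)) - T (\<iota> p) (cov_along A' A \<iota> nabla p w Z) =
    nabla (\<iota> p) (d\<iota> p w) (\<lambda>q. T q (coord_field A d (Z p) q)) -
    T (\<iota> p) (nabla (\<iota> p) (d\<iota> p w) (coord_field A d (Z p)))"
proof -
  define c where "c = chart_at A' p"
  have c: "c \<in> A'" "p \<in> fst c" and d: "d \<in> A" "\<iota> p \<in> fst d"
    using amb.chart_at hyp.chart_at by (auto simp: c_def d_def)
  let ?S = "snd c ` (fst c \<inter> (\<iota> -` fst d \<inter> W))" and ?x = "snd c p"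
  let ?\<zeta> = "along_rep c d Z" and ?j = "\<iota>_rep c d" and ?P = "\<iota> p" and ?v = "d\<iota> p w"
  have S: "open ?S" "?x \<in> ?S" using open_along_dom[OF c(1) d(1) W(1)] c d W by auto
  have self: "coords A d ?P v = v" "coord_field A d v ?P = v" for v
    unfolding d_def by (rule amb.coords_chart_at amb.coord_field_chart_at)+
  have jx: "?j ?x = snd d ?P" using \<iota>_rep_apply[OF c(1) d(1) open_UNIV c(2)] .
  have \<zeta>x: "?\<zeta> ?x = Z p" using along_rep_apply[OF c(1) d(1) open_UNIV c(2)] self by simp
  have lT: "linear (T ?P)" using T unfolding smooth_tensor_def by blast
  have tx: "tensor_rep d T (snd d ?P) u = T ?P u" for u
    unfolding tensor_rep_apply[OF T d] self ..
  have dj: "(?j has_derivative d\<iota> p) (at ?x)" using differential_has_derivative by (simp add: c_def d_def)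
  have d\<zeta>: "(?\<zeta> has_derivative fderiv ?\<zeta> ?x) (at ?x)"
    using Z c(1) d(1) S(2) unfolding smooth_along_def by (blast intro: smooth_on_has_derivative)
  have dT: "((\<lambda>y. tensor_rep d T y u) has_derivative fderiv (\<lambda>y. tensor_rep d T y u) (snd d ?P)) (at (?j ?x))" for u
    unfolding jx by (rule smooth_on_has_derivative[OF tensor_rep_smooth[OF T d(1)]]) (use d in blast)
  have dTj: "((\<lambda>x. tensor_rep d T (?j x) u) has_derivative
      (\<lambda>w. fderiv (\<lambda>y. tensor_rep d T y u) (snd d ?P) (d\<iota> p w))) (at ?x)" for u
    by (rule has_derivative_compose[OF dj dT])
  have 1: "((\<lambda>x. tensor_rep d T (?j x) (?\<zeta> x)) has_derivative
      (\<lambda>w. fderiv (\<lambda>x. tensor_rep d T (?j x) (?\<zeta> ?x)) ?x w + tensor_rep d T (?j ?x) (fderiv ?\<zeta> ?x w))) (at ?x)"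
  proof (rule has_derivative_linear_apply[OF S _ _ d\<zeta>])
    show "linear (tensor_rep d T (?j x))" if "x \<in> ?S" for x
      by (rule tensor_rep_linear[OF T d(1)]) (use that \<iota>_rep_image[OF c(1) d(1) W(1)] in blast)
    show "(\<lambda>x. tensor_rep d T (?j x) u) differentiable (at ?x)" for u
      using dTj unfolding differentiable_def by blast
  qed
  have "(along_rep c d (\<lambda>q. T (\<iota> q) (Z q)) has_derivative
      (\<lambda>w. fderiv (\<lambda>x. tensor_rep d T (?j x) (?\<zeta> ?x)) ?x w + tensor_rep d T (?j ?x) (fderiv ?\<zeta> ?x w))) (at ?x)"
  proof (rule has_derivative_transform_within_open[OF 1 S])
    fix x assume "x \<in> ?S"
    then obtain q where q: "q \<in> fst c" "\<iota> q \<in> fst d" "x = snd c q" by auto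
    show "tensor_rep d T (?j x) (?\<zeta> x) = along_rep c d (\<lambda>q. T (\<iota> q) (Z q)) x"
      unfolding q(3) by (rule along_rep_tensor[OF T d(1) c(1) q(1,2), symmetric])
  qed
  from fderiv_applyI[OF this, of w]
  have "fderiv (along_rep c d (\<lambda>q. T (\<iota> q) (Z q))) ?x w =
      fderiv (\<lambda>y. tensor_rep d T y (Z p)) (snd d ?P) ?v + T ?P (fderiv ?\<zeta> ?x w)"
    unfolding \<zeta>x jx tx fderiv_applyI[OF dTj] .
  moreover have "nabla ?P ?v (\<lambda>q. T q (coord_field A d (Z p) q)) =
      fderiv (\<lambda>y. tensor_rep d T y (Z p)) (snd d ?P) ?v + nabla ?P ?v (coord_field A d (T ?P (Z p)))"
  proof -
    have "smooth_field A (fst d) (\<lambda>q. T q (coord_field A d (Z p) q))"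
      using T d(1) unfolding smooth_tensor_def by blast
    from amb.nabla_in_chart[OF conn chart_facts(2)[OF amb.atlas d(1)] d(2) this, of ?v]
    show ?thesis unfolding d_def[symmetric] self .
  qed
  ultimately show ?thesis
    unfolding cov_along_def Let_def c_def[symmetric] d_def[symmetric]
    by (simp add: linear_add[OF lT])
qed

text \<open>The second derivatives of the immersion cancel by symmetry, the connection terms because coordinate
  fields commute; what remains is the bracket of the two tangent fields.\<close>

lemma cov_along_torsion_free:
  assumes lc: "levi_civita A g nabla" and W: "open W" "p \<in> W"
    and X: "smooth_field A' W X" and Y: "smooth_field A' W Y"
  shows "cov_along A' A \<iota> nabla p (X p) (\<lambda>q. d\<iota> q (Y q)) - cov_along A' A \<iota> nabla p (Y p) (\<lambda>q. d\<iota> q (X q)) =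
    d\<iota> p (lie_bracket A' X Y p)"
proof -
  define c where "c = chart_at A' p"
  define d where "d = chart_at A (\<iota> p)"
  have c: "c \<in> A'" "p \<in> fst c" and d: "d \<in> A" "\<iota> p \<in> fst d"
    using amb.chart_at hyp.chart_at by (auto simp: c_def d_def)
  let ?S = "snd c ` (fst c \<inter> (\<iota> -` fst d \<inter> W))" and ?x = "snd c p"
  let ?j = "\<iota>_rep c d" and ?P = "\<iota> p"
  have S: "open ?S" "?x \<in> ?S" using open_along_dom[OF c(1) d(1) W(1)] c d W by auto
  note js = \<iota>_rep_smooth[OF c(1) d(1) W(1)]
  have self: "coord_field A d v ?P = v" for v unfolding d_def by (rule amb.coord_field_chart_at)
  have self': "coords A' c p v = v" for v unfolding c_def by (rule hyp.coords_chart_at)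
  have dj: "fderiv ?j ?x = d\<iota> p" using differential_has_derivative by (intro fderiv_eqI) (simp add: c_def d_def)
  have key: "cov_along A' A \<iota> nabla p w (\<lambda>q. d\<iota> q (Y q)) =
      fderiv (\<lambda>x. fderiv ?j x (Y p)) ?x w + d\<iota> p (fderiv (local_rep A' c Y) ?x w)
        + nabla ?P (d\<iota> p w) (coord_field A d (d\<iota> p (Y p)))"
    if Y: "smooth_field A' W Y" for Y w
  proof -
    have Yx: "local_rep A' c Y ?x = Y p" using hyp.local_rep_apply_A[OF c] self' by simp
    have "smooth_on (snd c ` (fst c \<inter> W)) (local_rep A' c Y)" using Y c(1) unfolding smooth_field_def by blast
    then have dY: "(local_rep A' c Y has_derivative fderiv (local_rep A' c Y) ?x) (at ?x)"
      by (rule smooth_on_has_derivative) (use c W in blast)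
    have 1: "((\<lambda>x. fderiv ?j x (local_rep A' c Y x)) has_derivative
        (\<lambda>w. fderiv (\<lambda>x. fderiv ?j x (local_rep A' c Y ?x)) ?x w + fderiv ?j ?x (fderiv (local_rep A' c Y) ?x w))) (at ?x)"
    proof (rule has_derivative_linear_apply[OF S _ _ dY])
      show "linear (fderiv ?j x)" if "x \<in> ?S" for x by (rule smooth_on_linear_fderiv[OF js that])
      show "(\<lambda>x. fderiv ?j x u) differentiable (at ?x)" for u
        using smooth_on_has_derivative[OF smooth_on_fderiv_apply[OF S(1) js smooth_on_const] S(2)]
        unfolding differentiable_def by blast
    qed
    have "(along_rep c d (\<lambda>q. d\<iota> q (Y q)) has_derivative
        (\<lambda>w. fderiv (\<lambda>x. fderiv ?j x (local_rep A' c Y ?x)) ?x w + fderiv ?j ?x (fderiv (local_rep A' c Y) ?x w))) (at ?x)"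
    proof (rule has_derivative_transform_within_open[OF 1 S])
      fix x assume "x \<in> ?S"
      then obtain q where q: "q \<in> fst c" "\<iota> q \<in> fst d" "x = snd c q" by auto
      show "fderiv ?j x (local_rep A' c Y x) = along_rep c d (\<lambda>q. d\<iota> q (Y q)) x"
        unfolding q(3) along_rep_apply[OF c(1) d(1) W(1) q(1)] hyp.local_rep_apply_A[OF c(1) q(1)]
          differential_in_charts[OF c(1) d(1) q(1,2)] ..
    qed
    from fderiv_applyI[OF this, of w] show ?thesis
      unfolding cov_along_def Let_def c_def[symmetric] d_def[symmetric] Yx dj by simp
  qed
  have fr: "smooth_field A (fst d) (coord_field A d a)" for a by (rule amb.smooth_coord_field[OF d(1)])
  note od = chart_facts(2)[OF amb.atlas d(1)]
  have const: "fderiv (local_rep A d (coord_field A d a)) (snd d ?P) v = 0" for a v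
  proof (rule fderiv_applyI)
    show "(local_rep A d (coord_field A d a) has_derivative (\<lambda>_. 0)) (at (snd d ?P))"
      by (rule has_derivative_transform_within_open[OF has_derivative_const[of a] chart_facts(3)[OF amb.atlas d(1)]])
        (use d amb.coords_coord_field_A[OF d(1)] chart_facts(4)[OF amb.atlas d(1)] in auto)
  qed
  have "nabla ?P (coord_field A d a ?P) (coord_field A d b) - nabla ?P (coord_field A d b ?P) (coord_field A d a) =
      lie_bracket A (coord_field A d a) (coord_field A d b) ?P" for a b
    using lc amb.smooth_field_near[OF od d(2) fr] unfolding levi_civita_def by blast
  moreover have "lie_bracket A (coord_field A d a) (coord_field A d b) ?P = 0" for a b
    using const by (simp add: lie_bracket_def Let_def flip: d_def)
  ultimately have tf: "nabla ?P a (coord_field A d b) = nabla ?P b (coord_field A d a)" for a b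
    unfolding self by simp
  have "lie_bracket A' X Y p = fderiv (local_rep A' c Y) ?x (X p) - fderiv (local_rep A' c X) ?x (Y p)"
    by (simp add: lie_bracket_def Let_def c_def)
  then show ?thesis
    unfolding key[OF X] key[OF Y] using symmetric_second_derivative[OF S js, of "Y p" "X p"]
      tf[of "d\<iota> p (X p)" "d\<iota> p (Y p)"] linear_diff[OF differential_linear] by simp
qed

end

section \<open>Linear algebra of the lightlike hypersurface\<close>

locale screen_semi_invariant_hypersurface = smooth_immersion A A' \<iota>
  for A :: "('m::{t2_space,second_countable_topology}, 'e::euclidean_space) chart set"
    and A' :: "('n::{t2_space,second_countable_topology}, 'h::euclidean_space) chart set"
    and \<iota> :: "'n \<Rightarrow> 'm" +
  fixes \<phi> :: "'m \<Rightarrow> 'e \<Rightarrow> 'e" and \<xi> :: "'m \<Rightarrow> 'e" and \<eta> :: "'m \<Rightarrow> 'e \<Rightarrow> real"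
    and g :: "'m \<Rightarrow> 'e \<Rightarrow> 'e \<Rightarrow> real" and \<epsilon> :: real
    and nabla :: "'m \<Rightarrow> 'e \<Rightarrow> ('m \<Rightarrow> 'e) \<Rightarrow> 'e" and S :: "'n \<Rightarrow> 'h set"
  assumes codim: "DIM('e) = DIM('h) + 1"
    and sasakian: "eps_para_sasakian A \<phi> \<xi> \<eta> g \<epsilon> nabla"
    and Rad_nonzero: "\<And>p. \<exists>x. x \<noteq> 0 \<and> x \<in> Rad A' A \<iota> g p"
    and screen: "screen_distribution A' A \<iota> g S"
    and \<xi>_screen: "\<And>p. \<xi> (\<iota> p) \<in> d\<iota> p ` S p"
    and semi_invariant: "screen_semi_invariant A' A \<iota> g S \<phi>"
begin

abbreviation radical :: "'n \<Rightarrow> 'h set" where "radical \<equiv> Rad A' A \<iota> g"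

abbreviation D :: "'n \<Rightarrow> 'h set" where "D \<equiv> D_dist A' A \<iota> g S \<phi> \<xi>"

abbreviation D\<^sub>\<xi> :: "'n \<Rightarrow> 'h set" where "D\<^sub>\<xi> \<equiv> D_xi A' A \<iota> g S \<phi> \<xi>"

abbreviation phiT :: "'n \<Rightarrow> 'h \<Rightarrow> 'h" where "phiT \<equiv> phi_tan A' A \<iota> g S \<phi>"

abbreviation B :: "('n \<Rightarrow> 'h) \<Rightarrow> ('n \<Rightarrow> 'h) \<Rightarrow> ('n \<Rightarrow> 'h) \<Rightarrow> 'n \<Rightarrow> real" where
  "B \<equiv> second_fundamental_form A' A \<iota> g S nabla"

lemma almost_paracontact: "eps_almost_paracontact_metric A \<phi> \<xi> \<eta> g \<epsilon>"
  and levi_civita_nabla: "levi_civita A g nabla"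
  using sasakian unfolding eps_para_sasakian_def by blast+

lemma conn: "affine_connection A nabla"
  using levi_civita_nabla unfolding levi_civita_def by blast

lemma metric: "semi_riemannian_metric A g"
  and eps: "\<epsilon> * \<epsilon> = 1"
  and \<phi>_linear: "linear (\<phi> P)" and \<eta>_linear: "linear (\<eta> P)"
  and \<phi>\<phi>: "\<phi> P (\<phi> P x) = x - \<eta> P x *\<^sub>R \<xi> P"
  and \<eta>\<xi>: "\<eta> P (\<xi> P) = 1" and \<phi>\<xi>: "\<phi> P (\<xi> P) = 0" and \<eta>\<phi>: "\<eta> P (\<phi> P x) = 0"
  and g\<phi>\<phi>: "g P (\<phi> P x) (\<phi> P y) = g P x y - \<epsilon> * \<eta> P x * \<eta> P y"
  and \<xi>_smooth: "smooth_field A UNIV \<xi>"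
  and \<phi>_tensor: "smooth_tensor \<phi>"
  using almost_paracontact unfolding eps_almost_paracontact_metric_def smooth_tensor_def by auto

lemma g_linear: "linear (g P x)" "linear (\<lambda>x. g P x y)"
  and g_sym: "g P x y = g P y x"
  and g_nondeg: "(\<And>y. g P x y = 0) \<Longrightarrow> x = 0"
  using metric unfolding semi_riemannian_metric_def bilinear_def by blast+

lemmas g_simps = linear_add[OF g_linear(1)] linear_add[OF g_linear(2)]
  linear_diff[OF g_linear(1)] linear_diff[OF g_linear(2)]
  linear_cmul[OF g_linear(1)] linear_cmul[OF g_linear(2)]
  linear_0[OF g_linear(1)] linear_0[OF g_linear(2)]
  linear_neg[OF g_linear(1)] linear_neg[OF g_linear(2)]

lemmas \<phi>_simps = linear_add[OF \<phi>_linear] linear_diff[OF \<phi>_linear] linear_cmul[OF \<phi>_linear] linear_0[OF \<phi>_linear]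

lemmas d\<iota>_simps = linear_add[OF differential_linear] linear_diff[OF differential_linear]
  linear_cmul[OF differential_linear] linear_0[OF differential_linear]

lemma d\<iota>_eq_iff: "d\<iota> p x = d\<iota> p y \<longleftrightarrow> x = y"
  using inj_differential by (auto dest: injD)

lemma g_\<xi>: "g P x (\<xi> P) = \<epsilon> * \<eta> P x"
  using g\<phi>\<phi>[of P x "\<xi> P"] by (simp add: \<phi>\<xi> \<eta>\<xi> g_simps)

lemma \<eta>_eq: "\<eta> P x = \<epsilon> * g P x (\<xi> P)"
  using eps by (simp add: g_\<xi> flip: mult.assoc)

lemma g_\<phi>_sym: "g P (\<phi> P x) y = g P x (\<phi> P y)"
proof -
  have "g P (\<phi> P x) y = g P (\<phi> P (\<phi> P x)) (\<phi> P y)" by (simp add: g\<phi>\<phi>[of P "\<phi> P x" y] \<eta>\<phi>)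
  also have "\<dots> = g P x (\<phi> P y) - \<eta> P x * g P (\<xi> P) (\<phi> P y)" by (simp add: \<phi>\<phi> g_simps)
  also have "g P (\<xi> P) (\<phi> P y) = 0" by (simp add: g_sym[of P "\<xi> P"] g_\<xi> \<eta>\<phi>)
  finally show ?thesis by simp
qed

lemma Rad_iff: "x \<in> radical p \<longleftrightarrow> (\<forall>y. g (\<iota> p) (d\<iota> p x) (d\<iota> p y) = 0)"
  by (simp add: Rad_def induced_metric_def)

lemma Rad_scaleR: "x \<in> radical p \<Longrightarrow> k *\<^sub>R x \<in> radical p"
  by (simp add: Rad_iff d\<iota>_simps g_simps)

lemma S_subspace: "subspace (S p)"
proof -
  have "smooth_distribution A' S" using screen unfolding screen_distribution_def by blast
  then obtain W k F where "p \<in> W" "\<forall>q\<in>W. S q = span ((\<lambda>j. F j q) ` {..<k::nat})"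
    unfolding smooth_distribution_def by metis
  then show ?thesis by simp
qed

lemma S_Rad: "S p \<inter> radical p = {0}" "\<exists>s r. x = s + r \<and> s \<in> S p \<and> r \<in> radical p"
proof -
  show "S p \<inter> radical p = {0}" using screen unfolding screen_distribution_def by blast
  have "{s + r | s r. s \<in> S p \<and> r \<in> radical p} = UNIV"
    using screen unfolding screen_distribution_def by blast
  then show "\<exists>s r. x = s + r \<and> s \<in> S p \<and> r \<in> radical p" by blast
qed

text \<open>Nondegeneracy makes the metric injective as a map into the dual space, which has the same dimension.\<close>

lemma g_riesz:
  fixes l :: "'e \<Rightarrow> real"
  assumes "linear l" obtains N where "\<And>z. g P N z = l z"
proof -
  define f where "f x = (\<Sum>b\<in>Basis. g P x b *\<^sub>R b)" for x :: 'e
  have lf: "linear f" unfolding f_def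
    by (intro linear_compose_sum ballI linearI) (auto simp: g_simps algebra_simps)
  have fb: "f x \<bullet> b = g P x b" if "b \<in> Basis" for x b
    using that by (simp add: f_def inner_sum_left inner_Basis if_distrib sum.delta cong: if_cong)
  have ext: "g P x z = l z" if "\<And>b. b \<in> Basis \<Longrightarrow> g P x b = l b" for x z
    using linear_expand_Basis[OF g_linear(1), of P x z] linear_expand_Basis[OF assms, of z] that by simp
  have "inj f" unfolding linear_injective_0[OF lf]
  proof (intro allI impI)
    fix x assume "f x = 0"
    then have "g P x b = 0" if "b \<in> Basis" for b using fb[OF that, of x] by simp
    then have "g P x z = 0" for z using linear_expand_Basis[OF g_linear(1), of P x z] by simp
    then show "x = 0" by (rule g_nondeg)
  qed
  then have "surj f" using linear_injective_imp_surjective[OF lf] by blast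
  then obtain N where N: "f N = (\<Sum>b\<in>Basis. l b *\<^sub>R b)" by (metis surjD)
  have "g P N b = l b" if "b \<in> Basis" for b
    using fb[OF that, of N] that unfolding N
    by (simp add: inner_sum_left inner_Basis if_distrib sum.delta cong: if_cong)
  then show thesis using that ext by blast
qed

context
  fixes p :: 'n and e :: 'h
  assumes e: "e \<in> radical p" "e \<noteq> 0"
begin

lemma g_tangent_e: "g (\<iota> p) (d\<iota> p x) (d\<iota> p e) = 0"
  using e(1) by (simp add: Rad_iff g_sym[of _ "d\<iota> p x"])

lemma d\<iota>_e_nonzero: "d\<iota> p e \<noteq> 0"
  using e(2) d\<iota>_eq_iff[of p e 0] by (simp add: d\<iota>_simps)

text \<open>The tangent space is a hyperplane that is contained in the orthogonal of the radical.\<close>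

lemma range_d\<iota>_iff: "z \<in> range (d\<iota> p) \<longleftrightarrow> g (\<iota> p) z (d\<iota> p e) = 0"
proof -
  define a where "a = (\<Sum>b\<in>Basis. g (\<iota> p) b (d\<iota> p e) *\<^sub>R (b::'e))"
  have a: "a \<bullet> z = g (\<iota> p) z (d\<iota> p e)" for z
    using linear_expand_Basis[OF g_linear(2)[of "\<iota> p" "d\<iota> p e"], of z]
    by (simp add: a_def inner_sum_left inner_sum_right inner_commute mult.commute)
  have "a \<noteq> 0"
  proof
    assume "a = 0"
    then have "g (\<iota> p) (d\<iota> p e) z = 0" for z using a[of z] by (simp add: g_sym[of _ "d\<iota> p e"])
    then show False using g_nondeg d\<iota>_e_nonzero by blast
  qed
  then have "dim {z. a \<bullet> z = 0} = DIM('e) - 1" by (rule dim_hyperplane)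
  moreover have "dim (range (d\<iota> p)) = DIM('h)"
    using dim_image_eq[OF differential_linear, of p UNIV] inj_differential by simp
  ultimately have "range (d\<iota> p) = {z. a \<bullet> z = 0}"
    using codim g_tangent_e a
    by (intro subspace_dim_equal linear_subspace_image differential_linear subspace_UNIV subspace_hyperplane) auto
  then show ?thesis using a by auto
qed

text \<open>A functional that vanishes on the tangent hyperplane is a multiple of the one that defines it.\<close>

lemma orthogonal_tangent_space:
  assumes "\<And>x. g (\<iota> p) R (d\<iota> p x) = 0" obtains k where "R = k *\<^sub>R d\<iota> p e"
proof -
  obtain z0 where z0: "g (\<iota> p) (d\<iota> p e) z0 \<noteq> 0" using g_nondeg d\<iota>_e_nonzero by blast
  define N0 where "N0 = (1 / g (\<iota> p) (d\<iota> p e) z0) *\<^sub>R z0"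
  have N0: "g (\<iota> p) (d\<iota> p e) N0 = 1" using z0 by (simp add: N0_def g_simps)
  have "g (\<iota> p) (R - g (\<iota> p) R N0 *\<^sub>R d\<iota> p e) z = 0" for z
  proof -
    have "g (\<iota> p) (z - g (\<iota> p) (d\<iota> p e) z *\<^sub>R N0) (d\<iota> p e) = 0"
      using N0 by (simp add: g_simps g_sym[of _ _ "d\<iota> p e"])
    then have "z - g (\<iota> p) (d\<iota> p e) z *\<^sub>R N0 \<in> range (d\<iota> p)" using range_d\<iota>_iff by blast
    then have "g (\<iota> p) R (z - g (\<iota> p) (d\<iota> p e) z *\<^sub>R N0) = 0" using assms by auto
    then show ?thesis by (simp add: g_simps mult.commute)
  qed
  then have "R = g (\<iota> p) R N0 *\<^sub>R d\<iota> p e" using g_nondeg[of "\<iota> p" "R - g (\<iota> p) R N0 *\<^sub>R d\<iota> p e"] by simp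
  then show thesis by (rule that)
qed

lemma Rad_eq_span: "r \<in> radical p \<Longrightarrow> \<exists>k. r = k *\<^sub>R e"
proof -
  assume "r \<in> radical p"
  then obtain k where "d\<iota> p r = k *\<^sub>R d\<iota> p e" using orthogonal_tangent_space unfolding Rad_iff by blast
  then have "d\<iota> p r = d\<iota> p (k *\<^sub>R e)" by (simp add: d\<iota>_simps)
  then show ?thesis using d\<iota>_eq_iff by blast
qed

text \<open>A vector that represents the form with kernel \<open>S\<close> and value 1 on \<open>e\<close> becomes null after a multiple of
  \<open>e\<close> is subtracted; the other two conditions are not affected, as \<open>e\<close> is orthogonal to the tangent space.\<close>

lemma transversal_exists: "\<exists>N. is_transversal A' A \<iota> g S p e N"
proof -
  have "e \<notin> S p" using S_Rad(1)[of p] e by blast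
  obtain y z where yz: "y \<in> span (S p)" "\<And>w. w \<in> span (S p) \<Longrightarrow> orthogonal z w" "e = y + z"
    using orthogonal_subspace_decomp_exists by blast
  have sp: "span (S p) = S p" using S_subspace span_eq_iff by blast
  have "z \<noteq> 0" using yz \<open>e \<notin> S p\<close> sp by auto
  have ze: "z \<bullet> e = z \<bullet> z" using yz(1) yz(2)[of y] yz(3) by (simp add: inner_add_right orthogonal_def)
  obtain G where G: "linear G" "G \<circ> d\<iota> p = id"
    using linear_injective_left_inverse[OF differential_linear inj_differential] by blast
  have Gd: "G (d\<iota> p x) = x" for x using G(2) by (metis comp_apply id_apply)
  have "linear (\<lambda>u. (z \<bullet> G u) / (z \<bullet> z))"
    by (intro linearI) (auto simp: linear_add[OF G(1)] linear_cmul[OF G(1)] inner_add_right add_divide_distrib)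
  then obtain N' where N': "\<And>u. g (\<iota> p) N' u = (z \<bullet> G u) / (z \<bullet> z)" using g_riesz by blast
  define N where "N = N' - (g (\<iota> p) N' N' / 2) *\<^sub>R d\<iota> p e"
  have NE: "g (\<iota> p) N' (d\<iota> p e) = 1" using \<open>z \<noteq> 0\<close> by (simp add: N' Gd ze)
  have "is_transversal A' A \<iota> g S p e N"
    unfolding is_transversal_def
  proof (intro conjI ballI)
    fix s assume "s \<in> S p"
    then have "z \<bullet> s = 0" using yz(2)[of s] by (simp add: sp orthogonal_def)
    then show "g (\<iota> p) N (d\<iota> p s) = 0"
      using g_tangent_e[of s] by (simp add: N_def g_simps N' Gd g_sym[of _ "d\<iota> p e"])
  next
    show "g (\<iota> p) N N = 0" using NE g_tangent_e[of e]
      by (simp add: N_def g_simps g_sym[of _ "d\<iota> p e" N'])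
    show "g (\<iota> p) (d\<iota> p e) N = 1" using NE g_tangent_e[of e]
      by (simp add: N_def g_simps g_sym[of _ "d\<iota> p e" N'])
  qed
  then show ?thesis ..
qed

lemma transversal_unique:
  assumes N: "is_transversal A' A \<iota> g S p e N" "is_transversal A' A \<iota> g S p e N'"
  shows "N = N'"
proof -
  have "g (\<iota> p) (N - N') (d\<iota> p x) = 0" for x
  proof -
    obtain s r where x: "x = s + r" "s \<in> S p" "r \<in> radical p" using S_Rad(2) by blast
    obtain k where k: "r = k *\<^sub>R e" using Rad_eq_span[OF x(3)] by blast
    show ?thesis using N x(2) unfolding is_transversal_def x(1) k
      by (simp add: d\<iota>_simps g_simps g_sym[of _ _ "d\<iota> p e"])
  qed
  then obtain k where k: "N - N' = k *\<^sub>R d\<iota> p e" using orthogonal_tangent_space by blast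
  then have "N = N' + k *\<^sub>R d\<iota> p e" by (simp add: algebra_simps)
  then have "g (\<iota> p) N N = g (\<iota> p) N' N' + 2 * k"
    using N(2) g_tangent_e[of e] unfolding is_transversal_def
    by (simp add: g_simps g_sym[of _ N' "d\<iota> p e"])
  then have "k = 0" using N unfolding is_transversal_def by simp
  then show ?thesis using k by simp
qed

abbreviation N where "N \<equiv> transversal A' A \<iota> g S p e"

lemma transversal: "is_transversal A' A \<iota> g S p e N"
  unfolding transversal_def using transversal_exists transversal_unique by (blast intro: theI)

lemma g_N_e: "g (\<iota> p) N (d\<iota> p e) = 1"
  using transversal unfolding is_transversal_def by (simp add: g_sym[of _ _ "d\<iota> p e"])

lemma ltr_eq: "ltr A' A \<iota> g S p = span {N}"
proof -
  have "{N'. \<exists>e'\<in>radical p. is_transversal A' A \<iota> g S p e' N'} \<subseteq> span {N}"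
  proof clarify
    fix N' e' assume e': "e' \<in> radical p" "is_transversal A' A \<iota> g S p e' N'"
    obtain k where k: "e' = k *\<^sub>R e" using Rad_eq_span[OF e'(1)] by blast
    have "k \<noteq> 0" using e'(2) unfolding is_transversal_def k by (auto simp: d\<iota>_simps g_simps)
    have "is_transversal A' A \<iota> g S p e (k *\<^sub>R N')"
      using e'(2) unfolding is_transversal_def k by (simp add: d\<iota>_simps g_simps)
    then have "k *\<^sub>R N' = N" using transversal_unique[OF _ transversal] by blast
    moreover have "(1/k) *\<^sub>R (k *\<^sub>R N') = N'" using \<open>k \<noteq> 0\<close> by simp
    ultimately have "N' = (1/k) *\<^sub>R N" by simp
    then show "N' \<in> span {N}" by (simp add: span_base span_scale)
  qed
  moreover have "N \<in> {N'. \<exists>e'\<in>radical p. is_transversal A' A \<iota> g S p e' N'}"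
    using e(1) transversal by blast
  ultimately have "span {N'. \<exists>e'\<in>radical p. is_transversal A' A \<iota> g S p e' N'} = span {N}"
    by (meson span_eq span_mono span_superset insert_subset empty_subsetI subset_trans)
  then show ?thesis by (simp add: ltr_def)
qed

text \<open>The coefficient of the transversal part of \<open>\<phi> X\<close>, by \<open>g_N_e\<close> and \<open>g_tangent_e\<close>.\<close>

abbreviation u_form :: "'h \<Rightarrow> real" where
  "u_form x \<equiv> g (\<iota> p) (\<phi> (\<iota> p) (d\<iota> p x)) (d\<iota> p e)"

lemma \<xi>_tangent: obtains x where "x \<in> S p" "d\<iota> p x = \<xi> (\<iota> p)"
  using \<xi>_screen[of p] by auto

lemma g_\<xi>_e: "g (\<iota> p) (\<xi> (\<iota> p)) (d\<iota> p e) = 0"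
  using \<xi>_tangent g_tangent_e by metis

lemma \<eta>_e: "\<eta> (\<iota> p) (d\<iota> p e) = 0"
  using g_\<xi>_e by (simp add: \<eta>_eq g_sym[of _ "d\<iota> p e"])

lemma V_exists: obtains v where "v \<in> S p" "d\<iota> p v = \<phi> (\<iota> p) (d\<iota> p e)"
proof -
  have "\<phi> (\<iota> p) (d\<iota> p e) \<in> d\<iota> p ` S p"
    using semi_invariant e(1) unfolding screen_semi_invariant_def by blast
  then show thesis using that by auto
qed

lemma U_exists: obtains u where "u \<in> S p" "d\<iota> p u = \<phi> (\<iota> p) N"
proof -
  have "N \<in> ltr A' A \<iota> g S p" unfolding ltr_eq by (simp add: span_base)
  then have "\<phi> (\<iota> p) N \<in> d\<iota> p ` S p"
    using semi_invariant unfolding screen_semi_invariant_def by blast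
  then show thesis using that by auto
qed

lemma u_form_nontrivial: "\<exists>x. u_form x \<noteq> 0"
proof -
  obtain u where "u \<in> S p" "d\<iota> p u = \<phi> (\<iota> p) N" by (rule U_exists)
  then have "u_form u = 1" by (simp add: \<phi>\<phi> g_simps g_N_e g_\<xi>_e)
  then show ?thesis by (metis zero_neq_one)
qed

lemma g_\<phi>\<phi>_tangent_e: "g (\<iota> p) (\<phi> (\<iota> p) (\<phi> (\<iota> p) (d\<iota> p x))) (d\<iota> p e) = 0"
  by (simp add: \<phi>\<phi> g_simps g_tangent_e g_\<xi>_e)

text \<open>By \<open>g_\<phi>_sym\<close>, \<open>u\<close> is the product with \<open>V = \<phi> E\<close>. Since \<open>V\<close> is null, orthogonal to \<open>\<xi>\<close> and paired to 1 with
  \<open>U = \<phi> N\<close>, the component of a vector of \<open>S\<close> along \<open>U\<close> is its value under \<open>u\<close>, and the one along \<open>\<xi>\<close> is its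
  value under \<open>\<eta>\<close>. What remains lies in \<open>D\<^sub>0\<close> and the line of \<open>V\<close>.\<close>

lemma D_dist_iff: "x \<in> D p \<longleftrightarrow> u_form x = 0 \<and> \<eta> (\<iota> p) (d\<iota> p x) = 0"
proof -
  obtain v where v: "v \<in> S p" "d\<iota> p v = \<phi> (\<iota> p) (d\<iota> p e)" by (rule V_exists)
  obtain u where u: "u \<in> S p" "d\<iota> p u = \<phi> (\<iota> p) N" by (rule U_exists)
  obtain x\<xi> where x\<xi>: "x\<xi> \<in> S p" "d\<iota> p x\<xi> = \<xi> (\<iota> p)" by (rule \<xi>_tangent)
  have gv: "g (\<iota> p) (d\<iota> p v) (d\<iota> p e) = 0" by (rule g_tangent_e)
  have u_eq: "u_form y = g (\<iota> p) (d\<iota> p y) (d\<iota> p v)" for y by (simp add: g_\<phi>_sym v(2))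
  have gvv: "g (\<iota> p) (d\<iota> p v) (d\<iota> p v) = 0" by (simp add: v(2) g\<phi>\<phi> \<eta>_e g_tangent_e)
  have gvu: "g (\<iota> p) (d\<iota> p v) (d\<iota> p u) = 1"
    using g_N_e by (simp add: v(2) u(2) g\<phi>\<phi> \<eta>_e g_sym[of _ "d\<iota> p e"])
  have gv\<xi>: "g (\<iota> p) (d\<iota> p v) (\<xi> (\<iota> p)) = 0" by (simp add: v(2) g_\<xi> \<eta>\<phi>)
  have vl: "k *\<^sub>R v \<in> V_line A' A \<iota> g \<phi> p" for k
  proof -
    have "d\<iota> p (k *\<^sub>R v) = \<phi> (\<iota> p) (d\<iota> p (k *\<^sub>R e))" by (simp add: d\<iota>_simps \<phi>_simps v(2))
    then show ?thesis using Rad_scaleR[OF e(1), of k] unfolding V_line_def by blast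
  qed
  have V_line: "\<exists>k. y = k *\<^sub>R v" if y: "y \<in> V_line A' A \<iota> g \<phi> p" for y
  proof -
    obtain r where r: "r \<in> radical p" "d\<iota> p y = \<phi> (\<iota> p) (d\<iota> p r)"
      using y unfolding V_line_def by blast
    obtain k where "r = k *\<^sub>R e" using Rad_eq_span[OF r(1)] by blast
    then have "d\<iota> p y = d\<iota> p (k *\<^sub>R v)" using r(2) by (simp add: d\<iota>_simps \<phi>_simps v(2))
    then show ?thesis unfolding d\<iota>_eq_iff by blast
  qed
  have \<xi>l: "x\<xi> \<in> xi_line A' A \<iota> \<xi> p" unfolding xi_line_def using x\<xi>(2) by (simp add: span_base)
  show ?thesis
  proof
    assume "x \<in> D p"
    then obtain a r w where x: "x = a + r + w" "a \<in> D0 A' A \<iota> g S \<phi> \<xi> p" "r \<in> radical p"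
      "w \<in> V_line A' A \<iota> g \<phi> p" unfolding D_dist_def by blast
    obtain k where k: "r = k *\<^sub>R e" using Rad_eq_span[OF x(3)] by blast
    obtain l where l: "w = l *\<^sub>R v" using V_line[OF x(4)] by blast
    have "g (\<iota> p) (d\<iota> p a) (d\<iota> p (1 *\<^sub>R v)) = 0" "g (\<iota> p) (d\<iota> p a) (d\<iota> p x\<xi>) = 0"
      using x(2) vl[of 1] \<xi>l unfolding D0_def induced_metric_def by blast+
    then have "g (\<iota> p) (d\<iota> p a) (d\<iota> p v) = 0" "g (\<iota> p) (d\<iota> p a) (\<xi> (\<iota> p)) = 0"
      by (simp_all add: x\<xi>(2))
    then show "u_form x = 0 \<and> \<eta> (\<iota> p) (d\<iota> p x) = 0"
      unfolding u_eq unfolding \<eta>_eq x(1) k l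
      by (simp add: d\<iota>_simps g_simps gvv gv\<xi> g_sym[of _ "d\<iota> p e"] gv g_\<xi>_e)
  next
    assume ux: "u_form x = 0 \<and> \<eta> (\<iota> p) (d\<iota> p x) = 0"
    obtain s r where x: "x = s + r" "s \<in> S p" "r \<in> radical p" using S_Rad(2) by blast
    obtain k where k: "r = k *\<^sub>R e" using Rad_eq_span[OF x(3)] by blast
    \<comment> \<open>The component of \<open>s\<close> along \<open>V\<close> is its product with \<open>U\<close>.\<close>
    define l where "l = g (\<iota> p) (d\<iota> p s) (d\<iota> p u)"
    define a where "a = s - l *\<^sub>R v"
    have "g (\<iota> p) (d\<iota> p s) (d\<iota> p v) = 0" "g (\<iota> p) (d\<iota> p s) (\<xi> (\<iota> p)) = 0"
      using ux eps unfolding u_eq unfolding \<eta>_eq x(1) k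
      by (auto simp: d\<iota>_simps g_simps g_sym[of _ "d\<iota> p e"] gv g_\<xi>_e)
    then have av: "g (\<iota> p) (d\<iota> p a) (d\<iota> p v) = 0" and a\<xi>: "g (\<iota> p) (d\<iota> p a) (\<xi> (\<iota> p)) = 0"
      by (simp_all add: a_def d\<iota>_simps g_simps gvv gv\<xi>)
    have au: "g (\<iota> p) (d\<iota> p a) (d\<iota> p u) = 0" by (simp add: a_def d\<iota>_simps g_simps gvu l_def)
    have "a \<in> D0 A' A \<iota> g S \<phi> \<xi> p"
      unfolding D0_def mem_Collect_eq induced_metric_def
    proof (intro conjI ballI)
      show "a \<in> S p" unfolding a_def by (intro subspace_diff subspace_scale S_subspace x v)
      fix y assume "y \<in> V_line A' A \<iota> g \<phi> p \<union> U_line A' A \<iota> g S \<phi> p \<union> xi_line A' A \<iota> \<xi> p"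
      then consider "y \<in> V_line A' A \<iota> g \<phi> p" | "y \<in> U_line A' A \<iota> g S \<phi> p" | "y \<in> xi_line A' A \<iota> \<xi> p" by blast
      then show "g (\<iota> p) (d\<iota> p a) (d\<iota> p y) = 0"
      proof cases
        case 1
        then obtain k where "y = k *\<^sub>R v" using V_line by blast
        then show ?thesis by (simp add: d\<iota>_simps g_simps av)
      next
        case 2
        then obtain k where "d\<iota> p y = \<phi> (\<iota> p) (k *\<^sub>R N)"
          unfolding U_line_def ltr_eq span_singleton by blast
        then have "d\<iota> p y = k *\<^sub>R d\<iota> p u" by (simp add: \<phi>_simps u(2))
        then show ?thesis by (simp add: g_simps au)
      next
        case 3
        then obtain k where "d\<iota> p y = k *\<^sub>R \<xi> (\<iota> p)" unfolding xi_line_def span_singleton by blast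
        then show ?thesis by (simp add: g_simps a\<xi>)
      qed
    qed
    moreover have "x = a + r + l *\<^sub>R v" by (simp add: x(1) a_def)
    ultimately show "x \<in> D p" using x(3) vl unfolding D_dist_def by blast
  qed
qed

lemma D_xi_iff: "x \<in> D\<^sub>\<xi> p \<longleftrightarrow> u_form x = 0"
proof
  assume "x \<in> D\<^sub>\<xi> p"
  then obtain y z where x: "x = y + z" "y \<in> D p" "z \<in> xi_line A' A \<iota> \<xi> p"
    unfolding D_xi_def by blast
  obtain k where "d\<iota> p z = k *\<^sub>R \<xi> (\<iota> p)" using x(3) unfolding xi_line_def span_singleton by blast
  then show "u_form x = 0" using x(2) unfolding D_dist_iff x(1) by (simp add: d\<iota>_simps \<phi>_simps \<phi>\<xi> g_simps)
next
  assume ux: "u_form x = 0"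
  obtain x\<xi> where x\<xi>: "x\<xi> \<in> S p" "d\<iota> p x\<xi> = \<xi> (\<iota> p)" by (rule \<xi>_tangent)
  define k where "k = \<eta> (\<iota> p) (d\<iota> p x)"
  have "x - k *\<^sub>R x\<xi> \<in> D p"
    unfolding D_dist_iff using ux
    by (simp add: d\<iota>_simps x\<xi> \<phi>_simps \<phi>\<xi> g_simps linear_diff[OF \<eta>_linear] linear_cmul[OF \<eta>_linear] \<eta>\<xi> k_def)
  moreover have "k *\<^sub>R x\<xi> \<in> xi_line A' A \<iota> \<xi> p"
    unfolding xi_line_def by (simp add: d\<iota>_simps x\<xi> span_base span_scale)
  ultimately show "x \<in> D\<^sub>\<xi> p" unfolding D_xi_def by force
qed

lemma phi_tan_eq:
  assumes "u_form x = 0" shows "d\<iota> p (phiT p x) = \<phi> (\<iota> p) (d\<iota> p x)"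
proof -
  have "\<phi> (\<iota> p) (d\<iota> p x) \<in> range (d\<iota> p)" using assms range_d\<iota>_iff by blast
  then obtain z where z: "\<phi> (\<iota> p) (d\<iota> p x) = d\<iota> p z" by blast
  have "phiT p x = z"
    unfolding phi_tan_def
  proof (rule the_equality)
    have "0 \<in> ltr A' A \<iota> g S p" unfolding ltr_eq by (rule span_zero)
    then show "\<exists>N\<in>ltr A' A \<iota> g S p. \<phi> (\<iota> p) (d\<iota> p x) = d\<iota> p z + N" using z by force
    fix z' assume "\<exists>N\<in>ltr A' A \<iota> g S p. \<phi> (\<iota> p) (d\<iota> p x) = d\<iota> p z' + N"
    then obtain k where k: "d\<iota> p z = d\<iota> p z' + k *\<^sub>R N" unfolding ltr_eq span_singleton z by blast
    have "g (\<iota> p) (d\<iota> p z) (d\<iota> p e) = g (\<iota> p) (d\<iota> p z') (d\<iota> p e) + k"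
      unfolding k by (simp add: g_simps g_N_e)
    then have "k = 0" by (simp add: g_tangent_e)
    then show "z' = z" using k d\<iota>_eq_iff by simp
  qed
  then show ?thesis using z by simp
qed

lemma gauss_coefficient:
  "(THE b. \<exists>z. Z = d\<iota> p z + b *\<^sub>R N) = g (\<iota> p) Z (d\<iota> p e)"
proof (rule the_equality)
  have "g (\<iota> p) (Z - g (\<iota> p) Z (d\<iota> p e) *\<^sub>R N) (d\<iota> p e) = 0" by (simp add: g_simps g_N_e)
  then obtain z where "Z - g (\<iota> p) Z (d\<iota> p e) *\<^sub>R N = d\<iota> p z" using range_d\<iota>_iff by blast
  then have "Z = d\<iota> p z + g (\<iota> p) Z (d\<iota> p e) *\<^sub>R N" by (simp add: algebra_simps)
  then show "\<exists>z. Z = d\<iota> p z + g (\<iota> p) Z (d\<iota> p e) *\<^sub>R N" by blast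
  fix b assume "\<exists>z. Z = d\<iota> p z + b *\<^sub>R N"
  then show "b = g (\<iota> p) Z (d\<iota> p e)" by (auto simp: g_simps g_N_e g_tangent_e)
qed

end

end

context screen_semi_invariant_hypersurface
begin

section \<open>The bracket of sections and the second fundamental form\<close>

abbreviation u_at :: "'n \<Rightarrow> 'h \<Rightarrow> 'h \<Rightarrow> real" where
  "u_at p e x \<equiv> g (\<iota> p) (\<phi> (\<iota> p) (d\<iota> p x)) (d\<iota> p e)"

abbreviation cov :: "'n \<Rightarrow> 'h \<Rightarrow> ('n \<Rightarrow> 'e) \<Rightarrow> 'e" where
  "cov \<equiv> cov_along A' A \<iota> nabla"

lemma second_fundamental_form_eq:
  assumes "E p \<in> radical p" "E p \<noteq> 0"
  shows "B E X Y p = g (\<iota> p) (cov p (X p) (\<lambda>q. d\<iota> q (Y q))) (d\<iota> p (E p))"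
  unfolding second_fundamental_form_def by (rule gauss_coefficient[OF assms])

lemma sasakian_along:
  assumes W: "open W" "p \<in> W" and Z: "smooth_along W Z"
  shows "cov p w (\<lambda>q. \<phi> (\<iota> q) (Z q)) - \<phi> (\<iota> p) (cov p w Z) =
    - g (\<iota> p) (\<phi> (\<iota> p) (d\<iota> p w)) (\<phi> (\<iota> p) (Z p)) *\<^sub>R \<xi> (\<iota> p)
    - (\<epsilon> * \<eta> (\<iota> p) (Z p)) *\<^sub>R \<phi> (\<iota> p) (\<phi> (\<iota> p) (d\<iota> p w))"
proof -
  let ?d = "chart_at A (\<iota> p)"
  have "smooth_field_near A (\<iota> p) (coord_field A ?d (Z p))"
    by (rule amb.smooth_field_near[OF chart_facts(2)[OF amb.atlas amb.chart_at(1)] amb.chart_at(2)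
          amb.smooth_coord_field[OF amb.chart_at(1)]])
  then have "nabla (\<iota> p) (d\<iota> p w) (\<lambda>q. \<phi> q (coord_field A ?d (Z p) q)) - \<phi> (\<iota> p) (nabla (\<iota> p) (d\<iota> p w) (coord_field A ?d (Z p))) =
    - g (\<iota> p) (\<phi> (\<iota> p) (d\<iota> p w)) (\<phi> (\<iota> p) (coord_field A ?d (Z p) (\<iota> p))) *\<^sub>R \<xi> (\<iota> p)
    - (\<epsilon> * \<eta> (\<iota> p) (coord_field A ?d (Z p) (\<iota> p))) *\<^sub>R \<phi> (\<iota> p) (\<phi> (\<iota> p) (d\<iota> p w))"
    using sasakian unfolding eps_para_sasakian_def by blast
  then show ?thesis
    unfolding cov_along_tensor[OF conn W \<phi>_tensor Z] amb.coord_field_chart_at .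
qed

text \<open>The right-hand side of the para Sasakian identity is orthogonal to the radical, so that \<open>\<phi>\<close> commutes with
  covariant differentiation as far as the transversal component is concerned.\<close>

lemma sasakian_along_e:
  assumes e: "e \<in> radical p" "e \<noteq> 0" and W: "open W" "p \<in> W" and Z: "smooth_along W Z"
  shows "g (\<iota> p) (\<phi> (\<iota> p) (cov p w Z)) (d\<iota> p e) = g (\<iota> p) (cov p w (\<lambda>q. \<phi> (\<iota> q) (Z q))) (d\<iota> p e)"
proof -
  have "g (\<iota> p) (cov p w (\<lambda>q. \<phi> (\<iota> q) (Z q)) - \<phi> (\<iota> p) (cov p w Z)) (d\<iota> p e) = 0"
    unfolding sasakian_along[OF W Z] by (simp add: g_simps g_\<xi>_e[OF e] g_\<phi>\<phi>_tangent_e[OF e])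
  then show ?thesis by (simp add: g_simps)
qed

lemma cov_zero: "cov p w (\<lambda>_. 0) = 0"
proof -
  let ?d = "chart_at A (\<iota> p)" and ?c = "chart_at A' p"
  note od = chart_facts(2)[OF amb.atlas amb.chart_at(1)]
  have near: "smooth_field_near A (\<iota> p) (\<lambda>_. 0)"
    by (rule amb.smooth_field_near[OF open_UNIV UNIV_I amb.smooth_field_zero[OF open_UNIV]])
  have near': "smooth_field_near A (\<iota> p) (coord_field A ?d 0)"
    by (rule amb.smooth_field_near[OF od amb.chart_at(2) amb.smooth_coord_field[OF amb.chart_at(1)]])
  have "nabla (\<iota> p) v (coord_field A ?d 0) = nabla (\<iota> p) v (\<lambda>_. 0)" for v
    by (rule amb.nabla_local[OF conn od amb.chart_at(2) _ near' near])
      (simp add: linear_0[OF amb.coord_field_linear_A[OF amb.chart_at(1)]])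
  also have "nabla (\<iota> p) v (\<lambda>_. 0) = 0" for v
    using amb.nabla_add[OF conn near near, of v] by simp
  finally have "nabla (\<iota> p) v (coord_field A ?d 0) = 0" for v .
  moreover have "fderiv (along_rep ?c ?d (\<lambda>_. 0)) (snd ?c p) w = 0"
  proof (rule fderiv_applyI)
    show "(along_rep ?c ?d (\<lambda>_. 0) has_derivative (\<lambda>_. 0)) (at (snd ?c p))"
    proof (rule has_derivative_transform_within_open[OF has_derivative_const[of 0]])
      show "open (snd ?c ` (fst ?c \<inter> (\<iota> -` fst ?d \<inter> UNIV)))"
        by (rule open_along_dom[OF hyp.chart_at(1) amb.chart_at(1) open_UNIV])
      show "snd ?c p \<in> snd ?c ` (fst ?c \<inter> (\<iota> -` fst ?d \<inter> UNIV))" using hyp.chart_at(2) amb.chart_at(2) by auto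
      show "0 = along_rep ?c ?d (\<lambda>_. 0) x" if "x \<in> snd ?c ` (fst ?c \<inter> (\<iota> -` fst ?d \<inter> UNIV))" for x
        using that chart_facts(4)[OF hyp.atlas hyp.chart_at(1)]
        by (auto simp: linear_0[OF amb.coords_linear_A[OF amb.chart_at(1)]])
    qed
  qed
  ultimately show ?thesis by (simp add: cov_along_def Let_def)
qed

lemma u_bracket:
  assumes e: "e \<in> radical p" "e \<noteq> 0" and W: "open W" "p \<in> W"
    and X: "smooth_field A' W X" and Y: "smooth_field A' W Y"
  shows "u_at p e (lie_bracket A' X Y p) =
    g (\<iota> p) (cov p (X p) (\<lambda>q. \<phi> (\<iota> q) (d\<iota> q (Y q)))) (d\<iota> p e) -
    g (\<iota> p) (cov p (Y p) (\<lambda>q. \<phi> (\<iota> q) (d\<iota> q (X q)))) (d\<iota> p e)"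
  unfolding cov_along_torsion_free[OF levi_civita_nabla W X Y, symmetric]
  by (simp add: \<phi>_simps g_simps sasakian_along_e[OF e W smooth_along_differential[OF W(1) X]]
      sasakian_along_e[OF e W smooth_along_differential[OF W(1) Y]])

text \<open>This is the symmetry of the second fundamental form: the bracket of tangent fields is tangent.\<close>

lemma cov_swap:
  assumes e: "e \<in> radical p" "e \<noteq> 0" and W: "open W" "p \<in> W"
    and X: "smooth_field A' W X" and Y: "smooth_field A' W Y"
  shows "g (\<iota> p) (cov p (X p) (\<lambda>q. d\<iota> q (Y q))) (d\<iota> p e) = g (\<iota> p) (cov p (Y p) (\<lambda>q. d\<iota> q (X q))) (d\<iota> p e)"
proof -
  have "g (\<iota> p) (cov p (X p) (\<lambda>q. d\<iota> q (Y q)) - cov p (Y p) (\<lambda>q. d\<iota> q (X q))) (d\<iota> p e) = 0"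
    unfolding cov_along_torsion_free[OF levi_civita_nabla W X Y] by (rule g_tangent_e[OF e])
  then show ?thesis by (simp add: g_simps)
qed

lemma smooth_phi_tan:
  assumes W: "open W" and X: "smooth_field A' W X" "\<And>q. q \<in> W \<Longrightarrow> X q \<in> D\<^sub>\<xi> q"
  shows "smooth_field A' W (\<lambda>q. phiT q (X q))"
    and "q \<in> W \<Longrightarrow> d\<iota> q (phiT q (X q)) = \<phi> (\<iota> q) (d\<iota> q (X q))"
proof -
  show eq: "d\<iota> q (phiT q (X q)) = \<phi> (\<iota> q) (d\<iota> q (X q))" if "q \<in> W" for q
  proof -
    obtain e where e: "e \<noteq> 0" "e \<in> radical q" using Rad_nonzero by blast
    show ?thesis using phi_tan_eq[OF e(2,1)] D_xi_iff[OF e(2,1)] X(2)[OF that] by blast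
  qed
  show "smooth_field A' W (\<lambda>q. phiT q (X q))"
    by (rule smooth_field_of_along[OF W smooth_along_tensor[OF W \<phi>_tensor smooth_along_differential[OF W X(1)]] eq])
qed

lemma D_dist_imp_D_xi: "x \<in> D p \<Longrightarrow> x \<in> D\<^sub>\<xi> p"
proof -
  assume x: "x \<in> D p"
  obtain e where e: "e \<noteq> 0" "e \<in> radical p" using Rad_nonzero by blast
  show ?thesis using x D_dist_iff[OF e(2,1)] D_xi_iff[OF e(2,1)] by blast
qed

text \<open>On the kernel of \<open>u\<close>, \<open>\<phi>\<close> takes tangent values, so that the covariant derivatives in \<open>u_bracket\<close> are values of
  \<open>B\<close>; the second one is brought to the stated form by symmetry.\<close>

lemma u_bracket_second_fundamental_form:
  assumes W: "open W" "p \<in> W" and E: "E p \<in> radical p" "E p \<noteq> 0"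
    and X: "smooth_field A' W X" "\<And>q. q \<in> W \<Longrightarrow> X q \<in> D\<^sub>\<xi> q"
    and Y: "smooth_field A' W Y" "\<And>q. q \<in> W \<Longrightarrow> Y q \<in> D\<^sub>\<xi> q"
  shows "u_at p (E p) (lie_bracket A' X Y p) =
    B E X (\<lambda>q. phiT q (Y q)) p -
    B E (\<lambda>q. phiT q (X q)) Y p"
proof -
  have pX: "smooth_field A' W (\<lambda>q. phiT q (X q))"
    "\<And>q. q \<in> W \<Longrightarrow> d\<iota> q (phiT q (X q)) = \<phi> (\<iota> q) (d\<iota> q (X q))"
    using smooth_phi_tan[OF W(1) X] by blast+
  have pY: "smooth_field A' W (\<lambda>q. phiT q (Y q))"
    "\<And>q. q \<in> W \<Longrightarrow> d\<iota> q (phiT q (Y q)) = \<phi> (\<iota> q) (d\<iota> q (Y q))"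
    using smooth_phi_tan[OF W(1) Y] by blast+
  have 1: "cov p w (\<lambda>q. \<phi> (\<iota> q) (d\<iota> q (Y q))) = cov p w (\<lambda>q. d\<iota> q (phiT q (Y q)))" for w
    by (rule cov_along_local[OF W]) (simp add: pY(2))
  have 2: "cov p w (\<lambda>q. \<phi> (\<iota> q) (d\<iota> q (X q))) = cov p w (\<lambda>q. d\<iota> q (phiT q (X q)))" for w
    by (rule cov_along_local[OF W]) (simp add: pX(2))
  show ?thesis
    unfolding u_bracket[OF E W X(1) Y(1)] second_fundamental_form_eq[of E, OF E] 1 2
      cov_swap[OF E W Y(1) pX(1)] ..
qed

definition \<xi>_tan :: "'n \<Rightarrow> 'h" where
  "\<xi>_tan q = (SOME x. d\<iota> q x = \<xi> (\<iota> q))"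

lemma d\<iota>_\<xi>_tan: "d\<iota> q (\<xi>_tan q) = \<xi> (\<iota> q)"
proof -
  have "\<exists>x. d\<iota> q x = \<xi> (\<iota> q)" using \<xi>_screen[of q] by force
  then show ?thesis unfolding \<xi>_tan_def by (rule someI_ex)
qed

lemma \<xi>_tan_smooth: "open W \<Longrightarrow> smooth_field A' W \<xi>_tan"
  using smooth_field_of_along[OF _ smooth_along_restrict[OF _ \<xi>_smooth]] d\<iota>_\<xi>_tan by blast

text \<open>For the field \<open>\<xi>\<close> the para Sasakian identity reads \<open>\<phi> (\<nabla>\<^sub>Z \<xi>) = \<epsilon> \<phi>\<^sup>2 Z\<close>, so that \<open>\<nabla>\<^sub>Z \<xi>\<close> is \<open>\<epsilon> \<phi> Z\<close> up to a
  multiple of \<open>\<xi>\<close>. For \<open>Z = \<phi> X\<close> this is tangent, because \<open>\<phi>\<^sup>2 X\<close> is.\<close>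

lemma u_bracket_\<xi>:
  assumes W: "open W" "p \<in> W" and e: "e \<in> radical p" "e \<noteq> 0"
    and X: "smooth_field A' W X" "\<And>q. q \<in> W \<Longrightarrow> X q \<in> D\<^sub>\<xi> q"
  shows "u_at p e (lie_bracket A' X \<xi>_tan p) = 0"
proof -
  let ?P = "\<iota> p" and ?\<xi> = "\<lambda>q. d\<iota> q (\<xi>_tan q)" and ?Z = "\<lambda>q. phiT q (X q)"
  have pX: "smooth_field A' W (\<lambda>q. phiT q (X q))"
    "\<And>q. q \<in> W \<Longrightarrow> d\<iota> q (phiT q (X q)) = \<phi> (\<iota> q) (d\<iota> q (X q))"
    using smooth_phi_tan[OF W(1) X] by blast+
  note \<xi>s = \<xi>_tan_smooth[OF W(1)]
  have "(\<lambda>q. \<phi> (\<iota> q) (?\<xi> q)) = (\<lambda>_. 0)" by (simp add: d\<iota>_\<xi>_tan \<phi>\<xi>)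
  then have 1: "cov p w (\<lambda>q. \<phi> (\<iota> q) (?\<xi> q)) = 0" for w using cov_zero by simp
  have 2: "cov p w (\<lambda>q. \<phi> (\<iota> q) (d\<iota> q (X q))) = cov p w (\<lambda>q. d\<iota> q (?Z q))" for w
    by (rule cov_along_local[OF W]) (simp add: pX(2))
  define C where "C = cov p (?Z p) ?\<xi>"
  define v where "v = \<phi> ?P (d\<iota> p (X p))"
  have "0 - \<phi> ?P C = - g ?P (\<phi> ?P v) (\<phi> ?P (?\<xi> p)) *\<^sub>R \<xi> ?P - (\<epsilon> * \<eta> ?P (?\<xi> p)) *\<^sub>R \<phi> ?P (\<phi> ?P v)"
    using sasakian_along[OF W smooth_along_differential[OF W(1) \<xi>s], of "?Z p"]
    unfolding C_def v_def 1 pX(2)[OF W(2)] .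
  then have "\<phi> ?P C = \<epsilon> *\<^sub>R \<phi> ?P (\<phi> ?P v)" by (simp add: d\<iota>_\<xi>_tan \<phi>\<xi> \<eta>\<xi> g_simps)
  \<comment> \<open>Applying \<open>\<phi>\<close> once more recovers \<open>C\<close> up to a multiple of \<open>\<xi>\<close>.\<close>
  then have "\<phi> ?P (\<phi> ?P C) = \<phi> ?P (\<phi> ?P (\<epsilon> *\<^sub>R \<phi> ?P v))" by (simp add: \<phi>_simps)
  then have "C = \<eta> ?P C *\<^sub>R \<xi> ?P + \<epsilon> *\<^sub>R \<phi> ?P v"
    unfolding \<phi>\<phi>[of ?P C] \<phi>\<phi>[of ?P "\<epsilon> *\<^sub>R \<phi> ?P v"]
    by (simp add: linear_cmul[OF \<eta>_linear] \<eta>\<phi> algebra_simps)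
  then have "g ?P C (d\<iota> p e) = g ?P (\<eta> ?P C *\<^sub>R \<xi> ?P + \<epsilon> *\<^sub>R \<phi> ?P v) (d\<iota> p e)"
    by (rule arg_cong)
  also have "\<dots> = \<eta> ?P C * g ?P (\<xi> ?P) (d\<iota> p e) + \<epsilon> * g ?P (\<phi> ?P v) (d\<iota> p e)"
    by (simp add: g_simps)
  finally have "g ?P C (d\<iota> p e) = 0"
    by (simp add: g_\<xi>_e[OF e] v_def g_\<phi>\<phi>_tangent_e[OF e])
  then show ?thesis
    unfolding u_bracket[OF e W X(1) \<xi>s] 1 2 cov_swap[OF e W \<xi>s pX(1)] C_def by (simp add: g_simps)
qed

section \<open>Local sections\<close>

text \<open>The radical is the kernel of the symmetric Gram matrix \<open>G\<close> of the induced metric and has rank one.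
  If \<open>e\<^sub>0\<close> spans it at one point, then \<open>G + e\<^sub>0 e\<^sub>0\<^sup>T\<close> is invertible nearby and sends the element \<open>r\<close> of
  the radical with \<open>e\<^sub>0 \<bullet> r = 1\<close> to \<open>e\<^sub>0\<close>; thus this element depends smoothly on the point.\<close>

lemma local_radical_section:
  "\<exists>W E. open W \<and> p \<in> W \<and> section_on A' radical W E \<and> (\<forall>q\<in>W. E q \<noteq> 0)"
proof -
  define c where "c = chart_at A' p"
  have c: "c \<in> A'" "p \<in> fst c" using hyp.chart_at by (auto simp: c_def)
  obtain e0 where e0: "e0 \<in> radical p" "e0 \<noteq> 0" using Rad_nonzero by blast
  let ?S = "snd c ` fst c" and ?cf = "coord_field A' c"
  note oc = chart_facts(2)[OF hyp.atlas c(1)] and oS = chart_facts(3)[OF hyp.atlas c(1)]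
  define G where "G x v b = induced_metric A' A \<iota> g (chart_inv c x) (?cf v (chart_inv c x)) (?cf b (chart_inv c x))" for x v b
  define M where "M x v = (\<Sum>b\<in>Basis. G x v b *\<^sub>R b) + (e0 \<bullet> v) *\<^sub>R e0" for x v
  have Gq: "G (snd c q) v b = g (\<iota> q) (d\<iota> q (?cf v q)) (d\<iota> q (?cf b q))" if "q \<in> fst c" for q v b
    using chart_facts(4)[OF hyp.atlas c(1) that] by (simp add: G_def induced_metric_def)
  have Gs: "smooth_on ?S (\<lambda>x. G x v b)" for v b
  proof -
    have "smooth_fun A' (fst c) (\<lambda>q. g (\<iota> q) (d\<iota> q (?cf v q)) (d\<iota> q (?cf b q)))"
      by (intro smooth_fun_along_metric[OF oc metric] smooth_along_differential[OF oc] hyp.smooth_coord_field[OF c(1)])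
    then have "smooth_on (snd c ` (fst c \<inter> fst c)) ((\<lambda>q. g (\<iota> q) (d\<iota> q (?cf v q)) (d\<iota> q (?cf b q))) \<circ> chart_inv c)"
      using c(1) unfolding smooth_fun_def by blast
    then have "smooth_on ?S ((\<lambda>q. g (\<iota> q) (d\<iota> q (?cf v q)) (d\<iota> q (?cf b q))) \<circ> chart_inv c)"
      by (simp only: Int_absorb)
    then show ?thesis by (rule smooth_on_cong[OF _ oS]) (simp add: G_def induced_metric_def)
  qed
  have cfl: "linear (\<lambda>v. ?cf v q)" if "q \<in> fst c" for q by (rule hyp.coord_field_linear_A[OF c(1) that])
  have Gl: "linear (\<lambda>v. G x v b)" "linear (\<lambda>b. G x v b)" if "x \<in> ?S" for x v b
  proof -
    obtain q where q: "q \<in> fst c" "x = snd c q" using \<open>x \<in> ?S\<close> by blast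
    show "linear (\<lambda>v. G x v b)" "linear (\<lambda>b. G x v b)" unfolding q(2) Gq[OF q(1)]
      by (intro linearI; simp add: linear_add[OF cfl[OF q(1)]] linear_cmul[OF cfl[OF q(1)]] d\<iota>_simps g_simps)+
  qed
  have lM: "linear (M x)" if "x \<in> ?S" for x
    unfolding M_def
    by (intro linear_compose_add linear_compose_sum ballI)
      (auto intro!: linearI simp: linear_add[OF Gl(1)[OF that]] linear_cmul[OF Gl(1)[OF that]] inner_add_right algebra_simps)
  have sM: "smooth_on ?S (\<lambda>x. M x v)" for v
    unfolding M_def by (intro smooth_on_intros oS Gs)
  have Gsum: "(\<Sum>b\<in>Basis. G x v b *\<^sub>R b) \<bullet> w = G x v w" if "x \<in> ?S" for x v w
    using linear_expand_Basis[OF Gl(2)[OF that], of v w]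
    by (simp add: inner_sum_left inner_sum_right inner_commute[of _ w] mult.commute)
  have Rad_G: "?cf v q \<in> radical q \<longleftrightarrow> (\<forall>w. G (snd c q) v w = 0)" if q: "q \<in> fst c" for q v
    unfolding Rad_iff Gq[OF q] using hyp.coord_field_coords_A[OF c(1) q] by metis
  have cfp: "?cf v p = v" for v unfolding c_def by (rule hyp.coord_field_chart_at)
  have injp: "inj (M (snd c p))"
  proof -
    have xS: "snd c p \<in> ?S" using c by blast
    show ?thesis unfolding linear_injective_0[OF lM[OF xS]]
    proof (intro allI impI)
      fix v assume v: "M (snd c p) v = 0"
      have "G (snd c p) v e0 = 0" using e0(1) by (simp add: Gq[OF c(2)] cfp Rad_iff g_sym[of _ "d\<iota> p v"])
      moreover have "M (snd c p) v \<bullet> e0 = G (snd c p) v e0 + (e0 \<bullet> v) * (e0 \<bullet> e0)"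
        unfolding M_def inner_add_left Gsum[OF xS] by simp
      ultimately have ev: "e0 \<bullet> v = 0" using v e0(2) by simp
      then have "G (snd c p) v w = 0" for w
        using v Gsum[OF xS, of v w] unfolding M_def by simp
      then have "v \<in> radical p" using Rad_G[OF c(2), of v] cfp by simp
      then obtain k where "v = k *\<^sub>R e0" using Rad_eq_span[OF e0] by blast
      then show "v = 0" using ev e0(2) by simp
    qed
  qed
  obtain T where T: "open T" "snd c p \<in> T" "T \<subseteq> ?S" "\<And>x. x \<in> T \<Longrightarrow> inj (M x)"
    using eventually_inj_linear[OF oS _ lM injp smooth_on_imp_continuous_on[OF sM]] c by blast
  have "\<exists>y. M x y = e0 \<and> y \<noteq> 0 \<and> ?cf y (chart_inv c x) \<in> radical (chart_inv c x)" if x: "x \<in> T" for x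
  proof -
    have xS: "x \<in> ?S" using x T by blast
    obtain q where q: "q \<in> fst c" "x = snd c q" using xS by blast
    obtain r where r: "r \<noteq> 0" "r \<in> radical q" using Rad_nonzero by blast
    define y where "y = coords A' c q r"
    have cy: "?cf y q = r" unfolding y_def by (rule hyp.coord_field_coords_A[OF c(1) q(1)])
    have y0: "y \<noteq> 0" using cy r(1) linear_0[OF cfl[OF q(1)]] by auto
    have "G x y w = 0" for w using Rad_G[OF q(1), of y] r(2) cy q(2) by simp
    then have My: "M x y = (e0 \<bullet> y) *\<^sub>R e0" unfolding M_def by simp
    have "e0 \<bullet> y \<noteq> 0" using My y0 T(4)[OF x] linear_injective_0[OF lM[OF xS]] by auto
    then have "M x ((1 / (e0 \<bullet> y)) *\<^sub>R y) = e0" using My lM[OF xS] by (simp add: linear_cmul)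
    moreover have "?cf ((1 / (e0 \<bullet> y)) *\<^sub>R y) q \<in> radical q"
      using Rad_scaleR[OF r(2)] cy by (simp add: linear_cmul[OF cfl[OF q(1)]])
    ultimately show ?thesis using y0 \<open>e0 \<bullet> y \<noteq> 0\<close> chart_facts(4)[OF hyp.atlas c(1) q(1)] q(2)
      by (intro exI[of _ "(1 / (e0 \<bullet> y)) *\<^sub>R y"]) auto
  qed
  then obtain y where y: "\<And>x. x \<in> T \<Longrightarrow> M x (y x) = e0 \<and> y x \<noteq> 0 \<and> ?cf (y x) (chart_inv c x) \<in> radical (chart_inv c x)"
    by metis
  have ys: "smooth_on T y"
  proof (rule smooth_on_linear_solution[OF T(1), where M=M and b="\<lambda>_. e0"])
    show "smooth_on T (\<lambda>x. M x v)" for v by (rule smooth_on_subset[OF sM T(3)])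
  qed (use lM T y in \<open>auto intro: smooth_on_const\<close>)
  let ?W = "{q \<in> fst c. snd c q \<in> T}" and ?E = "\<lambda>q. ?cf (y (snd c q)) q"
  have "section_on A' radical ?W ?E"
    unfolding section_on_def
    using hyp.smooth_field_of_rep[OF c(1) T(1,3) ys] y chart_facts(4)[OF hyp.atlas c(1)] by fastforce
  moreover have "?E q \<noteq> 0" if "q \<in> ?W" for q
  proof
    assume "?E q = 0"
    then have "y (snd c q) = 0"
      using hyp.coords_coord_field_A[OF c(1), of q "y (snd c q)"] linear_0[OF hyp.coords_linear_A[OF c(1)]] that by simp
    then show False using y that by blast
  qed
  ultimately show ?thesis using chart_vimage_open[OF hyp.atlas c(1) T(1)] c T(2)
    by (intro exI[of _ ?W] exI[of _ ?E]) blast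
qed

section \<open>The integrability criterion\<close>

abbreviation B_symmetric :: bool where
  "B_symmetric \<equiv> (\<forall>W E. open W \<and> section_on A' radical W E \<and> (\<forall>p\<in>W. E p \<noteq> 0) \<longrightarrow>
      (\<forall>X Y. section_on A' D W X \<and>
             section_on A' D W Y \<longrightarrow>
        (\<forall>p\<in>W.
          B E X (\<lambda>q. phiT q (Y q)) p =
          B E (\<lambda>q. phiT q (X q)) Y p)))"

lemma integrable_imp_B_symmetric:
  assumes int: "integrable_distribution A' D\<^sub>\<xi>"
  shows B_symmetric
proof (intro allI impI ballI, elim conjE)
  fix W E X Y p
  assume W: "open W" and E: "section_on A' radical W E" "\<forall>p\<in>W. E p \<noteq> 0"
    and X: "section_on A' D W X" and Y: "section_on A' D W Y"
    and p: "p \<in> W"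
  have Ep: "E p \<in> radical p" "E p \<noteq> 0" using E p unfolding section_on_def by blast+
  have D: "section_on A' D\<^sub>\<xi> W X" "section_on A' D\<^sub>\<xi> W Y"
    using X Y D_dist_imp_D_xi unfolding section_on_def by blast+
  have "lie_bracket A' X Y p \<in> D\<^sub>\<xi> p"
    by (rule hyp.integrable_imp_involutive[OF int W p D])
  then have "u_at p (E p) (lie_bracket A' X Y p) = 0" using D_xi_iff[OF Ep] by blast
  moreover have XY: "smooth_field A' W X" "smooth_field A' W Y" "\<And>q. q \<in> W \<Longrightarrow> X q \<in> D\<^sub>\<xi> q"
    "\<And>q. q \<in> W \<Longrightarrow> Y q \<in> D\<^sub>\<xi> q"
    using D unfolding section_on_def by blast+
  ultimately show "B E X (\<lambda>q. phiT q (Y q)) p =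
      B E (\<lambda>q. phiT q (X q)) Y p"
    using u_bracket_second_fundamental_form[of W p E X Y, OF W p Ep XY(1,3,2,4)] by linarith
qed

text \<open>The hypothesis on \<open>B\<close> speaks of sections of \<open>D\<close>, while involutivity of \<open>u\<close> concerns all vectors of its kernel.
  A vector of the kernel is extended to a section of \<open>D\<close> after its component along \<open>\<xi>\<close> is split off; since the
  exterior derivative of \<open>u\<close> is tensorial, the remaining terms are brackets with \<open>\<xi>\<close>.\<close>

lemma B_symmetric_imp_integrable:
  assumes B: B_symmetric
  shows "integrable_distribution A' D\<^sub>\<xi>"
  unfolding integrable_distribution_def
proof
  fix p
  obtain W0 E where W0: "open W0" "p \<in> W0" "section_on A' radical W0 E" "\<forall>q\<in>W0. E q \<noteq> 0"
    using local_radical_section by blast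
  define c where "c = chart_at A' p"
  have c: "c \<in> A'" "p \<in> fst c" using hyp.chart_at by (auto simp: c_def)
  define W where "W = fst c \<inter> W0"
  have W: "open W" "p \<in> W" using chart_facts(2)[OF hyp.atlas c(1)] W0 c by (auto simp: W_def)
  have Wc: "q \<in> fst c" if "q \<in> W" for q using that by (simp add: W_def)
  have Es: "smooth_field A' W E" and E: "\<And>q. q \<in> W \<Longrightarrow> E q \<in> radical q" "\<And>q. q \<in> W \<Longrightarrow> E q \<noteq> 0"
    using W0(3,4) hyp.smooth_field_subset[of W0 E W] unfolding section_on_def by (auto simp: W_def)
  define u where "u q x = u_at q (E q) x" for q x
  let ?cf = "coord_field A' c" and ?\<Omega> = "snd c ` W" and ?rep = "local_rep A' c"
  have Om: "open ?\<Omega>" by (rule chart_image_open_subset[OF hyp.atlas c(1) W(1)]) (auto simp: W_def)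
  have lu: "linear (u q)" for q unfolding u_def by (intro linearI) (auto simp: d\<iota>_simps \<phi>_simps g_simps)
  have us: "smooth_fun A' W (\<lambda>q. u q (X q))" if "smooth_field A' W X" for X
    unfolding u_def
    by (intro smooth_fun_along_metric[OF W(1) metric] smooth_along_tensor[OF W(1) \<phi>_tensor]
        smooth_along_differential[OF W(1)] that Es)
  have cfs: "smooth_field A' W (?cf b)" for b
    by (rule hyp.smooth_field_subset[OF hyp.smooth_coord_field[OF c(1)]]) (auto simp: W_def)
  define \<omega> where "\<omega> x = (\<Sum>b\<in>Basis. u (chart_inv c x) (?cf b (chart_inv c x)) *\<^sub>R b)" for x
  have \<omega>_u: "\<omega> (snd c q) \<bullet> coords A' c q x = u q x" if "q \<in> W" for q x
  proof -
    have q: "q \<in> fst c" by (rule Wc[OF that])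
    have "linear (\<lambda>v. u q (?cf v q))"
      using linear_compose[OF hyp.coord_field_linear_A[OF c(1) q] lu] by (simp add: o_def)
    from linear_expand_Basis[OF this, of "coords A' c q x"] show ?thesis
      unfolding hyp.coord_field_coords_A[OF c(1) q]
      by (simp add: \<omega>_def chart_facts(4)[OF hyp.atlas c(1) q] inner_sum_left inner_sum_right inner_commute mult.commute)
  qed
  have \<omega>_cf: "\<omega> (snd c q) \<bullet> v = u q (?cf v q)" if "q \<in> W" for q v
    using \<omega>_u[OF that, of "?cf v q"] hyp.coords_coord_field_A[OF c(1) Wc[OF that]] by simp
  have \<omega>s: "smooth_on ?\<Omega> \<omega>"
    unfolding \<omega>_def
  proof (intro smooth_on_sum smooth_on_scaleR Om smooth_on_const)
    fix b
    have "smooth_on (snd c ` (fst c \<inter> W)) ((\<lambda>q. u q (?cf b q)) \<circ> chart_inv c)"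
      using us[OF cfs] c(1) unfolding smooth_fun_def by blast
    then show "smooth_on ?\<Omega> (\<lambda>x. u (chart_inv c x) (?cf b (chart_inv c x)))"
      by (simp add: W_def o_def)
  qed
  have \<omega>0: "\<exists>v. \<omega> (snd c q) \<bullet> v \<noteq> 0" if "q \<in> W" for q
    using u_form_nontrivial[OF E[OF that]] \<omega>_u[OF that] unfolding u_def by metis
  have D_xi_u: "x \<in> D\<^sub>\<xi> q \<longleftrightarrow> u q x = 0" if "q \<in> W" for q x
    unfolding u_def by (rule D_xi_iff[OF E[OF that]])
  have D_dist_u: "x \<in> D q \<longleftrightarrow> u q x = 0 \<and> \<eta> (\<iota> q) (d\<iota> q x) = 0" if "q \<in> W" for q x
    unfolding u_def by (rule D_dist_iff[OF E[OF that]])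
  have u\<xi>: "u q (\<xi>_tan q) = 0" for q by (simp add: u_def d\<iota>_\<xi>_tan \<phi>\<xi> g_simps)
  have \<xi>s: "smooth_field A' W \<xi>_tan" by (rule \<xi>_tan_smooth[OF W(1)])
  have u_br: "u q (lie_bracket A' X Y q) = 0"
    if q: "q \<in> W" and X: "section_on A' D W X"
      and Y: "section_on A' D W Y" for q X Y
  proof -
    have "section_on A' radical W E" using Es E(1) unfolding section_on_def by blast
    then have "B E X (\<lambda>q. phiT q (Y q)) q =
      B E (\<lambda>q. phiT q (X q)) Y q"
      using B[rule_format, of W E X Y q] W(1) E(2) X Y q by blast
    moreover have "smooth_field A' W X" "smooth_field A' W Y" "\<And>q. q \<in> W \<Longrightarrow> X q \<in> D\<^sub>\<xi> q"
      "\<And>q. q \<in> W \<Longrightarrow> Y q \<in> D\<^sub>\<xi> q"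
      using X Y D_dist_imp_D_xi unfolding section_on_def by blast+
    note u_bracket_second_fundamental_form[of W q E X Y, OF W(1) q E[OF q] this(1,3,2,4)]
    ultimately show ?thesis unfolding u_def by linarith
  qed
  define d\<omega> where "d\<omega> x v w = fderiv \<omega> x v \<bullet> w - fderiv \<omega> x w \<bullet> v" for x v w
  \<comment> \<open>Cartan's formula for the exterior derivative: the other terms vanish, as \<open>u\<close> is 0 on both fields.\<close>
  have d\<omega>_bracket: "d\<omega> (snd c q) (coords A' c q (X q)) (coords A' c q (Y q)) = - u q (lie_bracket A' X Y q)"
    if q: "q \<in> W" and X: "smooth_field A' W X" "\<And>q. q \<in> W \<Longrightarrow> u q (X q) = 0"
      and Y: "smooth_field A' W Y" "\<And>q. q \<in> W \<Longrightarrow> u q (Y q) = 0" for q X Y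
  proof -
    let ?x = "snd c q"
    have x: "?x \<in> ?\<Omega>" using q by blast
    have prod: "fderiv \<omega> ?x v \<bullet> ?rep X ?x = - (\<omega> ?x \<bullet> fderiv (?rep X) ?x v)"
      if X: "smooth_field A' W X" "\<And>q. q \<in> W \<Longrightarrow> u q (X q) = 0" for X v
    proof -
      have "smooth_on (snd c ` (fst c \<inter> W)) (?rep X)" using X(1) c(1) unfolding smooth_field_def by blast
      then have rX: "(?rep X has_derivative fderiv (?rep X) ?x) (at ?x)"
        by (rule smooth_on_has_derivative) (use q Wc in blast)
      have "((\<lambda>y. \<omega> y \<bullet> ?rep X y) has_derivative
          (\<lambda>v. \<omega> ?x \<bullet> fderiv (?rep X) ?x v + fderiv \<omega> ?x v \<bullet> ?rep X ?x)) (at ?x)"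
        by (rule has_derivative_inner[OF smooth_on_has_derivative[OF \<omega>s x] rX])
      then have "((\<lambda>y. 0) has_derivative
          (\<lambda>v. \<omega> ?x \<bullet> fderiv (?rep X) ?x v + fderiv \<omega> ?x v \<bullet> ?rep X ?x)) (at ?x)"
      proof (rule has_derivative_transform_within_open[OF _ Om x])
        fix y assume "y \<in> ?\<Omega>"
        then obtain q' where q': "q' \<in> W" "y = snd c q'" by blast
        show "\<omega> y \<bullet> ?rep X y = 0"
          unfolding q'(2) hyp.local_rep_apply_A[OF c(1) Wc[OF q'(1)]] \<omega>_u[OF q'(1)] by (rule X(2)[OF q'(1)])
      qed
      from fun_cong[OF has_derivative_unique[OF this has_derivative_const], of v] show ?thesis by linarith
    qed
    have "u q (lie_bracket A' X Y q) = \<omega> ?x \<bullet> (fderiv (?rep Y) ?x (?rep X ?x) - fderiv (?rep X) ?x (?rep Y ?x))"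
      unfolding \<omega>_u[OF q, symmetric] hyp.lie_bracket_chart_A[OF c(1) Wc[OF q] W(1) q X(1) Y(1)] ..
    also have "\<dots> = - (fderiv \<omega> ?x (?rep X ?x) \<bullet> ?rep Y ?x) + fderiv \<omega> ?x (?rep Y ?x) \<bullet> ?rep X ?x"
      using prod[of X "?rep Y ?x"] prod[of Y "?rep X ?x"] X Y by (simp only: inner_diff_right)
    finally show ?thesis
      unfolding hyp.local_rep_apply_A[OF c(1) Wc[OF q]] d\<omega>_def by simp
  qed
  have extend: "\<exists>X. section_on A' D W X \<and> X q = x - \<eta> (\<iota> q) (d\<iota> q x) *\<^sub>R \<xi>_tan q"
    if q: "q \<in> W" and x: "u q x = 0" for q x
  proof -
    obtain v1 where v1: "\<omega> (snd c q) \<bullet> v1 \<noteq> 0" using \<omega>0[OF q] by blast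
    define b where "b = (1 / u q (?cf v1 q)) *\<^sub>R v1"
    have q': "q \<in> fst c" by (rule Wc[OF q])
    have ub: "u q (?cf b q) = 1"
      using v1 unfolding \<omega>_cf[OF q] b_def
      by (simp add: linear_cmul[OF hyp.coord_field_linear_A[OF c(1) q']] linear_cmul[OF lu])
    define a where "a = coords A' c q x"
    \<comment> \<open>A field with \<open>u (X0) = 0\<close>, by its form, and with the value \<open>x\<close> at \<open>q\<close>, where \<open>u b = 1\<close> and \<open>u x = 0\<close>.\<close>
    define X0 where "X0 r = u r (?cf b r) *\<^sub>R ?cf a r - u r (?cf a r) *\<^sub>R ?cf b r" for r
    have X0s: "smooth_field A' W X0" unfolding X0_def
      by (intro hyp.smooth_field_diff hyp.smooth_field_scaleR W us cfs)
    have X0u: "u r (X0 r) = 0" for r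
      by (simp add: X0_def linear_diff[OF lu] linear_cmul[OF lu])
    have caq: "?cf a q = x" unfolding a_def by (rule hyp.coord_field_coords_A[OF c(1) q'])
    have X0q: "X0 q = x" by (simp add: X0_def caq ub x)
    define X where "X r = X0 r - (\<epsilon> * g (\<iota> r) (d\<iota> r (X0 r)) (d\<iota> r (\<xi>_tan r))) *\<^sub>R \<xi>_tan r" for r
    have X_eq: "X r = X0 r - \<eta> (\<iota> r) (d\<iota> r (X0 r)) *\<^sub>R \<xi>_tan r" for r
      unfolding X_def d\<iota>_\<xi>_tan \<eta>_eq ..
    have "smooth_fun A' W (\<lambda>r. g (\<iota> r) (\<epsilon> *\<^sub>R d\<iota> r (X0 r)) (d\<iota> r (\<xi>_tan r)))"
    proof -
      have "smooth_along W (\<lambda>r. d\<iota> r (\<epsilon> *\<^sub>R X0 r))"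
        by (intro smooth_along_differential[OF W(1)] hyp.smooth_field_scaleR W X0s hyp.smooth_fun_const)
      then show ?thesis
        unfolding d\<iota>_simps by (intro smooth_fun_along_metric[OF W(1) metric] smooth_along_differential[OF W(1) \<xi>s])
    qed
    then have "smooth_field A' W X" unfolding X_def
      by (intro hyp.smooth_field_diff hyp.smooth_field_scaleR W X0s \<xi>s) (simp add: g_simps)
    moreover have "X r \<in> D r" if "r \<in> W" for r
      unfolding D_dist_u[OF that] X_eq
      by (simp add: linear_diff[OF lu] linear_cmul[OF lu] X0u u\<xi> d\<iota>_simps d\<iota>_\<xi>_tan
          linear_diff[OF \<eta>_linear] linear_cmul[OF \<eta>_linear] \<eta>\<xi>)
    ultimately show ?thesis using X_eq[of q] X0q unfolding section_on_def by auto
  qed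
  have involutive: "fderiv \<omega> x v \<bullet> w = fderiv \<omega> x w \<bullet> v"
    if x: "x \<in> ?\<Omega>" and v: "\<omega> x \<bullet> v = 0" and w: "\<omega> x \<bullet> w = 0" for x v w
  proof -
    obtain q where q: "q \<in> W" "x = snd c q" using x by blast
    have q': "q \<in> fst c" by (rule Wc[OF q(1)])
    note lc = hyp.coords_linear_A[OF c(1) q']
    have uv: "u q (?cf v q) = 0" "u q (?cf w q) = 0" using v w unfolding q(2) \<omega>_cf[OF q(1)] by auto
    define r where "r = \<eta> (\<iota> q) (d\<iota> q (?cf v q))"
    define s where "s = \<eta> (\<iota> q) (d\<iota> q (?cf w q))"
    obtain X where X: "section_on A' D W X" "X q = ?cf v q - r *\<^sub>R \<xi>_tan q"
      using extend[OF q(1) uv(1)] unfolding r_def by blast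
    obtain Y where Y: "section_on A' D W Y" "Y q = ?cf w q - s *\<^sub>R \<xi>_tan q"
      using extend[OF q(1) uv(2)] unfolding s_def by blast
    define v' where "v' = coords A' c q (X q)"
    define w' where "w' = coords A' c q (Y q)"
    define z where "z = coords A' c q (\<xi>_tan q)"
    have v': "v = v' + r *\<^sub>R z" and w': "w = w' + s *\<^sub>R z"
      by (simp_all add: v'_def w'_def z_def X(2) Y(2) linear_diff[OF lc] linear_cmul[OF lc]
          hyp.coords_coord_field_A[OF c(1) q'])
    have sX: "smooth_field A' W X" and uX: "\<And>q. q \<in> W \<Longrightarrow> u q (X q) = 0"
      and sY: "smooth_field A' W Y" and uY: "\<And>q. q \<in> W \<Longrightarrow> u q (Y q) = 0"
      using X(1) Y(1) D_dist_u unfolding section_on_def by blast+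
    have b\<xi>: "u q (lie_bracket A' X \<xi>_tan q) = 0"
      if "smooth_field A' W X" "\<And>q. q \<in> W \<Longrightarrow> u q (X q) = 0" for X
      unfolding u_def by (rule u_bracket_\<xi>[OF W(1) q(1) E[OF q(1)] that(1)]) (simp add: D_xi_u that(2))
    have "d\<omega> x v' w' = 0"
      using d\<omega>_bracket[OF q(1) sX uX sY uY] u_br[OF q(1) X(1) Y(1)] by (simp add: v'_def w'_def q(2))
    moreover have "d\<omega> x v' z = 0"
      using d\<omega>_bracket[OF q(1) sX uX \<xi>s u\<xi>] b\<xi>[OF sX uX] by (simp add: v'_def z_def q(2))
    moreover have "d\<omega> x w' z = 0"
      using d\<omega>_bracket[OF q(1) sY uY \<xi>s u\<xi>] b\<xi>[OF sY uY] by (simp add: w'_def z_def q(2))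
    moreover have "linear (fderiv \<omega> x)" by (rule smooth_on_linear_fderiv[OF \<omega>s x])
    ultimately show ?thesis
      unfolding v' w' d\<omega>_def by (simp add: linear_add linear_cmul inner_add_left inner_add_right)
  qed
  show "\<exists>S'. p \<in> S' \<and> integral_manifold A' D\<^sub>\<xi> S'"
  proof (rule hyp.frobenius_codimension_one[OF c Om _ \<omega>s _ _ involutive])
    show "snd c p \<in> ?\<Omega>" using W by blast
    show "\<omega> (snd c p) \<noteq> 0" using \<omega>0[OF W(2)] by auto
    fix q assume q: "q \<in> fst c" "snd c q \<in> ?\<Omega>"
    then obtain q' where "q' \<in> W" "snd c q = snd c q'" by auto
    then have "q \<in> W" using chart_facts(4)[OF hyp.atlas c(1)] q(1) Wc by metis
    then show "D\<^sub>\<xi> q = {v. \<omega> (snd c q) \<bullet> coords A' c q v = 0}"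
      by (auto simp: D_xi_u \<omega>_u)
  qed
qed

end

theorem theorem6p6:
  fixes A :: "('m::{t2_space,second_countable_topology}, 'e::euclidean_space) chart set"
    and \<phi> :: "'m \<Rightarrow> 'e \<Rightarrow> 'e" and \<xi> :: "'m \<Rightarrow> 'e" and \<eta> :: "'m \<Rightarrow> 'e \<Rightarrow> real"
    and g :: "'m \<Rightarrow> 'e \<Rightarrow> 'e \<Rightarrow> real" and \<epsilon> :: real
    and nabla :: "'m \<Rightarrow> 'e \<Rightarrow> ('m \<Rightarrow> 'e) \<Rightarrow> 'e"
    and A' :: "('n::{t2_space,second_countable_topology}, 'h::euclidean_space) chart set"
    and \<iota> :: "'n \<Rightarrow> 'm" and S :: "'n \<Rightarrow> 'h set" and n :: nat
  assumes "smooth_atlas A" and "DIM('e) = n + 2"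
    and "eps_para_sasakian A \<phi> \<xi> \<eta> g \<epsilon> nabla"
    and "smooth_atlas A'" and "lightlike_hypersurface A' A \<iota> g"
    and "screen_distribution A' A \<iota> g S"
    and "\<forall>p. \<xi> (\<iota> p) \<in> differential A' A \<iota> p ` S p"
    and "screen_semi_invariant A' A \<iota> g S \<phi>"
  shows "integrable_distribution A' (D_xi A' A \<iota> g S \<phi> \<xi>) \<longleftrightarrow>
    (\<forall>W E. open W \<and> section_on A' (Rad A' A \<iota> g) W E \<and> (\<forall>p\<in>W. E p \<noteq> 0) \<longrightarrow>
      (\<forall>X Y. section_on A' (D_dist A' A \<iota> g S \<phi> \<xi>) W X \<and>
             section_on A' (D_dist A' A \<iota> g S \<phi> \<xi>) W Y \<longrightarrow>
        (\<forall>p\<in>W.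
          second_fundamental_form A' A \<iota> g S nabla E X (\<lambda>q. phi_tan A' A \<iota> g S \<phi> q (Y q)) p =
          second_fundamental_form A' A \<iota> g S nabla E (\<lambda>q. phi_tan A' A \<iota> g S \<phi> q (X q)) Y p)))"
proof -
  interpret screen_semi_invariant_hypersurface A A' \<iota> \<phi> \<xi> \<eta> g \<epsilon> nabla S
    using assms unfolding lightlike_hypersurface_def immersed_hypersurface_def
    by unfold_locales auto
  show ?thesis using integrable_imp_B_symmetric B_symmetric_imp_integrable by blast
qed

end
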